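(* Consider the flowmap of a stochastic differential system driven by independent Lévy processes with moments of all orders. Assume the flowmap possesses a separated stochastic Taylor expansion $\sum_{w\in\mathbb A^*}I_w(t)\tilde V_w$, and the vector fields are sufficiently smooth to ensure convergence of the truncated stochastic Taylor integration schemes to all orders. Let $n\in\mathbb N$ be a truncation level. Then: (a) The antisymmetric sign reverse integrator at truncation level $n$ is efficient in the sense that its local leading order mean-square error is never larger than that of the stochastic Taylor scheme of the same order truncated according to word length, independently of the driving vector fields and of the initial conditions: at leading order (i.e. for the parts of the remainders indexed by words of length $n+1$), $$\bigl\|R_t^{\mathrm{ASRI}}(y_0)\bigr\|_{L^2}^2\leqslant\bigl\|R_t^{\mathrm{wl}}(y_0)\bigr\|_{L^2}^2,$$ where at leading order $$R_t^{\mathrm{ASRI}}(y_0)=\sum_{|w|=n+1}\tfrac12\bigl(I_w(t)-I_{S(w)}(t)\bigr)\tilde V_w(y_0),\qquad R_t^{\mathrm{wl}}(y_0)=\sum_{|w|=n+1}I_w(t)\tilde V_w(y_0).$$ (b) When $n$ is odd, the antisymmetric sign reverse integrator is optimal in the following sense. Let $Z$ be any linear endomorphism of $\mathbb R\langle\mathbb A\rangle$ satisfying $|S|(Z(w))=Z(w)$ for all words $w$ of length $n+1$, let $\epsilon\in\mathbb R$, and replace $\tfrac12(\mathrm{id}-S)$ by the perturbation $\tfrac12(\mathrm{id}-S)+\epsilon Z$, so that the leading order remainder becomes $$R_t^{\epsilon}(y_0)=\sum_{|w|=n+1}\Bigl(\tfrac12\bigl(I_w(t)-I_{S(w)}(t)\bigr)+\epsilon\,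 I_{Z(w)}(t)\Bigr)\tilde V_w(y_0).$$ Then the difference $\|R_t^{\epsilon}(y_0)\|_{L^2}^2-\|R_t^{\mathrm{wl}}(y_0)\|_{L^2}^2$ of the two quantities in the inequality of (a) is minimized when the perturbation is zero, i.e. at $\epsilon=0$.
   Context: Setting: an It\^o equation on $\mathbb R^N$, $y_t=y_0+\sum_{i=0}^d\int_0^tV_i(y_s)\,\mathrm dW^i_s+\sum_{i=d+1}^\ell\int_0^tV_i(y_{s_-})\,\mathrm dJ^i_s$, where $W^0_t\equiv t$, $W^1,\dots,W^d$ are Wiener processes, and $J^i_t=\int_0^t\int_{\mathbb R}v\,\overline Q^i(\mathrm dv,\mathrm ds)$ for $d<i\le\ell$, $\overline Q^i$ being the compensation of a Poisson measure with intensity $\rho^i(\mathrm dv)\mathrm ds$, $\rho^i(\{0\})=0$, $\int(1\wedge v^2)\rho^i(\mathrm dv)<\infty$. All these processes are independent and the $J^i$ have moments of all orders. The initial data satisfies $y_0\in L^2(\Omega,\mathcal F_0,P)$. Extended alphabet: for $d<i\le\ell$, $p\ge2$, put $J^{i^{(p)}}_t=\int_0^t\int_{\mathbb R}v^p\,\overline Q^i(\mathrm dv,\mathrm ds)$. The alphabet $\mathbb A$ consists of $0,1,\dots,\ell$ (associated with $W^0,\dots,W^d,J^{d+1},\dots,J^\ell$) together with the letters $i^{(p)}$ (associated with $J^{i^{(p)}}$) for which $J^{i^{(p)}}$ is not in the linear span of $\{t,J^i,J^{i^{(2)}},\dots,J^{i^{(p-1)}}\}$. $\mathbb A^*$ is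 the set of words over $\mathbb A$, $|w|$ the length of $w$, and $\mathbb R\langle\mathbb A\rangle$ the vector space with basis $\mathbb A^*$. With $Z^a$ the process associated with letter $a$, $I_w(t)=\int_{0<\tau_1<\cdots<\tau_m<t}\mathrm dZ^{a_1}_{\tau_1}\cdots\mathrm dZ^{a_m}_{\tau_m}$ for $w=a_1\ldots a_m$ ($I_w=1$ for the empty word), extended linearly in $w$ to $\mathbb R\langle\mathbb A\rangle$. A separated stochastic Taylor expansion is a representation of the flowmap $y_0\mapsto y_t$ as $\sum_{w\in\mathbb A^*}I_w(t)\tilde V_w$, where $\tilde V_w=\tilde V_{a_1}\circ\cdots\circ\tilde V_{a_m}$ are compositions of operators $\tilde V_a$, $a\in\mathbb A$, not depending on $t$ or the randomness; $\tilde V_w(y_0)$ denotes $\tilde V_w$ applied to the identity map, evaluated at $y_0$. The series in the statement are assumed to converge in $L^2$. Reversal maps: $|S|$ and $S$ are the linear endomorphisms of $\mathbb R\langle\mathbb A\rangle$ with $|S|(a_1\ldots a_m)=a_m\ldots a_1$ and $S(a_1\ldots a_m)=(-1)^ma_m\ldots a_1$. Schemes: the stochastic Taylor scheme truncated by word length at level $n$ is $\sum_{|w|\le n}I_w(t)\tilde V_w$. The antisymmetric sign reverse integrator at level $n$ is the (direct map-truncate-invert) scheme associated with the endomorphism $\tfrac12(\mathrm{id}-S)$ truncated by word length, namely the approximate flow $\sum_{|w|\le n}I_w(t)\tilde V_w+\sum_{|w|=n+1}\tfrac12I_{w+S(w)}(t)\tilde V_w$. The remainder of a scheme is the exact flow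 minus the approximate flow. *)

theory Defs
  imports "HOL-Probability.Probability" "HOL-Analysis.Finite_Function_Topology"
begin

section \<open>Convergence in mean square\<close>

definition L2 :: "'a measure \<Rightarrow> ('a \<Rightarrow> 'b::real_normed_vector) \<Rightarrow> bool" where
  "L2 M X \<longleftrightarrow> X \<in> borel_measurable M \<and> integrable M (\<lambda>\<omega>. (norm (X \<omega>))\<^sup>2)"

definition L2_normsq :: "'a measure \<Rightarrow> ('a \<Rightarrow> 'b::real_normed_vector) \<Rightarrow> real" where
  "L2_normsq M X = (\<integral>\<omega>. (norm (X \<omega>))\<^sup>2 \<partial>M)"

definition L2_tendsto ::
    "'a measure \<Rightarrow> ('i \<Rightarrow> 'a \<Rightarrow> 'b::real_normed_vector) \<Rightarrow> ('a \<Rightarrow> 'b) \<Rightarrow> 'i filter \<Rightarrow> bool" where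
  "L2_tendsto M X Y G \<longleftrightarrow> L2 M Y \<and> (\<forall>\<^sub>F i in G. L2 M (X i)) \<and>
     ((\<lambda>i. L2_normsq M (\<lambda>\<omega>. X i \<omega> - Y \<omega>)) \<longlongrightarrow> 0) G"

text \<open>Sum of an unordered (possibly infinite) family, as the limit over the finite subfamilies.\<close>

definition L2_has_sum ::
    "'a measure \<Rightarrow> ('i \<Rightarrow> 'a \<Rightarrow> 'b::real_normed_vector) \<Rightarrow> 'i set \<Rightarrow> ('a \<Rightarrow> 'b) \<Rightarrow> bool" where
  "L2_has_sum M f A Y \<longleftrightarrow> (\<forall>i\<in>A. L2 M (f i)) \<and>
     L2_tendsto M (\<lambda>B \<omega>. \<Sum>i\<in>B. f i \<omega>) Y (finite_subsets_at_top A)"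


section \<open>The It\^o integral for square integrable integrands\<close>

definition cadlag :: "(real \<Rightarrow> 'b::topological_space) \<Rightarrow> bool" where
  "cadlag f \<longleftrightarrow> (\<forall>t\<ge>0. continuous (at_right t) f) \<and> (\<forall>t>0. \<exists>x. (f \<longlongrightarrow> x) (at_left t))"

definition left_limit :: "(real \<Rightarrow> 'a \<Rightarrow> 'b::t2_space) \<Rightarrow> real \<Rightarrow> 'a \<Rightarrow> 'b" where
  "left_limit X s \<omega> = Lim (at_left s) (\<lambda>u. X u \<omega>)"

definition cadlag_adapted ::
    "'a measure \<Rightarrow> (real \<Rightarrow> 'a measure) \<Rightarrow> (real \<Rightarrow> 'a \<Rightarrow> 'b::topological_space) \<Rightarrow> bool" where
  "cadlag_adapted M F X \<longleftrightarrow>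
     (\<forall>t\<ge>0. X t \<in> borel_measurable (F t)) \<and> (\<forall>\<omega>\<in>space M. cadlag (\<lambda>t. X t \<omega>))"

text \<open>
  The data \<open>(k, \<tau>, \<xi>)\<close> encode the simple predictable process
  $\sum_{j<k}\xi_j 1_{(\tau_j,\tau_{j+1}]}$.
\<close>

definition simple_integrand ::
    "'a measure \<Rightarrow> (real \<Rightarrow> 'a measure) \<Rightarrow> nat \<Rightarrow> (nat \<Rightarrow> real) \<Rightarrow> (nat \<Rightarrow> 'a \<Rightarrow> real) \<Rightarrow> bool" where
  "simple_integrand M F k \<tau> \<xi> \<longleftrightarrow> 0 \<le> \<tau> 0 \<and>
     (\<forall>j<k. \<tau> j \<le> \<tau> (Suc j) \<and> \<xi> j \<in> borel_measurable (F (\<tau> j)) \<and> bounded (\<xi> j ` space M))"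

definition simple_process :: "nat \<Rightarrow> (nat \<Rightarrow> real) \<Rightarrow> (nat \<Rightarrow> 'a \<Rightarrow> real) \<Rightarrow> real \<Rightarrow> 'a \<Rightarrow> real" where
  "simple_process k \<tau> \<xi> s \<omega> = (\<Sum>j<k. \<xi> j \<omega> * indicator {\<tau> j <.. \<tau> (Suc j)} s)"

definition simple_integral ::
    "(real \<Rightarrow> 'a \<Rightarrow> real) \<Rightarrow> nat \<Rightarrow> (nat \<Rightarrow> real) \<Rightarrow> (nat \<Rightarrow> 'a \<Rightarrow> real) \<Rightarrow> real \<Rightarrow> 'a \<Rightarrow> real" where
  "simple_integral X k \<tau> \<xi> t \<omega> =
     (\<Sum>j<k. \<xi> j \<omega> * (X (min (\<tau> (Suc j)) t) \<omega> - X (min (\<tau> j) t) \<omega>))"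

text \<open>
  \<open>ito_integral M F X H t Y\<close> says that $Y$ is a version of $\int_0^t H_s\,dX_s$. All integrators
  below are either $t$ or square integrable martingales whose predictable quadratic variation is a
  multiple of $t$, so the relevant norm on integrands is that of $L^2((0,t]\times\Omega, ds\otimes P)$.
\<close>

definition ito_integral ::
    "'a measure \<Rightarrow> (real \<Rightarrow> 'a measure) \<Rightarrow> (real \<Rightarrow> 'a \<Rightarrow> real) \<Rightarrow> (real \<Rightarrow> 'a \<Rightarrow> real) \<Rightarrow>
     real \<Rightarrow> ('a \<Rightarrow> real) \<Rightarrow> bool" where
  "ito_integral M F X H t Y \<longleftrightarrow>
     (\<lambda>(s, \<omega>). H s \<omega>) \<in> borel_measurable (restrict_space lborel {0<..t} \<Otimes>\<^sub>M M) \<and>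
     (\<exists>k \<tau> \<xi>. (\<forall>n::nat. simple_integrand M F (k n) (\<tau> n) (\<xi> n)) \<and>
        ((\<lambda>n. \<integral>\<^sup>+ (s, \<omega>). ennreal ((simple_process (k n) (\<tau> n) (\<xi> n) s \<omega> - H s \<omega>)\<^sup>2)
                 \<partial>(restrict_space lborel {0<..t} \<Otimes>\<^sub>M M)) \<longlonglongrightarrow> 0) \<and>
        L2_tendsto M (\<lambda>n. simple_integral X (k n) (\<tau> n) (\<xi> n) t) Y sequentially)"


section \<open>Driving noise\<close>

definition levy_measure :: "real measure \<Rightarrow> bool" where
  "levy_measure \<rho> \<longleftrightarrow> sets \<rho> = sets borel \<and> emeasure \<rho> {0} = 0 \<and>
     (\<integral>\<^sup>+ v. ennreal (min 1 (v\<^sup>2)) \<partial>\<rho>) < \<infinity>"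

definition intensity :: "real measure \<Rightarrow> (real \<times> real) measure" where
  "intensity \<rho> = \<rho> \<Otimes>\<^sub>M density lborel (indicator {0<..})"

text \<open>Points of the random measure are pairs (jump size, jump time).\<close>

definition poisson_measure ::
    "'a measure \<Rightarrow> real measure \<Rightarrow> ('a \<Rightarrow> (real \<times> real) measure) \<Rightarrow> bool" where
  "poisson_measure M \<rho> Q \<longleftrightarrow>
     (\<forall>\<omega>\<in>space M. sets (Q \<omega>) = sets borel) \<and>
     (\<forall>B\<in>sets borel. (\<lambda>\<omega>. emeasure (Q \<omega>) B) \<in> borel_measurable M) \<and>
     (\<forall>B\<in>sets borel. emeasure (intensity \<rho>) B < \<infinity> \<longrightarrow>
        (\<forall>k. measure M {\<omega>\<in>space M. emeasure (Q \<omega>) B = of_nat k} =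
           measure (intensity \<rho>) B ^ k / fact k * exp (- measure (intensity \<rho>) B))) \<and>
     (\<forall>(m::nat) B. (\<forall>j<m. B j \<in> sets borel) \<and> disjoint_family_on B {..<m} \<longrightarrow>
        prob_space.indep_vars M (\<lambda>_. borel) (\<lambda>j \<omega>. emeasure (Q \<omega>) (B j)) {..<m})"

text \<open>
  $X_t=\int_0^t\int_{\mathbb R} g(v)\,\overline Q(dv,ds)$ for $g\in L^2(\rho)$. If $\rho$ has infinite
  mass near $0$ the integral need not exist path by path; it is the mean-square limit of the
  integrals over jumps of size larger than $\delta$.
\<close>

definition compensated_integral ::
    "'a measure \<Rightarrow> real measure \<Rightarrow> ('a \<Rightarrow> (real \<times> real) measure) \<Rightarrow> (real \<Rightarrow> real) \<Rightarrow>
     (real \<Rightarrow> 'a \<Rightarrow> real) \<Rightarrow> bool" where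
  "compensated_integral M \<rho> Q g X \<longleftrightarrow> L2 \<rho> g \<and>
     (\<forall>t\<ge>0. L2_tendsto M
        (\<lambda>\<delta> \<omega>. (LINT z:{v. \<bar>v\<bar> > \<delta>} \<times> {0<..t}|Q \<omega>. g (fst z)) - t * (LINT v:{v. \<bar>v\<bar> > \<delta>}|\<rho>. g v))
        (X t) (at_right 0))"

definition wiener_process ::
    "'a measure \<Rightarrow> (real \<Rightarrow> 'a measure) \<Rightarrow> (real \<Rightarrow> 'a \<Rightarrow> real) \<Rightarrow> bool" where
  "wiener_process M F X \<longleftrightarrow>
     (\<forall>\<omega>\<in>space M. X 0 \<omega> = 0 \<and> continuous_on {0..} (\<lambda>t. X t \<omega>)) \<and>
     (\<forall>t\<ge>0. X t \<in> borel_measurable (F t)) \<and>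
     (\<forall>s t. 0 \<le> s \<and> s < t \<longrightarrow>
        distributed M lborel (\<lambda>\<omega>. X t \<omega> - X s \<omega>) (normal_density 0 (sqrt (t - s))) \<and>
        prob_space.indep_set M (sets (F s))
          {(\<lambda>\<omega>. X t \<omega> - X s \<omega>) -` B \<inter> space M | B. B \<in> sets borel})"

text \<open>Events generating the $i$-th noise (increments of $W^i$, resp. the measure $Q^i$) after time $s$.\<close>

definition noise_after ::
    "'a measure \<Rightarrow> nat \<Rightarrow> (nat \<Rightarrow> real \<Rightarrow> 'a \<Rightarrow> real) \<Rightarrow> (nat \<Rightarrow> 'a \<Rightarrow> (real \<times> real) measure) \<Rightarrow>
     real \<Rightarrow> nat \<Rightarrow> 'a set set" where
  "noise_after M d W Q s i =
     (if i \<le> d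
      then {(\<lambda>\<omega>. W i u \<omega> - W i s \<omega>) -` C \<inter> space M | u C. s \<le> u \<and> C \<in> sets borel}
      else {(\<lambda>\<omega>. emeasure (Q i \<omega>) B) -` C \<inter> space M | B C.
              B \<in> sets borel \<and> B \<subseteq> UNIV \<times> {s<..} \<and> C \<in> sets borel})"

text \<open>\<open>J i p\<close> is the process $\int_0^t\int v^p\,\overline Q^i(dv,ds)$, so \<open>J i 1\<close> is $J^i$.\<close>

locale levy_noise = prob_space M + filtration "space M" F
  for M :: "'a measure" and F :: "real \<Rightarrow> 'a measure" +
  fixes d l :: nat
    and W :: "nat \<Rightarrow> real \<Rightarrow> 'a \<Rightarrow> real"
    and \<rho> :: "nat \<Rightarrow> real measure"
    and Q :: "nat \<Rightarrow> 'a \<Rightarrow> (real \<times> real) measure"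
    and J :: "nat \<Rightarrow> nat \<Rightarrow> real \<Rightarrow> 'a \<Rightarrow> real"
  assumes d_le_l: "d \<le> l"
    and subalg: "\<And>t. subalgebra M (F t)"
    and wiener: "\<And>i. i \<in> {1..d} \<Longrightarrow> wiener_process M F (W i)"
    and levy: "\<And>i. i \<in> {d<..l} \<Longrightarrow> levy_measure (\<rho> i)"
    and poisson: "\<And>i. i \<in> {d<..l} \<Longrightarrow> poisson_measure M (\<rho> i) (Q i)"
    and Q_adapted: "\<And>i t B. i \<in> {d<..l} \<Longrightarrow> 0 \<le> t \<Longrightarrow> B \<in> sets borel \<Longrightarrow> B \<subseteq> UNIV \<times> {0<..t} \<Longrightarrow>
                      (\<lambda>\<omega>. emeasure (Q i \<omega>) B) \<in> borel_measurable (F t)"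
    and J_integral: "\<And>i p. i \<in> {d<..l} \<Longrightarrow> 1 \<le> p \<Longrightarrow> compensated_integral M (\<rho> i) (Q i) (\<lambda>v. v ^ p) (J i p)"
    and J_adapted: "\<And>i p. i \<in> {d<..l} \<Longrightarrow> 1 \<le> p \<Longrightarrow> cadlag_adapted M F (J i p)"
    and J_moments: "\<And>i k t. i \<in> {d<..l} \<Longrightarrow> 0 \<le> t \<Longrightarrow> integrable M (\<lambda>\<omega>. \<bar>J i 1 t \<omega>\<bar> ^ k)"
    and noises_independent:
      "indep_sets (\<lambda>i. sigma_sets (space M) (noise_after M d W Q 0 i)) {1..l}"
    and past_independent:
      "\<And>s. 0 \<le> s \<Longrightarrow>
         indep_set (sets (F s)) (sigma_sets (space M) (\<Union>i\<in>{1..l}. noise_after M d W Q s i))"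


section \<open>Alphabet, words and iterated integrals\<close>

text \<open>\<open>Base i\<close> is the letter $i$ and \<open>Power i p\<close> the letter $i^{(p)}$.\<close>

datatype letter = Base nat | Power nat nat

fun letter_process ::
    "nat \<Rightarrow> (nat \<Rightarrow> real \<Rightarrow> 'a \<Rightarrow> real) \<Rightarrow> (nat \<Rightarrow> nat \<Rightarrow> real \<Rightarrow> 'a \<Rightarrow> real) \<Rightarrow> letter \<Rightarrow> real \<Rightarrow> 'a \<Rightarrow> real"
where
  "letter_process d W J (Base i) t \<omega> =
     (if i = 0 then t else if i \<le> d then W i t \<omega> else J i 1 t \<omega>)"
| "letter_process d W J (Power i p) t \<omega> = J i p t \<omega>"

definition power_in_span :: "'a measure \<Rightarrow> (nat \<Rightarrow> real \<Rightarrow> 'a \<Rightarrow> real) \<Rightarrow> nat \<Rightarrow> bool" where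
  "power_in_span M Ji p \<longleftrightarrow>
     (\<exists>c::nat \<Rightarrow> real. \<forall>t\<ge>0. AE \<omega> in M. Ji p t \<omega> = c 0 * t + (\<Sum>q\<in>{1..<p}. c q * Ji q t \<omega>))"

definition alphabet :: "'a measure \<Rightarrow> nat \<Rightarrow> nat \<Rightarrow> (nat \<Rightarrow> nat \<Rightarrow> real \<Rightarrow> 'a \<Rightarrow> real) \<Rightarrow> letter set" where
  "alphabet M d l J =
     {Base i | i. i \<le> l} \<union> {Power i p | i p. i \<in> {d<..l} \<and> 2 \<le> p \<and> \<not> power_in_span M (J i) p}"

text \<open>
  \<open>I w t\<close> is $I_w(t)$; the last letter of $w$ is integrated last (outermost):
  $I_{wa}(t)=\int_0^t I_w(s_-)\,dZ^a_s$.
\<close>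

definition iterated_integrals ::
    "'a measure \<Rightarrow> (real \<Rightarrow> 'a measure) \<Rightarrow> letter set \<Rightarrow> (letter \<Rightarrow> real \<Rightarrow> 'a \<Rightarrow> real) \<Rightarrow>
     (letter list \<Rightarrow> real \<Rightarrow> 'a \<Rightarrow> real) \<Rightarrow> bool" where
  "iterated_integrals M F A Z I \<longleftrightarrow>
     (\<forall>t \<omega>. I [] t \<omega> = 1) \<and>
     (\<forall>w\<in>lists A. \<forall>a\<in>A. cadlag_adapted M F (I (w @ [a])) \<and>
        (\<forall>t\<ge>0. ito_integral M F (Z a) (left_limit (I w)) t (I (w @ [a]) t)))"

text \<open>
  $\mathbb R\langle\mathbb A\rangle$ is realised inside the finitely supported functions on all
  words in the type of letters.
\<close>

definition word :: "letter list \<Rightarrow> (letter list, real) poly_mapping" where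
  "word w = Poly_Mapping.single w 1"

definition word_space :: "letter set \<Rightarrow> (letter list, real) poly_mapping set" where
  "word_space A = {p. Poly_Mapping.keys p \<subseteq> lists A}"

definition reversal :: "(letter list, real) poly_mapping \<Rightarrow> (letter list, real) poly_mapping" where
  "reversal p = (\<Sum>w\<in>Poly_Mapping.keys p. Poly_Mapping.lookup p w *\<^sub>R word (rev w))"

definition sign_reversal :: "(letter list, real) poly_mapping \<Rightarrow> (letter list, real) poly_mapping" where
  "sign_reversal p =
     (\<Sum>w\<in>Poly_Mapping.keys p. Poly_Mapping.lookup p w *\<^sub>R ((-1) ^ length w *\<^sub>R word (rev w)))"

definition poly_integral ::
    "(letter list \<Rightarrow> real \<Rightarrow> 'a \<Rightarrow> real) \<Rightarrow> (letter list, real) poly_mapping \<Rightarrow> real \<Rightarrow> 'a \<Rightarrow> real" where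
  "poly_integral I p t \<omega> = (\<Sum>w\<in>Poly_Mapping.keys p. Poly_Mapping.lookup p w * I w t \<omega>)"


section \<open>The differential system, separated expansions and schemes\<close>

definition ito_solution ::
    "'a measure \<Rightarrow> (real \<Rightarrow> 'a measure) \<Rightarrow> nat \<Rightarrow> nat \<Rightarrow> (letter \<Rightarrow> real \<Rightarrow> 'a \<Rightarrow> real) \<Rightarrow>
     (nat \<Rightarrow> real^'n \<Rightarrow> real^'n) \<Rightarrow> ('a \<Rightarrow> real^'n) \<Rightarrow> (real \<Rightarrow> 'a \<Rightarrow> real^'n) \<Rightarrow> bool" where
  "ito_solution M F d l Z V y0 y \<longleftrightarrow> cadlag_adapted M F y \<and>
     (\<forall>t\<ge>0. \<exists>X :: nat \<Rightarrow> 'a \<Rightarrow> real^'n.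
        (\<forall>i\<le>d. \<forall>k. ito_integral M F (Z (Base i)) (\<lambda>s \<omega>. V i (y s \<omega>) $ k) t (\<lambda>\<omega>. X i \<omega> $ k)) \<and>
        (\<forall>i\<in>{d<..l}. \<forall>k.
           ito_integral M F (Z (Base i)) (\<lambda>s \<omega>. V i (left_limit y s \<omega>) $ k) t (\<lambda>\<omega>. X i \<omega> $ k)) \<and>
        (AE \<omega> in M. y t \<omega> = y0 \<omega> + (\<Sum>i\<le>d. X i \<omega>) + (\<Sum>i\<in>{d<..l}. X i \<omega>)))"

text \<open>
  $\tilde V_w(y)$: the composition $\tilde V_{a_1}\circ\cdots\circ\tilde V_{a_m}$ applied to the
  identity map, evaluated at $y$.
\<close>

definition word_field ::
    "(letter \<Rightarrow> (real^'n \<Rightarrow> real^'n) \<Rightarrow> real^'n \<Rightarrow> real^'n) \<Rightarrow> letter list \<Rightarrow> real^'n \<Rightarrow> real^'n" where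
  "word_field Vt w y = foldr (\<circ>) (map Vt w) id (\<lambda>x. x) y"

definition words_of_length :: "letter set \<Rightarrow> nat \<Rightarrow> letter list set" where
  "words_of_length A k = {w \<in> lists A. length w = k}"

text \<open>
  \<open>word_series M A f k Y\<close>: $Y=\sum_{|w|\ge k} f_w$ in mean square, where truncation is by word
  length.
\<close>

definition word_series ::
    "'a measure \<Rightarrow> letter set \<Rightarrow> (letter list \<Rightarrow> 'a \<Rightarrow> real^'n) \<Rightarrow> nat \<Rightarrow> ('a \<Rightarrow> real^'n) \<Rightarrow> bool" where
  "word_series M A f k Y \<longleftrightarrow>
     (\<exists>T. (\<forall>j\<ge>k. L2_has_sum M f (words_of_length A j) (T j)) \<and>
          L2_tendsto M (\<lambda>m \<omega>. \<Sum>j\<in>{k..m}. T j \<omega>) Y sequentially)"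

text \<open>The expansion of the flow started at \<open>y0\<close>, on the time interval $[0,T]$.\<close>

definition separated_expansion ::
    "'a measure \<Rightarrow> letter set \<Rightarrow> (letter list \<Rightarrow> real \<Rightarrow> 'a \<Rightarrow> real) \<Rightarrow>
     (letter \<Rightarrow> (real^'n \<Rightarrow> real^'n) \<Rightarrow> real^'n \<Rightarrow> real^'n) \<Rightarrow>
     real \<Rightarrow> ('a \<Rightarrow> real^'n) \<Rightarrow> (real \<Rightarrow> 'a \<Rightarrow> real^'n) \<Rightarrow> bool" where
  "separated_expansion M A I Vt T y0 y \<longleftrightarrow>
     (\<forall>w\<in>lists A. word_field Vt w \<in> borel_measurable borel) \<and>
     (\<forall>t\<in>{0..T}. word_series M A (\<lambda>w \<omega>. I w t \<omega> *\<^sub>R word_field Vt w (y0 \<omega>)) 0 (y t))"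

definition taylor_scheme ::
    "'a measure \<Rightarrow> letter set \<Rightarrow> (letter list \<Rightarrow> real \<Rightarrow> 'a \<Rightarrow> real) \<Rightarrow>
     (letter \<Rightarrow> (real^'n \<Rightarrow> real^'n) \<Rightarrow> real^'n \<Rightarrow> real^'n) \<Rightarrow>
     nat \<Rightarrow> real \<Rightarrow> ('a \<Rightarrow> real^'n) \<Rightarrow> ('a \<Rightarrow> real^'n) \<Rightarrow> bool" where
  "taylor_scheme M A I Vt n t y0 Y \<longleftrightarrow>
     L2_has_sum M (\<lambda>w \<omega>. I w t \<omega> *\<^sub>R word_field Vt w (y0 \<omega>)) {w \<in> lists A. length w \<le> n} Y"

definition asri_scheme ::
    "'a measure \<Rightarrow> letter set \<Rightarrow> (letter list \<Rightarrow> real \<Rightarrow> 'a \<Rightarrow> real) \<Rightarrow>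
     (letter \<Rightarrow> (real^'n \<Rightarrow> real^'n) \<Rightarrow> real^'n \<Rightarrow> real^'n) \<Rightarrow>
     nat \<Rightarrow> real \<Rightarrow> ('a \<Rightarrow> real^'n) \<Rightarrow> ('a \<Rightarrow> real^'n) \<Rightarrow> bool" where
  "asri_scheme M A I Vt n t y0 Y \<longleftrightarrow>
     (\<exists>Y1 Y2. taylor_scheme M A I Vt n t y0 Y1 \<and>
        L2_has_sum M
          (\<lambda>w \<omega>. (1/2 * poly_integral I (word w + sign_reversal (word w)) t \<omega>) *\<^sub>R
                     word_field Vt w (y0 \<omega>))
          (words_of_length A (n + 1)) Y2 \<and>
        Y = (\<lambda>\<omega>. Y1 \<omega> + Y2 \<omega>))"

end

theory Submission
  imports Defs
begin

text \<open>
  Conditionally on the initial data, the mixed moment of two iterated integrals $I_u(t)$, $I_v(t)$ is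
  a polynomial in $t$ whose coefficients count alignments of $u$ and $v$: the It\^o isometry strips the
  last noise letters of both words, and a time integral strips a time letter from one of them.
  Alignments can be read from either end, so reversing both words leaves the moments unchanged, and
  $\sum_w I_{p_w}\tilde V_w$ keeps its mean-square norm when every $p_w$ is reversed.
  If $X$ is the leading Taylor remainder and $X'$ its sign reversal, the leading remainder of the
  integrator is $(X-X')/2$ with $\|X'\|=\|X\|$, which gives (a). For odd $n$, reversal maps the
  perturbed remainder $Y=R^0+\epsilon P$ to $Y'=-R^0+\epsilon P$, so $R^0=(Y-Y')/2$ has norm at most
  $\|Y\|$, which is (b).
\<close>

section \<open>Mean-square calculus\<close>

text \<open>The coefficient of a word is a function of the initial data that need not be square
  integrable; only its product with the iterated integral is. Conditional moments are therefore
  stated weakly, against bounded \<open>F 0\<close>-measurable weights, and unbounded coefficients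
  are reached by truncating on events of \<open>F 0\<close> and monotone convergence of nonnegative
  integrals. \<open>ito_integral\<close> determines a random variable for each time separately, with
  its own approximating sequence, so even the martingale property of an integral has to be deduced
  from the isometry. A Levy measure may have infinite mass near zero, so covariances are computed
  for jumps above a threshold and then passed to the limit. Their values never enter the final
  argument: what matters is that increments have a symmetric covariance rate, constant in time, and
  are centred given the past. The last step needs no orthogonality of symmetric and antisymmetric
  parts, only that half the difference of two vectors of equal norm is no longer than either. Since
  the alphabet may be infinite, it is applied to finite sums of words and carried over to the
  limits.\<close>

lemma norm_add_sq_le: "(norm (x + y :: 'b::real_normed_vector))\<^sup>2 \<le> 2 * (norm x)\<^sup>2 + 2 * (norm y)\<^sup>2"
proof -
  have "(norm (x + y))\<^sup>2 \<le> (norm x + norm y)\<^sup>2"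
    by (intro power_mono norm_triangle_ineq) auto
  also have "\<dots> \<le> 2 * (norm x)\<^sup>2 + 2 * (norm y)\<^sup>2"
    using zero_le_power2[of "norm x - norm y"] by (simp add: power2_eq_square algebra_simps)
  finally show ?thesis .
qed

lemma L2_measurable: "L2 M X \<Longrightarrow> X \<in> borel_measurable M"
  by (simp add: L2_def)

lemma L2_integrable: "L2 M X \<Longrightarrow> integrable M (\<lambda>\<omega>. (norm (X \<omega>))\<^sup>2)"
  by (simp add: L2_def)

lemma L2_normsq_nonneg [simp]: "0 \<le> L2_normsq M X"
  by (simp add: L2_normsq_def)

lemma L2_bound:
  assumes "X \<in> borel_measurable M" "integrable M f" "\<And>\<omega>. \<omega> \<in> space M \<Longrightarrow> (norm (X \<omega>))\<^sup>2 \<le> f \<omega>"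
  shows "L2 M X"
  unfolding L2_def
proof
  show "integrable M (\<lambda>\<omega>. (norm (X \<omega>))\<^sup>2)"
  proof (rule Bochner_Integration.integrable_bound[OF assms(2)])
    show "(\<lambda>\<omega>. (norm (X \<omega>))\<^sup>2) \<in> borel_measurable M" using assms(1) by measurable
    show "AE \<omega> in M. norm ((norm (X \<omega>))\<^sup>2) \<le> norm (f \<omega>)"
      using assms(3) by (intro AE_I2) fastforce
  qed
qed fact

lemma L2_zero [simp]: "L2 M (\<lambda>_. 0)"
  by (simp add: L2_def)

lemma L2_scaleR_bounded:
  fixes X :: "'a \<Rightarrow> 'b::{real_normed_vector, second_countable_topology}"
  assumes X: "L2 M X" and c: "c \<in> borel_measurable M" "\<And>\<omega>. \<omega> \<in> space M \<Longrightarrow> \<bar>c \<omega>\<bar> \<le> (C::real)"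
  shows "L2 M (\<lambda>\<omega>. c \<omega> *\<^sub>R X \<omega>)"
proof (rule L2_bound)
  show "(\<lambda>\<omega>. c \<omega> *\<^sub>R X \<omega>) \<in> borel_measurable M"
    using L2_measurable[OF X] c by measurable
  show "integrable M (\<lambda>\<omega>. C\<^sup>2 * (norm (X \<omega>))\<^sup>2)" using L2_integrable[OF X] by simp
  show "(norm (c \<omega> *\<^sub>R X \<omega>))\<^sup>2 \<le> C\<^sup>2 * (norm (X \<omega>))\<^sup>2" if "\<omega> \<in> space M" for \<omega>
  proof -
    have "\<bar>c \<omega>\<bar>\<^sup>2 \<le> C\<^sup>2" using c(2)[OF that] by (intro power_mono) auto
    then show ?thesis by (simp add: power_mult_distrib mult_right_mono)
  qed
qed

lemma L2_scaleR:
  fixes X :: "'a \<Rightarrow> 'b::{real_normed_vector, second_countable_topology}"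
  shows "L2 M X \<Longrightarrow> L2 M (\<lambda>\<omega>. (c::real) *\<^sub>R X \<omega>)"
  by (rule L2_scaleR_bounded[where C = "\<bar>c\<bar>"]) auto

lemma L2_mult_bounded:
  fixes X :: "'a \<Rightarrow> real"
  shows "L2 M X \<Longrightarrow> c \<in> borel_measurable M \<Longrightarrow> (\<And>\<omega>. \<omega> \<in> space M \<Longrightarrow> \<bar>c \<omega>\<bar> \<le> (C::real)) \<Longrightarrow>
    L2 M (\<lambda>\<omega>. c \<omega> * X \<omega>)"
  using L2_scaleR_bounded[of M X c C] by simp

context
  fixes M :: "'a measure" and X Y :: "'a \<Rightarrow> 'b::{real_normed_vector, second_countable_topology}"
  assumes X: "L2 M X" and Y: "L2 M Y"
begin

lemma L2_add: "L2 M (\<lambda>\<omega>. X \<omega> + Y \<omega>)"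
proof (rule L2_bound)
  show "(\<lambda>\<omega>. X \<omega> + Y \<omega>) \<in> borel_measurable M"
    using X Y by (auto dest!: L2_measurable)
  show "integrable M (\<lambda>\<omega>. 2 * (norm (X \<omega>))\<^sup>2 + 2 * (norm (Y \<omega>))\<^sup>2)"
    using X Y by (auto dest!: L2_integrable)
qed (rule norm_add_sq_le)

lemma L2_normsq_add_le: "L2_normsq M (\<lambda>\<omega>. X \<omega> + Y \<omega>) \<le> 2 * L2_normsq M X + 2 * L2_normsq M Y"
proof -
  have "L2_normsq M (\<lambda>\<omega>. X \<omega> + Y \<omega>) \<le> (\<integral>\<omega>. 2 * (norm (X \<omega>))\<^sup>2 + 2 * (norm (Y \<omega>))\<^sup>2 \<partial>M)"
    unfolding L2_normsq_def
    using L2_integrable[OF L2_add] L2_integrable[OF X] L2_integrable[OF Y]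
    by (intro integral_mono norm_add_sq_le) auto
  also have "\<dots> = 2 * L2_normsq M X + 2 * L2_normsq M Y"
    using L2_integrable[OF X] L2_integrable[OF Y] by (simp add: L2_normsq_def)
  finally show ?thesis .
qed

end

lemma L2_diff:
  fixes X Y :: "'a \<Rightarrow> 'b::{real_normed_vector, second_countable_topology}"
  assumes "L2 M X" "L2 M Y"
  shows "L2 M (\<lambda>\<omega>. X \<omega> - Y \<omega>)"
  using L2_add[OF assms(1) L2_scaleR[OF assms(2), of "-1"]] by simp

lemma L2_sum:
  fixes X :: "'i \<Rightarrow> 'a \<Rightarrow> 'b::{real_normed_vector, second_countable_topology}"
  assumes "\<And>i. i \<in> B \<Longrightarrow> L2 M (X i)"
  shows "L2 M (\<lambda>\<omega>. \<Sum>i\<in>B. X i \<omega>)"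
  using assms by (induction B rule: infinite_finite_induct) (auto intro: L2_add)

lemma L2_normsq_scaleR: "L2_normsq M (\<lambda>\<omega>. c *\<^sub>R X \<omega>) = c\<^sup>2 * L2_normsq M X"
  by (simp add: L2_normsq_def power_mult_distrib)

section \<open>Convergence in mean square and its uniqueness up to null sets\<close>

lemma L2_tendstoD:
  assumes "L2_tendsto M X Y G"
  shows "L2 M Y" "\<forall>\<^sub>F i in G. L2 M (X i)"
    "((\<lambda>i. L2_normsq M (\<lambda>\<omega>. X i \<omega> - Y \<omega>)) \<longlongrightarrow> 0) G"
  using assms by (auto simp: L2_tendsto_def)

lemma L2_tendsto_bound:
  fixes X :: "'i \<Rightarrow> 'a \<Rightarrow> 'b::{real_normed_vector, second_countable_topology}"
  assumes "L2 M Y" "\<forall>\<^sub>F i in G. L2 M (X i)"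
    and "\<forall>\<^sub>F i in G. L2_normsq M (\<lambda>\<omega>. X i \<omega> - Y \<omega>) \<le> f i" "(f \<longlongrightarrow> 0) G"
  shows "L2_tendsto M X Y G"
  unfolding L2_tendsto_def
  using assms by (auto intro: tendsto_sandwich[of "\<lambda>_. 0" _ _ f])

lemma L2_tendsto_cong:
  assumes X: "L2_tendsto M X Y G" and eq: "\<forall>\<^sub>F i in G. X i = X' i"
  shows "L2_tendsto M X' Y G"
proof -
  have "\<forall>\<^sub>F i in G. L2 M (X' i)"
    using L2_tendstoD(2)[OF X] eq by eventually_elim simp
  moreover have "\<forall>\<^sub>F i in G. L2_normsq M (\<lambda>\<omega>. X i \<omega> - Y \<omega>) = L2_normsq M (\<lambda>\<omega>. X' i \<omega> - Y \<omega>)"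
    using eq by eventually_elim simp
  ultimately show ?thesis
    using L2_tendstoD[OF X] by (simp add: L2_tendsto_def tendsto_cong)
qed

lemma L2_tendsto_const: "L2 M Y \<Longrightarrow> L2_tendsto M (\<lambda>_. Y) Y G"
  by (simp add: L2_tendsto_def L2_normsq_def)

lemma L2_tendsto_add:
  fixes X Y :: "'i \<Rightarrow> 'a \<Rightarrow> 'b::{real_normed_vector, second_countable_topology}"
  assumes X: "L2_tendsto M X X' G" and Y: "L2_tendsto M Y Y' G"
  shows "L2_tendsto M (\<lambda>i \<omega>. X i \<omega> + Y i \<omega>) (\<lambda>\<omega>. X' \<omega> + Y' \<omega>) G"
proof (rule L2_tendsto_bound)
  note * = L2_tendstoD[OF X] L2_tendstoD[OF Y]
  show "L2 M (\<lambda>\<omega>. X' \<omega> + Y' \<omega>)" using * by (auto intro: L2_add)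
  show "\<forall>\<^sub>F i in G. L2 M (\<lambda>\<omega>. X i \<omega> + Y i \<omega>)"
    using *(2,5) by eventually_elim (auto intro: L2_add)
  show "\<forall>\<^sub>F i in G. L2_normsq M (\<lambda>\<omega>. X i \<omega> + Y i \<omega> - (X' \<omega> + Y' \<omega>)) \<le>
      2 * L2_normsq M (\<lambda>\<omega>. X i \<omega> - X' \<omega>) + 2 * L2_normsq M (\<lambda>\<omega>. Y i \<omega> - Y' \<omega>)"
    using *(2,5)
  proof eventually_elim
    case (elim i)
    show ?case
      using L2_normsq_add_le[OF L2_diff[OF elim(1) *(1)] L2_diff[OF elim(2) *(4)]]
      by (simp add: algebra_simps)
  qed
  show "((\<lambda>i. 2 * L2_normsq M (\<lambda>\<omega>. X i \<omega> - X' \<omega>) + 2 * L2_normsq M (\<lambda>\<omega>. Y i \<omega> - Y' \<omega>)) \<longlongrightarrow> 0) G"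
    using tendsto_add[OF tendsto_mult_left[OF *(3), of 2] tendsto_mult_left[OF *(6), of 2]] by simp
qed

lemma L2_tendsto_scaleR_bounded:
  fixes X :: "'i \<Rightarrow> 'a \<Rightarrow> 'b::{real_normed_vector, second_countable_topology}"
  assumes X: "L2_tendsto M X Y G"
    and c: "c \<in> borel_measurable M" "\<And>\<omega>. \<omega> \<in> space M \<Longrightarrow> \<bar>c \<omega>\<bar> \<le> (C::real)"
  shows "L2_tendsto M (\<lambda>i \<omega>. c \<omega> *\<^sub>R X i \<omega>) (\<lambda>\<omega>. c \<omega> *\<^sub>R Y \<omega>) G"
proof (rule L2_tendsto_bound)
  note * = L2_tendstoD[OF X]
  show "L2 M (\<lambda>\<omega>. c \<omega> *\<^sub>R Y \<omega>)" using *(1) c by (rule L2_scaleR_bounded)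
  show "\<forall>\<^sub>F i in G. L2 M (\<lambda>\<omega>. c \<omega> *\<^sub>R X i \<omega>)"
    using *(2) by eventually_elim (rule L2_scaleR_bounded[OF _ c])
  show "\<forall>\<^sub>F i in G. L2_normsq M (\<lambda>\<omega>. c \<omega> *\<^sub>R X i \<omega> - c \<omega> *\<^sub>R Y \<omega>) \<le>
      C\<^sup>2 * L2_normsq M (\<lambda>\<omega>. X i \<omega> - Y \<omega>)"
    using *(2)
  proof eventually_elim
    case (elim i)
    have d: "L2 M (\<lambda>\<omega>. X i \<omega> - Y \<omega>)" using elim *(1) by (rule L2_diff)
    have "L2_normsq M (\<lambda>\<omega>. c \<omega> *\<^sub>R (X i \<omega> - Y \<omega>)) \<le> (\<integral>\<omega>. C\<^sup>2 * (norm (X i \<omega> - Y \<omega>))\<^sup>2 \<partial>M)"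
      unfolding L2_normsq_def
    proof (rule integral_mono)
      show "integrable M (\<lambda>\<omega>. (norm (c \<omega> *\<^sub>R (X i \<omega> - Y \<omega>)))\<^sup>2)"
        by (rule L2_integrable[OF L2_scaleR_bounded[OF d c]])
      show "integrable M (\<lambda>\<omega>. C\<^sup>2 * (norm (X i \<omega> - Y \<omega>))\<^sup>2)"
        using L2_integrable[OF d] by simp
      fix \<omega> assume "\<omega> \<in> space M"
      then have "\<bar>c \<omega>\<bar>\<^sup>2 \<le> C\<^sup>2" using c(2) by (intro power_mono) auto
      then show "(norm (c \<omega> *\<^sub>R (X i \<omega> - Y \<omega>)))\<^sup>2 \<le> C\<^sup>2 * (norm (X i \<omega> - Y \<omega>))\<^sup>2"
        by (simp add: power_mult_distrib mult_right_mono)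
    qed
    then show ?case by (simp add: L2_normsq_def scaleR_diff_right)
  qed
  show "((\<lambda>i. C\<^sup>2 * L2_normsq M (\<lambda>\<omega>. X i \<omega> - Y \<omega>)) \<longlongrightarrow> 0) G"
    using tendsto_mult_left[OF *(3), of "C\<^sup>2"] by simp
qed

lemma L2_tendsto_scaleR:
  fixes X :: "'i \<Rightarrow> 'a \<Rightarrow> 'b::{real_normed_vector, second_countable_topology}"
  shows "L2_tendsto M X Y G \<Longrightarrow> L2_tendsto M (\<lambda>i \<omega>. (c::real) *\<^sub>R X i \<omega>) (\<lambda>\<omega>. c *\<^sub>R Y \<omega>) G"
  by (rule L2_tendsto_scaleR_bounded[where C = "\<bar>c\<bar>"]) auto

lemma L2_tendsto_diff:
  fixes X Y :: "'i \<Rightarrow> 'a \<Rightarrow> 'b::{real_normed_vector, second_countable_topology}"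
  assumes "L2_tendsto M X X' G" and "L2_tendsto M Y Y' G"
  shows "L2_tendsto M (\<lambda>i \<omega>. X i \<omega> - Y i \<omega>) (\<lambda>\<omega>. X' \<omega> - Y' \<omega>) G"
  using L2_tendsto_add[OF assms(1) L2_tendsto_scaleR[OF assms(2), of "-1"]] by simp

lemma L2_normsq_cong_AE:
  assumes "AE \<omega> in M. X \<omega> = Y \<omega>" "X \<in> borel_measurable M" "Y \<in> borel_measurable M"
  shows "L2_normsq M X = L2_normsq M Y"
  unfolding L2_normsq_def using assms by (intro integral_cong_AE) auto

lemma L2_cong_AE:
  assumes "L2 M X" "AE \<omega> in M. X \<omega> = Y \<omega>" "Y \<in> borel_measurable M"
  shows "L2 M Y"
proof -
  have "integrable M (\<lambda>\<omega>. (norm (Y \<omega>))\<^sup>2) \<longleftrightarrow> integrable M (\<lambda>\<omega>. (norm (X \<omega>))\<^sup>2)"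
    using assms L2_measurable[OF assms(1)] by (intro integrable_cong_AE) auto
  then show ?thesis using assms by (simp add: L2_def)
qed

lemma L2_tendsto_cong_AE:
  fixes X X' :: "'i \<Rightarrow> 'a \<Rightarrow> 'b::{real_normed_vector, second_countable_topology}"
  assumes X: "L2_tendsto M X Y G"
    and X': "\<forall>\<^sub>F i in G. X' i \<in> borel_measurable M \<and> (AE \<omega> in M. X i \<omega> = X' i \<omega>)"
    and Y': "Y' \<in> borel_measurable M" "AE \<omega> in M. Y \<omega> = Y' \<omega>"
  shows "L2_tendsto M X' Y' G"
proof (rule L2_tendsto_bound)
  note * = L2_tendstoD[OF X]
  show L2Y: "L2 M Y'" using *(1) Y' by (blast intro: L2_cong_AE)
  show "\<forall>\<^sub>F i in G. L2 M (X' i)"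
    using X' *(2) by eventually_elim (blast intro: L2_cong_AE)
  show "\<forall>\<^sub>F i in G. L2_normsq M (\<lambda>\<omega>. X' i \<omega> - Y' \<omega>) \<le> L2_normsq M (\<lambda>\<omega>. X i \<omega> - Y \<omega>)"
    using X' *(2)
  proof eventually_elim
    case (elim i)
    have "L2_normsq M (\<lambda>\<omega>. X' i \<omega> - Y' \<omega>) = L2_normsq M (\<lambda>\<omega>. X i \<omega> - Y \<omega>)"
    proof (rule L2_normsq_cong_AE)
      show "AE \<omega> in M. X' i \<omega> - Y' \<omega> = X i \<omega> - Y \<omega>"
        using elim Y'(2) by auto
    qed (use elim L2_measurable[OF elim(2)] L2_measurable[OF *(1)] Y' in auto)
    then show ?case by simp
  qed
  show "((\<lambda>i. L2_normsq M (\<lambda>\<omega>. X i \<omega> - Y \<omega>)) \<longlongrightarrow> 0) G" by fact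
qed

lemma L2_tendsto_unique:
  fixes X :: "'i \<Rightarrow> 'a \<Rightarrow> 'b::{real_normed_vector, second_countable_topology}"
  assumes Y: "L2_tendsto M X Y G" and Y': "L2_tendsto M X Y' G" and "G \<noteq> bot"
  shows "AE \<omega> in M. Y \<omega> = Y' \<omega>"
proof -
  \<comment> \<open>Subtracting the two convergences leaves the zero sequence, whose distance to
    \<open>Y - Y'\<close> is constant and therefore already zero.\<close>
  have "L2_tendsto M (\<lambda>i \<omega>. X i \<omega> - X i \<omega>) (\<lambda>\<omega>. Y \<omega> - Y' \<omega>) G"
    by (rule L2_tendsto_diff[OF Y Y'])
  then have lim: "((\<lambda>i. L2_normsq M (\<lambda>\<omega>. Y \<omega> - Y' \<omega>)) \<longlongrightarrow> 0) G" and L2: "L2 M (\<lambda>\<omega>. Y \<omega> - Y' \<omega>)"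
    by (auto simp: L2_tendsto_def L2_normsq_def norm_minus_commute)
  have "L2_normsq M (\<lambda>\<omega>. Y \<omega> - Y' \<omega>) = 0"
    using tendsto_unique[OF \<open>G \<noteq> bot\<close> lim tendsto_const] by simp
  then have "AE \<omega> in M. (norm (Y \<omega> - Y' \<omega>))\<^sup>2 = 0"
    unfolding L2_normsq_def
    using integral_nonneg_eq_0_iff_AE[OF L2_integrable[OF L2]] by simp
  then show ?thesis by simp
qed

section \<open>Continuity of norms and inner products in mean square\<close>

text \<open>Young's inequality: with \<open>r = norm (x - y)\<close> and \<open>b = norm y\<close>
  the left side is at most \<open>r * (r + 2 * b)\<close>, and \<open>2 * r * b\<close> is split by
  expanding the square of \<open>e * b - r\<close>. The free parameter lets the term that does not
  tend to zero be made small after integration.\<close>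

lemma norm_sq_diff_le:
  fixes x y :: "'b::real_normed_vector"
  assumes "0 < e"
  shows "\<bar>(norm x)\<^sup>2 - (norm y)\<^sup>2\<bar> \<le> e * (norm y)\<^sup>2 + (1 + 1 / e) * (norm (x - y))\<^sup>2"
proof -
  define a b r where "a = norm x" and "b = norm y" and "r = norm (x - y)"
  have ab: "\<bar>a - b\<bar> \<le> r" "0 \<le> b" "0 \<le> a" "0 \<le> r"
    by (auto simp: a_def b_def r_def norm_triangle_ineq3)
  have "\<bar>a\<^sup>2 - b\<^sup>2\<bar> = \<bar>a - b\<bar> * \<bar>(a - b) + 2 * b\<bar>"
    by (simp add: power2_eq_square abs_mult[symmetric] algebra_simps)
  also have "\<dots> \<le> r * (r + 2 * b)"
    using ab by (intro mult_mono) auto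
  also have "\<dots> \<le> e * b\<^sup>2 + (1 + 1 / e) * r\<^sup>2"
  proof -
    have "0 \<le> (e * b - r)\<^sup>2 / e" using assms by simp
    also have "\<dots> = e * b\<^sup>2 - 2 * r * b + r\<^sup>2 / e"
      using assms by (simp add: power2_eq_square field_simps)
    finally show ?thesis by (simp add: power2_eq_square algebra_simps)
  qed
  finally show ?thesis by (simp add: a_def b_def r_def)
qed

lemma L2_tendsto_normsq:
  fixes X :: "'i \<Rightarrow> 'a \<Rightarrow> 'b::{real_normed_vector, second_countable_topology}"
  assumes X: "L2_tendsto M X Y G"
  shows "((\<lambda>i. L2_normsq M (X i)) \<longlongrightarrow> L2_normsq M Y) G"
proof (rule tendstoI)
  fix e :: real assume e: "0 < e"
  note * = L2_tendstoD[OF X]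
  \<comment> \<open>Chosen so that the term \<open>\<delta> * L2_normsq M Y\<close> stays below
    \<open>e / 2\<close>; the added 1 covers \<open>Y\<close> of norm zero.\<close>
  define \<delta> where "\<delta> = e / (2 * (L2_normsq M Y + 1))"
  have pos: "0 < L2_normsq M Y + 1" using L2_normsq_nonneg[of M Y] by linarith
  then have \<delta>: "0 < \<delta>" using e by (simp add: \<delta>_def)
  have \<delta>Y: "\<delta> * L2_normsq M Y < e / 2"
  proof -
    have "\<delta> * L2_normsq M Y < \<delta> * (L2_normsq M Y + 1)" using \<delta> by simp
    also have "\<dots> = e / 2" using pos by (simp add: \<delta>_def field_simps)
    finally show ?thesis .
  qed
  have "((\<lambda>i. (1 + 1 / \<delta>) * L2_normsq M (\<lambda>\<omega>. X i \<omega> - Y \<omega>)) \<longlongrightarrow> 0) G"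
    using tendsto_mult_left[OF *(3), of "1 + 1 / \<delta>"] by simp
  then have "\<forall>\<^sub>F i in G. (1 + 1 / \<delta>) * L2_normsq M (\<lambda>\<omega>. X i \<omega> - Y \<omega>) < e / 2"
    by (rule order_tendstoD) (use e in simp)
  then show "\<forall>\<^sub>F i in G. dist (L2_normsq M (X i)) (L2_normsq M Y) < e"
    using *(2)
  proof eventually_elim
    case (elim i)
    note ints = L2_integrable[OF elim(2)] L2_integrable[OF *(1)] L2_integrable[OF L2_diff[OF elim(2) *(1)]]
    have "\<bar>L2_normsq M (X i) - L2_normsq M Y\<bar> = \<bar>\<integral>\<omega>. (norm (X i \<omega>))\<^sup>2 - (norm (Y \<omega>))\<^sup>2 \<partial>M\<bar>"
      using ints by (simp add: L2_normsq_def)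
    also have "\<dots> \<le> (\<integral>\<omega>. \<bar>(norm (X i \<omega>))\<^sup>2 - (norm (Y \<omega>))\<^sup>2\<bar> \<partial>M)"
      by (rule integral_abs_bound)
    also have "\<dots> \<le> (\<integral>\<omega>. \<delta> * (norm (Y \<omega>))\<^sup>2 + (1 + 1 / \<delta>) * (norm (X i \<omega> - Y \<omega>))\<^sup>2 \<partial>M)"
      using ints \<delta> by (intro integral_mono norm_sq_diff_le) auto
    also have "\<dots> = \<delta> * L2_normsq M Y + (1 + 1 / \<delta>) * L2_normsq M (\<lambda>\<omega>. X i \<omega> - Y \<omega>)"
      using ints by (simp add: L2_normsq_def)
    also have "\<dots> < e" using elim(1) \<delta>Y by linarith
    finally show ?case by (simp add: dist_real_def)
  qed
qed

lemma L2_mult_integrable: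
  fixes X Y :: "'a \<Rightarrow> real"
  assumes X: "L2 M X" and Y: "L2 M Y"
  shows "integrable M (\<lambda>\<omega>. X \<omega> * Y \<omega>)"
proof (rule Bochner_Integration.integrable_bound)
  show "integrable M (\<lambda>\<omega>. (norm (X \<omega>))\<^sup>2 + (norm (Y \<omega>))\<^sup>2)"
    using L2_integrable[OF X] L2_integrable[OF Y] by simp
  show "(\<lambda>\<omega>. X \<omega> * Y \<omega>) \<in> borel_measurable M"
    using L2_measurable[OF X] L2_measurable[OF Y] by measurable
  have "\<bar>x * y\<bar> \<le> x\<^sup>2 + y\<^sup>2" for x y :: real
  proof -
    have "2 * \<bar>x * y\<bar> \<le> x\<^sup>2 + y\<^sup>2"
      using zero_le_power2[of "\<bar>x\<bar> - \<bar>y\<bar>"]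
      by (simp add: power2_eq_square algebra_simps abs_mult)
    then show ?thesis using zero_le_power2[of x] zero_le_power2[of y] by linarith
  qed
  then show "AE \<omega> in M. norm (X \<omega> * Y \<omega>) \<le> norm ((norm (X \<omega>))\<^sup>2 + (norm (Y \<omega>))\<^sup>2)"
    by simp
qed

text \<open>Writes an inner product through norms, so that convergence of expectations of products
  reduces to \<open>L2_tendsto_normsq\<close>.\<close>

lemma L2_polarization:
  fixes X Y :: "'a \<Rightarrow> real"
  assumes X: "L2 M X" and Y: "L2 M Y"
  shows "(\<integral>\<omega>. X \<omega> * Y \<omega> \<partial>M) =
    (L2_normsq M (\<lambda>\<omega>. X \<omega> + Y \<omega>) - L2_normsq M (\<lambda>\<omega>. X \<omega> - Y \<omega>)) / 4"
proof -
  have "L2_normsq M (\<lambda>\<omega>. X \<omega> + Y \<omega>) - L2_normsq M (\<lambda>\<omega>. X \<omega> - Y \<omega>) =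
      (\<integral>\<omega>. (norm (X \<omega> + Y \<omega>))\<^sup>2 - (norm (X \<omega> - Y \<omega>))\<^sup>2 \<partial>M)"
    using L2_integrable[OF L2_add[OF X Y]] L2_integrable[OF L2_diff[OF X Y]]
    by (simp add: L2_normsq_def)
  also have "\<dots> = (\<integral>\<omega>. 4 * (X \<omega> * Y \<omega>) \<partial>M)"
    by (simp add: power2_eq_square algebra_simps)
  finally show ?thesis by simp
qed

lemma L2_tendsto_integral_mult:
  fixes X Y :: "'i \<Rightarrow> 'a \<Rightarrow> real"
  assumes X: "L2_tendsto M X X' G" and Y: "L2_tendsto M Y Y' G"
  shows "((\<lambda>i. \<integral>\<omega>. X i \<omega> * Y i \<omega> \<partial>M) \<longlongrightarrow> (\<integral>\<omega>. X' \<omega> * Y' \<omega> \<partial>M)) G"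
proof -
  note * = L2_tendstoD[OF X] L2_tendstoD[OF Y]
  have "((\<lambda>i. (L2_normsq M (\<lambda>\<omega>. X i \<omega> + Y i \<omega>) - L2_normsq M (\<lambda>\<omega>. X i \<omega> - Y i \<omega>)) / 4) \<longlongrightarrow>
     (L2_normsq M (\<lambda>\<omega>. X' \<omega> + Y' \<omega>) - L2_normsq M (\<lambda>\<omega>. X' \<omega> - Y' \<omega>)) / 4) G"
    by (intro tendsto_divide tendsto_diff L2_tendsto_normsq L2_tendsto_add[OF X Y]
        L2_tendsto_diff[OF X Y] tendsto_const) simp
  moreover have "\<forall>\<^sub>F i in G. (\<integral>\<omega>. X i \<omega> * Y i \<omega> \<partial>M) =
      (L2_normsq M (\<lambda>\<omega>. X i \<omega> + Y i \<omega>) - L2_normsq M (\<lambda>\<omega>. X i \<omega> - Y i \<omega>)) / 4"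
    using *(2,5) by eventually_elim (rule L2_polarization)
  ultimately show ?thesis
    unfolding L2_polarization[OF *(1,4)] by (simp only: tendsto_cong)
qed

text \<open>The bounded factor \<open>c\<close> is the slot for the \<open>F 0\<close>-measurable
  weight that is carried through all isometries.\<close>

lemma L2_tendsto_integral_mult3:
  fixes X Y :: "'i \<Rightarrow> 'a \<Rightarrow> real"
  assumes X: "L2_tendsto M X X' G" and Y: "L2_tendsto M Y Y' G"
    and c: "c \<in> borel_measurable M" "\<And>\<omega>. \<omega> \<in> space M \<Longrightarrow> \<bar>c \<omega>\<bar> \<le> (C::real)"
  shows "((\<lambda>i. \<integral>\<omega>. c \<omega> * X i \<omega> * Y i \<omega> \<partial>M) \<longlongrightarrow> (\<integral>\<omega>. c \<omega> * X' \<omega> * Y' \<omega> \<partial>M)) G"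
  using L2_tendsto_integral_mult[OF L2_tendsto_scaleR_bounded[OF X c] Y] by simp

lemma (in finite_measure) L2_const: "L2 M (\<lambda>_. c)"
  by (simp add: L2_def)

lemma (in finite_measure) L2_integrable_real: "L2 M X \<Longrightarrow> integrable M (X :: 'a \<Rightarrow> real)"
  using L2_mult_integrable[of M X "\<lambda>_. 1"] L2_const[of 1] by simp

section \<open>Mean-square sums over words\<close>

lemma L2_has_sum_tendsto:
  "L2_has_sum M f A Y \<Longrightarrow> L2_tendsto M (\<lambda>B \<omega>. \<Sum>i\<in>B. f i \<omega>) Y (finite_subsets_at_top A)"
  by (simp add: L2_has_sum_def)

lemma L2_has_sum_unique:
  fixes f :: "'i \<Rightarrow> 'a \<Rightarrow> 'b::{real_normed_vector, second_countable_topology}"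
  assumes "L2_has_sum M f A Y" "L2_has_sum M f A Y'"
  shows "AE \<omega> in M. Y \<omega> = Y' \<omega>"
  using assms[THEN L2_has_sum_tendsto] by (rule L2_tendsto_unique) simp

lemma L2_has_sum_add:
  fixes f g :: "'i \<Rightarrow> 'a \<Rightarrow> 'b::{real_normed_vector, second_countable_topology}"
  assumes f: "L2_has_sum M f A X" and g: "L2_has_sum M g A Y"
  shows "L2_has_sum M (\<lambda>i \<omega>. f i \<omega> + g i \<omega>) A (\<lambda>\<omega>. X \<omega> + Y \<omega>)"
  using L2_tendsto_add[OF L2_has_sum_tendsto[OF f] L2_has_sum_tendsto[OF g]] f g
  by (auto simp: L2_has_sum_def sum.distrib intro: L2_add)

text \<open>Finite subsets of \<open>B\<close> that contain a given finite subset of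
  \<open>A\<close> still contain it after intersection with \<open>A\<close>; hence partial sums
  over \<open>A\<close> may be indexed by finite subsets of the larger set.\<close>

lemma filterlim_inter_finite_subsets_at_top:
  assumes "A \<subseteq> B"
  shows "filterlim (\<lambda>X. X \<inter> A) (finite_subsets_at_top A) (finite_subsets_at_top B)"
  unfolding filterlim_iff eventually_finite_subsets_at_top
proof safe
  fix P X assume X: "finite X" "X \<subseteq> A" and P: "\<forall>Y. finite Y \<and> X \<subseteq> Y \<and> Y \<subseteq> A \<longrightarrow> P Y"
  show "\<exists>X. finite X \<and> X \<subseteq> B \<and> (\<forall>Y. finite Y \<and> X \<subseteq> Y \<and> Y \<subseteq> B \<longrightarrow> P (Y \<inter> A))"
    using X P assms by (intro exI[of _ X]) auto
qed

lemma L2_has_sum_disjoint_union: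
  fixes f :: "'i \<Rightarrow> 'a \<Rightarrow> 'b::{real_normed_vector, second_countable_topology}"
  assumes A: "L2_has_sum M f A X" and B: "L2_has_sum M f B Y" and "A \<inter> B = {}"
  shows "L2_has_sum M f (A \<union> B) (\<lambda>\<omega>. X \<omega> + Y \<omega>)"
proof -
  have lim: "L2_tendsto M (\<lambda>F \<omega>. \<Sum>i\<in>F \<inter> C. f i \<omega>) Z (finite_subsets_at_top (A \<union> B))"
    if "L2_has_sum M f C Z" "C \<subseteq> A \<union> B" for C Z
    using L2_has_sum_tendsto[OF that(1)] filterlim_inter_finite_subsets_at_top[OF that(2)]
    unfolding L2_tendsto_def
    by (auto dest: eventually_compose_filterlim filterlim_compose)
  have "L2_tendsto M (\<lambda>F \<omega>. (\<Sum>i\<in>F \<inter> A. f i \<omega>) + (\<Sum>i\<in>F \<inter> B. f i \<omega>)) (\<lambda>\<omega>. X \<omega> + Y \<omega>)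
      (finite_subsets_at_top (A \<union> B))"
    by (intro L2_tendsto_add lim A B) auto
  moreover have "(\<Sum>i\<in>F \<inter> A. f i \<omega>) + (\<Sum>i\<in>F \<inter> B. f i \<omega>) = (\<Sum>i\<in>F. f i \<omega>)"
    if "finite F" "F \<subseteq> A \<union> B" for F \<omega>
  proof -
    have "(F \<inter> A) \<union> (F \<inter> B) = F" "(F \<inter> A) \<inter> (F \<inter> B) = {}" using that \<open>A \<inter> B = {}\<close> by auto
    then show ?thesis
      using that sum.union_disjoint[of "F \<inter> A" "F \<inter> B" "\<lambda>i. f i \<omega>"] by simp
  qed
  then have "\<forall>\<^sub>F F in finite_subsets_at_top (A \<union> B).
      (\<lambda>\<omega>. (\<Sum>i\<in>F \<inter> A. f i \<omega>) + (\<Sum>i\<in>F \<inter> B. f i \<omega>)) = (\<lambda>\<omega>. \<Sum>i\<in>F. f i \<omega>)"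
    by (intro eventually_finite_subsets_at_top_weakI) auto
  ultimately have "L2_tendsto M (\<lambda>F \<omega>. \<Sum>i\<in>F. f i \<omega>) (\<lambda>\<omega>. X \<omega> + Y \<omega>) (finite_subsets_at_top (A \<union> B))"
    by (rule L2_tendsto_cong)
  then show ?thesis using A B by (auto simp: L2_has_sum_def)
qed

lemma L2_has_sum_words_atMost:
  assumes "\<And>j. L2_has_sum M f (words_of_length A j) (T j)"
  shows "L2_has_sum M f {w \<in> lists A. length w \<le> n} (\<lambda>\<omega>. \<Sum>j\<le>n. (T j \<omega> :: real^'n))"
proof (induction n)
  case 0
  have "{w \<in> lists A. length w \<le> 0} = words_of_length A 0"
    by (auto simp: words_of_length_def)
  then show ?case using assms[of 0] by simp
next
  case (Suc n)
  have "{w \<in> lists A. length w \<le> n} \<union> words_of_length A (Suc n) = {w \<in> lists A. length w \<le> Suc n}"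
    by (auto simp: words_of_length_def)
  moreover have "{w \<in> lists A. length w \<le> n} \<inter> words_of_length A (Suc n) = {}"
    by (auto simp: words_of_length_def)
  ultimately show ?case
    using L2_has_sum_disjoint_union[OF Suc.IH assms[of "Suc n"]] by simp
qed

text \<open>The layers \<open>T j\<close> of a \<open>word_series\<close> come from an existential,
  while \<open>Y1\<close> and \<open>Y2\<close> are versions chosen elsewhere. Uniqueness of
  mean-square sums identifies the layers of lengths \<open>0\<close> to \<open>n + 1\<close> with
  them up to null sets, and subtracting this fixed random variable from the partial sums leaves the
  tail.\<close>

lemma word_series_tail:
  assumes ser: "word_series M A f 0 Y"
    and head: "L2_has_sum M f {w \<in> lists A. length w \<le> n} Y1"
    and lead: "L2_has_sum M f (words_of_length A (n + 1)) Y2"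
    and X: "X \<in> borel_measurable M" "AE \<omega> in M. X \<omega> = Y \<omega> - Y1 \<omega> - Y2 \<omega>"
  shows "word_series M A f (n + 2) X"
proof -
  obtain T where T: "\<And>j. L2_has_sum M f (words_of_length A j) (T j)"
    and lim: "L2_tendsto M (\<lambda>m \<omega>. \<Sum>j\<in>{0..m}. T j \<omega>) Y sequentially"
    using ser by (auto simp: word_series_def)
  have L2T: "L2 M (T j)" for j
    using T[of j] by (auto simp: L2_has_sum_def L2_tendsto_def)
  have 1: "AE \<omega> in M. (\<Sum>j\<le>n. T j \<omega>) = Y1 \<omega>"
    by (rule L2_has_sum_unique[OF L2_has_sum_words_atMost[OF T] head])
  have 2: "AE \<omega> in M. T (n + 1) \<omega> = Y2 \<omega>"
    by (rule L2_has_sum_unique[OF T lead])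
  have L2S: "L2 M (\<lambda>\<omega>. \<Sum>j\<le>n + 1. T j \<omega>)" by (intro L2_sum L2T)
  have "L2_tendsto M (\<lambda>m \<omega>. \<Sum>j\<in>{n + 2..m}. T j \<omega>) X sequentially"
  proof (rule L2_tendsto_cong_AE)
    show "L2_tendsto M (\<lambda>m \<omega>. (\<Sum>j\<in>{0..m}. T j \<omega>) - (\<Sum>j\<le>n + 1. T j \<omega>))
        (\<lambda>\<omega>. Y \<omega> - (\<Sum>j\<le>n + 1. T j \<omega>)) sequentially"
      by (rule L2_tendsto_diff[OF lim L2_tendsto_const[OF L2S]])
    show "X \<in> borel_measurable M" by fact
    show "AE \<omega> in M. Y \<omega> - (\<Sum>j\<le>n + 1. T j \<omega>) = X \<omega>"
      using 1 2 X(2) by eventually_elim simp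
    show "\<forall>\<^sub>F m in sequentially. (\<lambda>\<omega>. \<Sum>j = n + 2..m. T j \<omega>) \<in> borel_measurable M \<and>
      (AE \<omega> in M. (\<Sum>j = 0..m. T j \<omega>) - (\<Sum>j\<le>n + 1. T j \<omega>) = (\<Sum>j = n + 2..m. T j \<omega>))"
      using eventually_ge_at_top[of "n + 1"]
    proof eventually_elim
      case (elim m)
      have "{0..m} = {..n + 1} \<union> {n + 2..m}" using elim by auto
      then have "(\<Sum>j = 0..m. T j \<omega>) = (\<Sum>j\<le>n + 1. T j \<omega>) + (\<Sum>j = n + 2..m. T j \<omega>)" for \<omega>
        by (simp only:) (rule sum.union_disjoint, auto)
      then show ?case using L2_measurable[OF L2_sum[OF L2T]] by auto
    qed
  qed
  then show ?thesis using T by (auto simp: word_series_def)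
qed

section \<open>Alignments of two words\<close>

text \<open>
  The value is the total weight of all ways of emptying the pair of words in k steps, a step
  removing either a time letter from the front of one word (weight 1) or the first letters of
  both words (weight \<open>\<kappa>\<close>).
\<close>

fun alignments :: "('l \<Rightarrow> 'l \<Rightarrow> real) \<Rightarrow> 'l \<Rightarrow> nat \<Rightarrow> 'l list \<Rightarrow> 'l list \<Rightarrow> real" where
  "alignments \<kappa> z 0 u v = (if u = [] \<and> v = [] then 1 else 0)"
| "alignments \<kappa> z (Suc k) u v =
     (if u \<noteq> [] \<and> v \<noteq> [] then \<kappa> (hd u) (hd v) * alignments \<kappa> z k (tl u) (tl v) else 0) +
     (if u \<noteq> [] \<and> hd u = z then alignments \<kappa> z k (tl u) v else 0) +
     (if v \<noteq> [] \<and> hd v = z then alignments \<kappa> z k u (tl v) else 0)"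

text \<open>Separates words of length zero, one and at least two. Only in the last case are the
  first and the last letter different positions, so that removals at the two ends commute
  literally.\<close>

lemma word_ends_cases:
  obtains "u = []" | x where "u = [x]" | x m y where "u = x # m @ [y]"
  by (metis append_Cons append_Nil list.exhaust rev_exhaust)

text \<open>A removal at the front and a removal at the back commute. With at least two steps, the
  first step can be peeled off at the front and the last one at the back in either order, giving the
  same double sum; the induction hypothesis supplies the inner peeling.\<close>

lemma alignments_back:
  "alignments \<kappa> z (Suc k) u v =
     (if u \<noteq> [] \<and> v \<noteq> [] then \<kappa> (last u) (last v) * alignments \<kappa> z k (butlast u) (butlast v) else 0) +
     (if u \<noteq> [] \<and> last u = z then alignments \<kappa> z k (butlast u) v else 0) +
     (if v \<noteq> [] \<and> last v = z then alignments \<kappa> z k u (butlast v) else 0)"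
proof (induction k arbitrary: u v)
  case 0
  show ?case by (cases u rule: word_ends_cases; cases v rule: word_ends_cases) simp_all
next
  case (Suc k)
  \<comment> \<open>Turning the conditionals into factors makes both double expansions sums of
    products, which agree by commutativity instead of by a large case analysis.\<close>
  have if_of_bool: "(if P then x else 0) = of_bool P * x" for P and x :: real by simp
  show ?case
    unfolding alignments.simps(2)[of \<kappa> z "Suc k" u v]
      Suc.IH[of "tl u" "tl v"] Suc.IH[of "tl u" v] Suc.IH[of u "tl v"]
      alignments.simps(2)[of \<kappa> z k "butlast u" "butlast v"]
      alignments.simps(2)[of \<kappa> z k "butlast u" v] alignments.simps(2)[of \<kappa> z k u "butlast v"]
    unfolding if_of_bool
    by (cases u rule: word_ends_cases; cases v rule: word_ends_cases)
      (simp_all add: butlast_append distrib_left mult_ac del: alignments.simps of_bool_conj)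
qed

text \<open>Reversal exchanges front steps with back steps, and \<open>alignments_back\<close> says
  that both recursions compute the same number. This is the symmetry behind the whole
  theorem.\<close>

lemma alignments_rev: "alignments \<kappa> z k (rev u) (rev v) = alignments \<kappa> z k u v"
proof (induction k arbitrary: u v)
  case (Suc k)
  have rev_butlast: "rev (butlast w) = tl (rev w)" for w :: "'a list"
    by (induction w rule: rev_induct) auto
  show ?case
    unfolding alignments_back[of \<kappa> z k u v] alignments.simps(2)[of \<kappa> z k "rev u" "rev v"]
    by (simp add: hd_rev rev_butlast[symmetric] Suc.IH Suc.IH[of _ "[]", simplified] Suc.IH[of "[]", simplified])
qed simp

text \<open>Every step removes at least one letter. It allows the summation bound in
  \<open>moment_poly\<close> to be enlarged at will, so that words of different lengths can share
  one bound.\<close>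

lemma alignments_eq_0: "length u + length v < k \<Longrightarrow> alignments \<kappa> z k u v = 0"
  by (induction k arbitrary: u v) (auto simp: neq_Nil_conv)

text \<open>Each of the \<open>k\<close> steps of an alignment carries one integration time, and
  \<open>t ^ k / fact k\<close> is the volume of the simplex of ordered times in
  \<open>(0, t]\<close>.\<close>

definition moment_poly :: "('l \<Rightarrow> 'l \<Rightarrow> real) \<Rightarrow> 'l \<Rightarrow> 'l list \<Rightarrow> 'l list \<Rightarrow> real \<Rightarrow> real" where
  "moment_poly \<kappa> z u v t = (\<Sum>k\<le>length u + length v. alignments \<kappa> z k u v * t ^ k / fact k)"

lemma moment_poly_rev: "moment_poly \<kappa> z (rev u) (rev v) t = moment_poly \<kappa> z u v t"
  by (simp add: moment_poly_def alignments_rev)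

lemma moment_poly_eq:
  assumes "length u + length v \<le> n"
  shows "moment_poly \<kappa> z u v t = (\<Sum>k\<le>n. alignments \<kappa> z k u v * t ^ k / fact k)"
  unfolding moment_poly_def using assms
  by (intro sum.mono_neutral_left) (auto simp: alignments_eq_0 not_le)

lemma moment_poly_Nil [simp]: "moment_poly \<kappa> z [] [] t = 1"
  by (simp add: moment_poly_def)

lemma has_integral_monomial:
  assumes "0 \<le> t"
  shows "has_bochner_integral (restrict_space lborel {0<..t}) (\<lambda>s. s ^ k / fact k) (t ^ Suc k / fact (Suc k) :: real)"
proof -
  have "has_bochner_integral lborel (\<lambda>s. (s ^ k / fact k) * indicator {0..t} s) (t ^ Suc k / fact (Suc k) - 0 ^ Suc k / fact (Suc k) :: real)"
    using assms
  proof (rule has_bochner_integral_FTC_Icc_real)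
    fix x :: real
    show "DERIV (\<lambda>s. s ^ Suc k / fact (Suc k)) x :> x ^ k / fact k"
      by (auto intro!: derivative_eq_intros simp del: power_Suc)
    show "isCont (\<lambda>s. s ^ k / fact k) x" by (intro continuous_intros) auto
  qed
  \<comment> \<open>The fundamental theorem is available on the closed interval, which differs from
    the half-open one by the null set \<open>{0}\<close>.\<close>
  moreover have "AE s in lborel. (s ^ k / fact k) * indicator {0..t} s = (indicator {0<..t} s *\<^sub>R (s ^ k / fact k) :: real)"
    using AE_lborel_singleton[of 0] by eventually_elim (auto simp: indicator_def)
  ultimately have "has_bochner_integral lborel (\<lambda>s. indicator {0<..t} s *\<^sub>R (s ^ k / fact k)) (t ^ Suc k / fact (Suc k) :: real)"
    by (subst (asm) has_bochner_integral_cong_AE[where g = "\<lambda>s. indicator {0<..t} s *\<^sub>R (s ^ k / fact k)"]) auto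
  then show ?thesis
    by (subst has_bochner_integral_restrict_space) auto
qed

lemma integral_moment_poly:
  assumes t: "0 \<le> t" and "length u + length v \<le> n"
  shows "(\<integral>s. moment_poly \<kappa> z u v s \<partial>restrict_space lborel {0<..t}) =
    (\<Sum>k\<le>n. alignments \<kappa> z k u v * t ^ Suc k / fact (Suc k))"
proof -
  note 1 = has_integral_monomial[OF t]
  have "moment_poly \<kappa> z u v s = (\<Sum>k\<le>n. alignments \<kappa> z k u v * (s ^ k / fact k))" for s
    using moment_poly_eq[OF assms(2)] by simp
  then show ?thesis
    using integrable.intros[OF 1] has_bochner_integral_integral_eq[OF 1]
    by (simp del: times_divide_eq_right power_Suc fact_Suc add: times_divide_eq_right[symmetric])
qed

text \<open>Peeling at the back matches the order of integration, in which the last letter is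
  outermost. Integrating \<open>s ^ k / fact k\<close> over \<open>(0, t]\<close> raises the degree
  by one, just as one more step does; the result has the same form as the recursion that the Ito
  calculus gives for moments.\<close>

lemma moment_poly_rec:
  assumes t: "0 \<le> t" and ne: "u \<noteq> [] \<or> v \<noteq> []"
  shows "moment_poly \<kappa> z u v t =
     (if u \<noteq> [] \<and> v \<noteq> [] then \<kappa> (last u) (last v) *
        (\<integral>s. moment_poly \<kappa> z (butlast u) (butlast v) s \<partial>restrict_space lborel {0<..t}) else 0) +
     (if u \<noteq> [] \<and> last u = z then
        (\<integral>s. moment_poly \<kappa> z (butlast u) v s \<partial>restrict_space lborel {0<..t}) else 0) +
     (if v \<noteq> [] \<and> last v = z then
        (\<integral>s. moment_poly \<kappa> z u (butlast v) s \<partial>restrict_space lborel {0<..t}) else 0)"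
proof -
  define n where "n = length u + length v"
  have le: "length (butlast u) + length (butlast v) \<le> n" "length (butlast u) + length v \<le> n"
    "length u + length (butlast v) \<le> n" by (auto simp: n_def)
  have "moment_poly \<kappa> z u v t = (\<Sum>k\<le>Suc n. alignments \<kappa> z k u v * t ^ k / fact k)"
    by (rule moment_poly_eq) (simp add: n_def)
  also have "\<dots> = (\<Sum>k\<le>n. alignments \<kappa> z (Suc k) u v * t ^ Suc k / fact (Suc k))"
    \<comment> \<open>The term for \<open>k = 0\<close> vanishes because an alignment without steps
      requires both words to be empty.\<close>
    using ne by (subst sum.atMost_Suc_shift) auto
  also have "\<dots> = (if u \<noteq> [] \<and> v \<noteq> [] then \<kappa> (last u) (last v) *
        (\<Sum>k\<le>n. alignments \<kappa> z k (butlast u) (butlast v) * t ^ Suc k / fact (Suc k)) else 0) +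
     (if u \<noteq> [] \<and> last u = z then (\<Sum>k\<le>n. alignments \<kappa> z k (butlast u) v * t ^ Suc k / fact (Suc k)) else 0) +
     (if v \<noteq> [] \<and> last v = z then (\<Sum>k\<le>n. alignments \<kappa> z k u (butlast v) * t ^ Suc k / fact (Suc k)) else 0)"
    unfolding alignments_back
    by (auto simp: sum.distrib[symmetric] sum_distrib_left intro!: sum.cong simp del: power_Suc fact_Suc)
      (simp_all add: add_divide_distrib distrib_right mult.assoc del: power_Suc fact_Suc)
  finally show ?thesis unfolding integral_moment_poly[OF t le(1)] integral_moment_poly[OF t le(2)] integral_moment_poly[OF t le(3)] .
qed

section \<open>The It\^o isometry\<close>

lemma (in pair_sigma_finite) integrable_mult_fst_snd:
  fixes f g :: "_ \<Rightarrow> real"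
  assumes f: "integrable M1 f" and g: "integrable M2 g"
  shows "integrable (M1 \<Otimes>\<^sub>M M2) (\<lambda>x. f (fst x) * g (snd x))"
    and "(\<integral>x. f (fst x) * g (snd x) \<partial>(M1 \<Otimes>\<^sub>M M2)) = (\<integral>x. f x \<partial>M1) * (\<integral>y. g y \<partial>M2)"
proof -
  have [measurable]: "f \<in> borel_measurable M1" "g \<in> borel_measurable M2" using f g by auto
  show int: "integrable (M1 \<Otimes>\<^sub>M M2) (\<lambda>x. f (fst x) * g (snd x))"
  proof (rule Fubini_integrable)
    show "integrable M1 (\<lambda>x. \<integral>y. norm (f (fst (x, y)) * g (snd (x, y))) \<partial>M2)"
      using f by (simp add: abs_mult)
    show "AE x in M1. integrable M2 (\<lambda>y. f (fst (x, y)) * g (snd (x, y)))"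
      using g by simp
  qed simp
  have "(\<integral>x. f (fst x) * g (snd x) \<partial>(M1 \<Otimes>\<^sub>M M2)) = (\<integral>x. \<integral>y. f x * g y \<partial>M2 \<partial>M1)"
    using integral_fst'[OF int] by simp
  then show "(\<integral>x. f (fst x) * g (snd x) \<partial>(M1 \<Otimes>\<^sub>M M2)) = (\<integral>x. f x \<partial>M1) * (\<integral>y. g y \<partial>M2)"
    by simp
qed

section \<open>The time interval as a finite measure space\<close>

abbreviation time_measure :: "real \<Rightarrow> real measure" where
  "time_measure t \<equiv> restrict_space lborel {0<..t}"

lemma finite_measure_time: "finite_measure (time_measure t)"
  by (rule finite_measureI, cases "0 \<le> t") (simp_all add: space_restrict_space emeasure_restrict_space)

lemma space_time_measure [simp]: "space (time_measure t) = {0<..t}"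
  by (simp add: space_restrict_space)

lemma measurable_fst_time [measurable]: "fst \<in> borel_measurable (time_measure t \<Otimes>\<^sub>M M)"
proof -
  have "(\<lambda>x. x) \<in> borel_measurable (time_measure t)"
    by (rule measurable_restrict_space1) simp
  then show ?thesis
    using measurable_compose[OF measurable_fst] by fastforce
qed

lemma time_measure_integral_indicator:
  assumes "0 \<le> p" "0 \<le> p'"
  shows "integrable (time_measure t) (\<lambda>s. indicator {p<..q} s * indicator {p'<..q'} s :: real)"
    and "(\<integral>s. indicator {p<..q} s * indicator {p'<..q'} s \<partial>time_measure t) =
      max 0 (min (min q t) (min q' t) - max p p')"
proof -
  interpret T: finite_measure "time_measure t" by (rule finite_measure_time)
  have eq: "indicator {p<..q} s * indicator {p'<..q'} s = (indicator {max p p'<..min q q'} s :: real)" for s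
    by (auto simp: indicator_def)
  show "integrable (time_measure t) (\<lambda>s. indicator {p<..q} s * indicator {p'<..q'} s :: real)"
    unfolding eq
    by (rule T.integrable_const_bound[where B = 1])
      (auto intro!: measurable_restrict_space1)
  have "(\<integral>s. indicator {p<..q} s * indicator {p'<..q'} s \<partial>time_measure t) =
      (\<integral>s. indicator {max p p'<..min q q'} s \<partial>time_measure t :: real)"
    by (simp only: eq)
  also have "\<dots> = (\<integral>s. indicator {0<..t} s *\<^sub>R indicator {max p p'<..min q q'} s \<partial>lborel)"
    by (rule integral_restrict_space) simp
  also have "\<dots> = (\<integral>s. indicator {max p p'<..min (min q t) (min q' t)} s \<partial>lborel)"
    using assms by (intro Bochner_Integration.integral_cong) (auto simp: indicator_def)
  also have "\<dots> = max 0 (min (min q t) (min q' t) - max p p')"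
    by (cases "max p p' \<le> min (min q t) (min q' t)") (simp_all del: max.bounded_iff min.bounded_iff)
  finally show "(\<integral>s. indicator {p<..q} s * indicator {p'<..q'} s \<partial>time_measure t) =
      max 0 (min (min q t) (min q' t) - max p p')" .
qed

text \<open>Lets an approximation error on \<open>(0, t]\<close> control the error on a shorter
  interval, as needed to compare integrals at two times.\<close>

lemma nn_integral_time_mono:
  assumes "sigma_finite_measure M" "f \<in> borel_measurable (time_measure s \<Otimes>\<^sub>M M)"
    "f \<in> borel_measurable (time_measure t \<Otimes>\<^sub>M M)" "s \<le> t"
  shows "(\<integral>\<^sup>+ x. f x \<partial>(time_measure s \<Otimes>\<^sub>M M)) \<le> (\<integral>\<^sup>+ x. f x \<partial>(time_measure t \<Otimes>\<^sub>M M))"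
  unfolding sigma_finite_measure.nn_integral_fst[OF assms(1,2), symmetric]
    sigma_finite_measure.nn_integral_fst[OF assms(1,3), symmetric]
  using assms(4)
  by (auto simp: nn_integral_restrict_space intro!: nn_integral_mono split: split_indicator)

lemma simple_integrand_times:
  assumes "simple_integrand M F k \<tau> \<xi>" "j \<le> k"
  shows "0 \<le> \<tau> j"
  using assms(2)
proof (induction j)
  case 0
  then show ?case using assms(1) by (simp add: simple_integrand_def)
next
  case (Suc j)
  then have "\<tau> j \<le> \<tau> (Suc j)" using assms(1) by (simp add: simple_integrand_def)
  with Suc show ?case by simp
qed

lemma simple_integrand_coeff:
  assumes "simple_integrand M F k \<tau> \<xi>" "j < k"
  shows "\<tau> j \<le> \<tau> (Suc j)" "\<xi> j \<in> borel_measurable (F (\<tau> j))"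
    "\<exists>C. \<forall>\<omega>\<in>space M. \<bar>\<xi> j \<omega>\<bar> \<le> C"
  using assms by (auto simp: simple_integrand_def bounded_iff)

text \<open>
  Abstract driving noise: \<open>Base 0\<close> is time, the other letters are square integrable martingales
  with predictable covariations \<open>\<kappa> a b * t\<close>.
\<close>

locale ito_noise = prob_space M
  for M :: "'a measure" +
  fixes F :: "real \<Rightarrow> 'a measure" and A :: "letter set"
    and Z :: "letter \<Rightarrow> real \<Rightarrow> 'a \<Rightarrow> real" and \<kappa> :: "letter \<Rightarrow> letter \<Rightarrow> real"
  assumes subalg: "\<And>t. subalgebra M (F t)"
    and F_mono: "\<And>s t. s \<le> t \<Longrightarrow> subalgebra (F t) (F s)"
    and time_letter: "\<And>t \<omega>. Z (Base 0) t \<omega> = t"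
    and \<kappa>_time: "\<And>b. \<kappa> (Base 0) b = 0"
    and \<kappa>_sym: "\<And>a b. \<kappa> a b = \<kappa> b a"
    and Z_adapted: "\<And>a t. a \<in> A - {Base 0} \<Longrightarrow> 0 \<le> t \<Longrightarrow> Z a t \<in> borel_measurable (F t)"
    and L2_Z: "\<And>a t. a \<in> A - {Base 0} \<Longrightarrow> 0 \<le> t \<Longrightarrow> L2 M (Z a t)"
    and orth: "\<And>a s t \<xi>. a \<in> A - {Base 0} \<Longrightarrow> 0 \<le> s \<Longrightarrow> s \<le> t \<Longrightarrow>
      \<xi> \<in> borel_measurable (F s) \<Longrightarrow> L2 M \<xi> \<Longrightarrow> (\<integral>\<omega>. \<xi> \<omega> * (Z a t \<omega> - Z a s \<omega>) \<partial>M) = 0"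
    and iso: "\<And>a b s t \<xi> C. a \<in> A - {Base 0} \<Longrightarrow> b \<in> A - {Base 0} \<Longrightarrow> 0 \<le> s \<Longrightarrow> s \<le> t \<Longrightarrow>
      \<xi> \<in> borel_measurable (F s) \<Longrightarrow> (\<And>\<omega>. \<omega> \<in> space M \<Longrightarrow> \<bar>\<xi> \<omega>\<bar> \<le> C) \<Longrightarrow>
      (\<integral>\<omega>. \<xi> \<omega> * (Z a t \<omega> - Z a s \<omega>) * (Z b t \<omega> - Z b s \<omega>) \<partial>M) = \<kappa> a b * (t - s) * (\<integral>\<omega>. \<xi> \<omega> \<partial>M)"
begin

lemma F_M: "f \<in> borel_measurable (F t) \<Longrightarrow> f \<in> borel_measurable M"
  by (rule measurable_from_subalg[OF subalg])

lemma F_le: "f \<in> borel_measurable (F s) \<Longrightarrow> s \<le> t \<Longrightarrow> f \<in> borel_measurable (F t)"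
  by (rule measurable_from_subalg[OF F_mono])

lemma L2_bounded:
  fixes f :: "'a \<Rightarrow> real"
  assumes "f \<in> borel_measurable M" "\<And>\<omega>. \<omega> \<in> space M \<Longrightarrow> \<bar>f \<omega>\<bar> \<le> C"
  shows "L2 M f"
  using L2_mult_bounded[OF L2_const[of 1] assms] by simp

lemma L2_incr:
  assumes "a \<in> A - {Base 0}" "0 \<le> s" "0 \<le> t"
  shows "L2 M (\<lambda>\<omega>. Z a t \<omega> - Z a s \<omega>)"
  by (rule L2_diff[OF L2_Z L2_Z]) (use assms in auto)

lemma incr_adapted:
  assumes "a \<in> A - {Base 0}" "0 \<le> s" "0 \<le> t" "s \<le> r" "t \<le> r"
  shows "(\<lambda>\<omega>. Z a t \<omega> - Z a s \<omega>) \<in> borel_measurable (F r)"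
  using F_le[OF Z_adapted[OF assms(1,2)] assms(4)] F_le[OF Z_adapted[OF assms(1,3)] assms(5)] by simp

section \<open>The isometry for increments and for simple integrals\<close>

text \<open>Cut the longer increment at \<open>q\<close>. Up to \<open>q\<close> the axiom
  \<open>iso\<close> applies; the remainder after \<open>q\<close> is orthogonal to everything
  measurable at time \<open>q\<close>, which includes the weight times the shorter
  increment.\<close>

lemma isometry_same_start_le:
  assumes a: "a \<in> A - {Base 0}" and b: "b \<in> A - {Base 0}" and "0 \<le> p" "p \<le> q" "q \<le> q'"
    and U: "U \<in> borel_measurable (F p)" "\<And>\<omega>. \<omega> \<in> space M \<Longrightarrow> \<bar>U \<omega>\<bar> \<le> C"
  shows "(\<integral>\<omega>. U \<omega> * (Z a q \<omega> - Z a p \<omega>) * (Z b q' \<omega> - Z b p \<omega>) \<partial>M) = \<kappa> a b * (q - p) * (\<integral>\<omega>. U \<omega> \<partial>M)"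
proof -
  let ?\<xi> = "\<lambda>\<omega>. U \<omega> * (Z a q \<omega> - Z a p \<omega>)"
  have \<xi>: "L2 M ?\<xi>" by (rule L2_mult_bounded[OF L2_incr[OF a] F_M[OF U(1)] U(2)]) (use assms in auto)
  have \<xi>': "?\<xi> \<in> borel_measurable (F q)"
    using F_le[OF U(1) \<open>p \<le> q\<close>] incr_adapted[OF a, of p q q] assms by simp
  have "(\<integral>\<omega>. U \<omega> * (Z a q \<omega> - Z a p \<omega>) * (Z b q' \<omega> - Z b p \<omega>) \<partial>M) =
      (\<integral>\<omega>. ?\<xi> \<omega> * (Z b q \<omega> - Z b p \<omega>) + ?\<xi> \<omega> * (Z b q' \<omega> - Z b q \<omega>) \<partial>M)"
    by (simp add: algebra_simps)
  also have "\<dots> = (\<integral>\<omega>. ?\<xi> \<omega> * (Z b q \<omega> - Z b p \<omega>) \<partial>M) + (\<integral>\<omega>. ?\<xi> \<omega> * (Z b q' \<omega> - Z b q \<omega>) \<partial>M)"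
    using assms by (intro Bochner_Integration.integral_add L2_mult_integrable \<xi> L2_incr[OF b]) auto
  also have "(\<integral>\<omega>. ?\<xi> \<omega> * (Z b q' \<omega> - Z b q \<omega>) \<partial>M) = 0"
    using assms by (intro orth[OF b] \<xi> \<xi>') auto
  finally show ?thesis using iso[OF a b _ _ U] assms by simp
qed

lemma isometry_same_start:
  assumes a: "a \<in> A - {Base 0}" and b: "b \<in> A - {Base 0}" and "0 \<le> p" "p \<le> q" "p \<le> q'"
    and U: "U \<in> borel_measurable (F p)" "\<And>\<omega>. \<omega> \<in> space M \<Longrightarrow> \<bar>U \<omega>\<bar> \<le> C"
  shows "(\<integral>\<omega>. U \<omega> * (Z a q \<omega> - Z a p \<omega>) * (Z b q' \<omega> - Z b p \<omega>) \<partial>M) =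
    \<kappa> a b * (min q q' - p) * (\<integral>\<omega>. U \<omega> \<partial>M)"
proof (cases "q \<le> q'")
  case True
  then show ?thesis using isometry_same_start_le[OF a b _ _ _ U, of q q'] assms by (simp add: min_def)
next
  case False
  then show ?thesis
    using isometry_same_start_le[OF b a _ _ _ U, of q' q] assms by (simp add: min_def \<kappa>_sym mult_ac)
qed

text \<open>The weight is measurable only at the later starting time \<open>p'\<close>. The
  increment that starts earlier is cut there: its first part acts as part of an
  \<open>F p'\<close>-measurable weight and contributes nothing, and the second part starts together
  with the other increment. If the first interval ends before \<open>p'\<close>, it belongs to that
  weight entirely.\<close>

lemma isometry_interval_le:
  assumes a: "a \<in> A - {Base 0}" and b: "b \<in> A - {Base 0}"
    and "0 \<le> p" "p \<le> q" "p \<le> p'" "p' \<le> q'"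
    and U: "U \<in> borel_measurable (F p')" "\<And>\<omega>. \<omega> \<in> space M \<Longrightarrow> \<bar>U \<omega>\<bar> \<le> C"
  shows "(\<integral>\<omega>. U \<omega> * (Z a q \<omega> - Z a p \<omega>) * (Z b q' \<omega> - Z b p' \<omega>) \<partial>M) =
    \<kappa> a b * max 0 (min q q' - max p p') * (\<integral>\<omega>. U \<omega> \<partial>M)"
proof (cases "q \<le> p'")
  case True
  have "(\<integral>\<omega>. (U \<omega> * (Z a q \<omega> - Z a p \<omega>)) * (Z b q' \<omega> - Z b p' \<omega>) \<partial>M) = 0"
  proof (rule orth[OF b])
    show "(\<lambda>\<omega>. U \<omega> * (Z a q \<omega> - Z a p \<omega>)) \<in> borel_measurable (F p')"
      using U(1) incr_adapted[OF a, of p q p'] assms True by simp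
    show "L2 M (\<lambda>\<omega>. U \<omega> * (Z a q \<omega> - Z a p \<omega>))"
      by (rule L2_mult_bounded[OF L2_incr[OF a] F_M[OF U(1)] U(2)]) (use assms in auto)
  qed (use assms in auto)
  then show ?thesis using True assms by (simp add: max_def min_def)
next
  case False
  have L: "L2 M (\<lambda>\<omega>. U \<omega> * (Z a p' \<omega> - Z a p \<omega>))" "L2 M (\<lambda>\<omega>. U \<omega> * (Z a q \<omega> - Z a p' \<omega>))"
    using assms by (auto intro!: L2_mult_bounded[OF L2_incr[OF a] F_M[OF U(1)] U(2)])
  have "(\<integral>\<omega>. U \<omega> * (Z a q \<omega> - Z a p \<omega>) * (Z b q' \<omega> - Z b p' \<omega>) \<partial>M) =
     (\<integral>\<omega>. U \<omega> * (Z a p' \<omega> - Z a p \<omega>) * (Z b q' \<omega> - Z b p' \<omega>) + U \<omega> * (Z a q \<omega> - Z a p' \<omega>) * (Z b q' \<omega> - Z b p' \<omega>) \<partial>M)"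
    by (simp add: algebra_simps)
  also have "\<dots> = (\<integral>\<omega>. U \<omega> * (Z a p' \<omega> - Z a p \<omega>) * (Z b q' \<omega> - Z b p' \<omega>) \<partial>M) +
     (\<integral>\<omega>. U \<omega> * (Z a q \<omega> - Z a p' \<omega>) * (Z b q' \<omega> - Z b p' \<omega>) \<partial>M)"
    using assms by (intro Bochner_Integration.integral_add L2_mult_integrable L L2_incr[OF b]) auto
  also have "(\<integral>\<omega>. U \<omega> * (Z a p' \<omega> - Z a p \<omega>) * (Z b q' \<omega> - Z b p' \<omega>) \<partial>M) = 0"
    using assms incr_adapted[OF a, of p p' p'] by (intro orth[OF b] L) auto
  also have "(\<integral>\<omega>. U \<omega> * (Z a q \<omega> - Z a p' \<omega>) * (Z b q' \<omega> - Z b p' \<omega>) \<partial>M) =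
      \<kappa> a b * (min q q' - p') * (\<integral>\<omega>. U \<omega> \<partial>M)"
    using assms False by (intro isometry_same_start[OF a b _ _ _ U]) auto
  finally show ?thesis using False assms by (simp add: max_def)
qed

lemma isometry_interval:
  assumes a: "a \<in> A - {Base 0}" and b: "b \<in> A - {Base 0}"
    and "0 \<le> p" "p \<le> q" "0 \<le> p'" "p' \<le> q'"
    and U: "U \<in> borel_measurable (F (max p p'))" "\<And>\<omega>. \<omega> \<in> space M \<Longrightarrow> \<bar>U \<omega>\<bar> \<le> C"
  shows "(\<integral>\<omega>. U \<omega> * (Z a q \<omega> - Z a p \<omega>) * (Z b q' \<omega> - Z b p' \<omega>) \<partial>M) =
    \<kappa> a b * max 0 (min q q' - max p p') * (\<integral>\<omega>. U \<omega> \<partial>M)"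
proof (cases "p \<le> p'")
  case True
  then show ?thesis using isometry_interval_le[OF a b, of p q p' q' U C] assms by (simp add: max_def)
next
  case False
  then show ?thesis
    using isometry_interval_le[OF b a, of p' q' p q U C] assms
    by (simp add: max_def mult_ac min.commute \<kappa>_sym[of b a])
qed

abbreviation time_space :: "real \<Rightarrow> (real \<times> 'a) measure" where
  "time_space t \<equiv> time_measure t \<Otimes>\<^sub>M M"

lemma pair_time: "pair_sigma_finite (time_measure t) M"
  using finite_measure.axioms(1)[OF finite_measure_time] sigma_finite_measure_axioms
  by (intro pair_sigma_finite.intro)

lemma finite_time_space: "finite_measure (time_space t)"
proof -
  interpret T: finite_measure "time_measure t" by (rule finite_measure_time)
  have "emeasure (time_space t) (space (time_measure t) \<times> space M) = emeasure (time_measure t) (space (time_measure t))"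
    using emeasure_pair_measure_Times[OF sets.top sets.top, of "time_measure t"]
    by (simp add: emeasure_space_1)
  then show ?thesis
    by (intro finite_measureI) (simp only: space_pair_measure, use T.emeasure_finite in auto)
qed

lemma isometry_term:
  assumes a: "a \<in> A - {Base 0}" and b: "b \<in> A - {Base 0}"
    and pq: "0 \<le> p" "p \<le> q" "0 \<le> p'" "p' \<le> q'"
    and G: "G \<in> borel_measurable (F 0)" "\<And>\<omega>. \<omega> \<in> space M \<Longrightarrow> \<bar>G \<omega>\<bar> \<le> C"
    and \<xi>: "\<xi> \<in> borel_measurable (F p)" "\<exists>C. \<forall>\<omega>\<in>space M. \<bar>\<xi> \<omega>\<bar> \<le> C"
    and \<eta>: "\<eta> \<in> borel_measurable (F p')" "\<exists>C. \<forall>\<omega>\<in>space M. \<bar>\<eta> \<omega>\<bar> \<le> C"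
    and t: "0 \<le> t"
  shows "(\<integral>\<omega>. G \<omega> * (\<xi> \<omega> * (Z a (min q t) \<omega> - Z a (min p t) \<omega>)) *
        (\<eta> \<omega> * (Z b (min q' t) \<omega> - Z b (min p' t) \<omega>)) \<partial>M) =
    \<kappa> a b * (\<integral>x. G (snd x) * (\<xi> (snd x) * indicator {p<..q} (fst x)) *
        (\<eta> (snd x) * indicator {p'<..q'} (fst x)) \<partial>time_space t)"
proof (cases "p \<le> t \<and> p' \<le> t")
  case False
  \<comment> \<open>An interval starting after \<open>t\<close> does not meet \<open>(0, t]\<close>,
    and its increment stopped at \<open>t\<close> is zero, so both sides vanish.\<close>
  then have "(\<integral>x. G (snd x) * (\<xi> (snd x) * indicator {p<..q} (fst x)) *
        (\<eta> (snd x) * indicator {p'<..q'} (fst x)) \<partial>time_space t) = (\<integral>x. 0 \<partial>time_space t)"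
    by (intro Bochner_Integration.integral_cong) (auto simp: space_pair_measure indicator_def)
  then show ?thesis using False pq by (auto simp: min_def)
next
  case True
  obtain C1 where C1: "\<forall>\<omega>\<in>space M. \<bar>\<xi> \<omega>\<bar> \<le> C1" using \<xi> by blast
  obtain C2 where C2: "\<forall>\<omega>\<in>space M. \<bar>\<eta> \<omega>\<bar> \<le> C2" using \<eta> by blast
  \<comment> \<open>The global weight and both coefficients merge into one bounded weight that is
    known at the later of the two starting times.\<close>
  define U where "U \<omega> = G \<omega> * \<xi> \<omega> * \<eta> \<omega>" for \<omega>
  have U: "U \<in> borel_measurable (F (max p p'))"
    using F_le[OF G(1), of "max p p'"] F_le[OF \<xi>(1), of "max p p'"] F_le[OF \<eta>(1), of "max p p'"] pq
    unfolding U_def by simp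
  have U_bd: "\<bar>U \<omega>\<bar> \<le> C * C1 * C2" if "\<omega> \<in> space M" for \<omega>
    using G(2)[OF that] C1 C2 that unfolding U_def abs_mult
    by (intro mult_mono) (auto intro: order_trans[OF abs_ge_zero] mult_nonneg_nonneg)
  interpret pair_sigma_finite "time_measure t" M by (rule pair_time)
  have intU: "integrable M U"
    using L2_bounded[OF F_M[OF U] U_bd] by (rule L2_integrable_real)
  have "(\<integral>\<omega>. G \<omega> * (\<xi> \<omega> * (Z a (min q t) \<omega> - Z a (min p t) \<omega>)) *
        (\<eta> \<omega> * (Z b (min q' t) \<omega> - Z b (min p' t) \<omega>)) \<partial>M) =
      (\<integral>\<omega>. U \<omega> * (Z a (min q t) \<omega> - Z a p \<omega>) * (Z b (min q' t) \<omega> - Z b p' \<omega>) \<partial>M)"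
    using True by (simp add: U_def min_absorb1 mult_ac)
  also have "\<dots> = \<kappa> a b * (max 0 (min (min q t) (min q' t) - max p p') * (\<integral>\<omega>. U \<omega> \<partial>M))"
    using isometry_interval[OF a b _ _ _ _ U U_bd, of "min q t" "min q' t"] True pq by simp
  also have "max 0 (min (min q t) (min q' t) - max p p') * (\<integral>\<omega>. U \<omega> \<partial>M) =
     (\<integral>x. (indicator {p<..q} (fst x) * indicator {p'<..q'} (fst x)) * U (snd x) \<partial>time_space t)"
    using time_measure_integral_indicator[OF pq(1,3), of t q q']
    by (subst integrable_mult_fst_snd(2)[OF _ intU]) auto
  finally show ?thesis by (simp add: U_def mult_ac)
qed

lemma L2_simple_integral_term:
  assumes "simple_integrand M F k \<tau> \<xi>" "j < k" "a \<in> A - {Base 0}" "0 \<le> t"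
  shows "L2 M (\<lambda>\<omega>. \<xi> j \<omega> * (Z a (min (\<tau> (Suc j)) t) \<omega> - Z a (min (\<tau> j) t) \<omega>))"
proof -
  obtain C where "\<forall>\<omega>\<in>space M. \<bar>\<xi> j \<omega>\<bar> \<le> C" using simple_integrand_coeff[OF assms(1,2)] by blast
  then show ?thesis
    using simple_integrand_times[OF assms(1), of j] simple_integrand_times[OF assms(1), of "Suc j"] assms
    by (intro L2_mult_bounded[OF L2_incr F_M[OF simple_integrand_coeff(2)]]) auto
qed

lemma L2_simple_integral:
  assumes "simple_integrand M F k \<tau> \<xi>" "a \<in> A - {Base 0}" "0 \<le> t"
  shows "L2 M (simple_integral (Z a) k \<tau> \<xi> t)"
proof -
  have "L2 M (\<lambda>\<omega>. \<Sum>j<k. \<xi> j \<omega> * (Z a (min (\<tau> (Suc j)) t) \<omega> - Z a (min (\<tau> j) t) \<omega>))"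
    using L2_simple_integral_term[OF assms(1) _ assms(2,3)] by (intro L2_sum) auto
  then show ?thesis by (simp add: simple_integral_def[abs_def])
qed

lemma L2_simple_process_term:
  assumes "simple_integrand M F k \<tau> \<xi>" "j < k"
  shows "L2 (time_space t) (\<lambda>x. \<xi> j (snd x) * indicator {\<tau> j <.. \<tau> (Suc j)} (fst x))"
proof -
  interpret finite_measure "time_space t" by (rule finite_time_space)
  obtain C where C: "\<forall>\<omega>\<in>space M. \<bar>\<xi> j \<omega>\<bar> \<le> C" using simple_integrand_coeff[OF assms] by blast
  have [measurable]: "\<xi> j \<in> borel_measurable M" using simple_integrand_coeff[OF assms] F_M by blast
  have "L2 (time_space t) (\<lambda>x. (\<xi> j (snd x) * indicator {\<tau> j <.. \<tau> (Suc j)} (fst x)) * 1)"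
  proof (rule L2_mult_bounded[OF L2_const])
    show "\<bar>\<xi> j (snd x) * indicator {\<tau> j<..\<tau> (Suc j)} (fst x)\<bar> \<le> C" if "x \<in> space (time_space t)" for x
      using C that by (auto simp: space_pair_measure indicator_def intro: order_trans[OF abs_ge_zero])
  qed measurable
  then show ?thesis by simp
qed

lemma L2_simple_process:
  assumes "simple_integrand M F k \<tau> \<xi>"
  shows "L2 (time_space t) (\<lambda>x. simple_process k \<tau> \<xi> (fst x) (snd x))"
  unfolding simple_process_def
  using L2_simple_process_term[OF assms] by (intro L2_sum) auto

lemma simple_isometry:
  assumes a: "a \<in> A - {Base 0}" and b: "b \<in> A - {Base 0}" and t: "0 \<le> t"
    and G: "G \<in> borel_measurable (F 0)" "\<And>\<omega>. \<omega> \<in> space M \<Longrightarrow> \<bar>G \<omega>\<bar> \<le> C"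
    and \<xi>: "simple_integrand M F k \<tau> \<xi>" and \<eta>: "simple_integrand M F k' \<tau>' \<eta>"
  shows "(\<integral>\<omega>. G \<omega> * simple_integral (Z a) k \<tau> \<xi> t \<omega> * simple_integral (Z b) k' \<tau>' \<eta> t \<omega> \<partial>M) =
    \<kappa> a b * (\<integral>x. G (snd x) * simple_process k \<tau> \<xi> (fst x) (snd x) *
        simple_process k' \<tau>' \<eta> (fst x) (snd x) \<partial>time_space t)" (is "?L = _ * ?R")
proof -
  define f where "f j \<omega> = \<xi> j \<omega> * (Z a (min (\<tau> (Suc j)) t) \<omega> - Z a (min (\<tau> j) t) \<omega>)" for j \<omega>
  define g where "g j \<omega> = \<eta> j \<omega> * (Z b (min (\<tau>' (Suc j)) t) \<omega> - Z b (min (\<tau>' j) t) \<omega>)" for j \<omega>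
  define f' where "f' j x = \<xi> j (snd x) * indicator {\<tau> j <.. \<tau> (Suc j)} (fst x)" for j and x :: "real \<times> 'a"
  define g' where "g' j x = \<eta> j (snd x) * indicator {\<tau>' j <.. \<tau>' (Suc j)} (fst x)" for j and x :: "real \<times> 'a"
  have GM: "G \<in> borel_measurable M" by (rule F_M[OF G(1)])
  have GN: "(\<lambda>x. G (snd x)) \<in> borel_measurable (time_space t)" using GM by measurable
  have GN_bd: "\<bar>G (snd x)\<bar> \<le> C" if "x \<in> space (time_space t)" for x
    using that G(2) by (auto simp: space_pair_measure)
  have int: "integrable M (\<lambda>\<omega>. G \<omega> * f i \<omega> * g j \<omega>)" if "i < k" "j < k'" for i j
    unfolding f_def g_def
    by (intro L2_mult_integrable L2_mult_bounded[OF _ GM G(2)] L2_simple_integral_term[OF \<xi>]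
        L2_simple_integral_term[OF \<eta>] a b t that)
  have int': "integrable (time_space t) (\<lambda>x. G (snd x) * f' i x * g' j x)" if "i < k" "j < k'" for i j
    unfolding f'_def g'_def
    by (intro L2_mult_integrable L2_mult_bounded[OF _ GN GN_bd] L2_simple_process_term[OF \<xi>]
        L2_simple_process_term[OF \<eta>] that)
  have "?L = (\<integral>\<omega>. (\<Sum>i<k. \<Sum>j<k'. G \<omega> * f i \<omega> * g j \<omega>) \<partial>M)"
    by (simp add: simple_integral_def f_def g_def sum_distrib_left sum_distrib_right mult_ac)
  also have "\<dots> = (\<Sum>i<k. \<Sum>j<k'. (\<integral>\<omega>. G \<omega> * f i \<omega> * g j \<omega> \<partial>M))"
    using int by (subst Bochner_Integration.integral_sum)
      (auto intro!: sum.cong Bochner_Integration.integral_sum Bochner_Integration.integrable_sum)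
  also have "\<dots> = (\<Sum>i<k. \<Sum>j<k'. \<kappa> a b * (\<integral>x. G (snd x) * f' i x * g' j x \<partial>time_space t))"
    unfolding f_def g_def f'_def g'_def
    using simple_integrand_times[OF \<xi>] simple_integrand_times[OF \<eta>]
    by (intro sum.cong refl isometry_term[OF a b _ _ _ _ G _ _ _ _ t]
        simple_integrand_coeff[OF \<xi>] simple_integrand_coeff[OF \<eta>]) auto
  also have "\<dots> = \<kappa> a b * (\<integral>x. (\<Sum>i<k. \<Sum>j<k'. G (snd x) * f' i x * g' j x) \<partial>time_space t)"
  proof -
    have "(\<integral>x. (\<Sum>i<k. \<Sum>j<k'. G (snd x) * f' i x * g' j x) \<partial>time_space t) =
        (\<Sum>i<k. \<Sum>j<k'. (\<integral>x. G (snd x) * f' i x * g' j x \<partial>time_space t))"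
      using int' by (subst Bochner_Integration.integral_sum)
        (auto intro!: sum.cong Bochner_Integration.integral_sum Bochner_Integration.integrable_sum)
    then show ?thesis by (simp add: sum_distrib_left)
  qed
  also have "(\<lambda>x. \<Sum>i<k. \<Sum>j<k'. G (snd x) * f' i x * g' j x) = (\<lambda>x. G (snd x) * simple_process k \<tau> \<xi> (fst x) (snd x) *
        simple_process k' \<tau>' \<eta> (fst x) (snd x))"
  proof -
    have "simple_process k \<tau> \<xi> (fst x) (snd x) = (\<Sum>i<k. f' i x)"
      "simple_process k' \<tau>' \<eta> (fst x) (snd x) = (\<Sum>i<k'. g' i x)" for x
      by (simp_all only: simple_process_def f'_def g'_def)
    then show ?thesis by (simp only: sum_distrib_left[symmetric] sum_distrib_right[symmetric] mult.assoc)
  qed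
  finally show ?thesis .
qed

end

section \<open>From simple integrands to the general integral\<close>

context ito_noise begin

lemma L2_tendsto_simple_process:
  assumes \<xi>: "\<And>n. simple_integrand M F (k n) (\<tau> n) (\<xi> n)"
    and H: "(\<lambda>x. H (fst x) (snd x)) \<in> borel_measurable (time_space t)"
    and lim: "(\<lambda>n. \<integral>\<^sup>+ x. ennreal ((simple_process (k n) (\<tau> n) (\<xi> n) (fst x) (snd x) - H (fst x) (snd x))\<^sup>2)
                 \<partial>time_space t) \<longlonglongrightarrow> 0" (is "?e \<longlonglongrightarrow> 0")
  shows "L2_tendsto (time_space t) (\<lambda>n x. simple_process (k n) (\<tau> n) (\<xi> n) (fst x) (snd x))
    (\<lambda>x. H (fst x) (snd x)) sequentially"
proof -
  let ?P = "\<lambda>n x. simple_process (k n) (\<tau> n) (\<xi> n) (fst x) (snd x)" and ?H = "\<lambda>x. H (fst x) (snd x)"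
  have P: "L2 (time_space t) (?P n)" for n by (rule L2_simple_process[OF \<xi>])
  have meas: "(\<lambda>x. ?P n x - ?H x) \<in> borel_measurable (time_space t)" for n
    using L2_measurable[OF P] H by (rule borel_measurable_diff)
  have fin: "\<forall>\<^sub>F n in sequentially. ?e n < \<infinity>"
    using lim by (rule order_tendstoD) simp
  have diff: "L2 (time_space t) (\<lambda>x. ?P n x - ?H x)" if "?e n < \<infinity>" for n
    unfolding L2_def using meas[of n] that by (auto intro!: integrableI_nonneg)
  \<comment> \<open>A single index with finite error suffices: \<open>H\<close> is the simple
    process minus a difference of finite norm.\<close>
  obtain n where "?e n < \<infinity>" using fin by (auto simp: eventually_sequentially)
  then have "L2 (time_space t) (\<lambda>x. ?P n x - (?P n x - ?H x))"
    by (intro L2_diff P diff)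
  moreover have "L2_normsq (time_space t) (\<lambda>x. ?P n x - ?H x) = enn2real (?e n)" for n
    unfolding L2_normsq_def using meas[of n] by (subst integral_eq_nn_integral) auto
  moreover have "(\<lambda>n. enn2real (?e n)) \<longlonglongrightarrow> 0"
    by (rule tendsto_enn2real) (use lim in simp_all)
  ultimately show ?thesis using P by (simp add: L2_tendsto_def)
qed

lemma ito_integral_measurable:
  "ito_integral M F X H t Y \<Longrightarrow> (\<lambda>x. H (fst x) (snd x)) \<in> borel_measurable (time_space t)"
  by (simp add: ito_integral_def case_prod_beta')

text \<open>The sequence that approximates the integrand up to time \<open>t\<close> also
  approximates it up to any earlier \<open>s\<close>. The two times are kept separate because the
  martingale property evaluates one sequence at both.\<close>

lemma ito_integral_approx:
  assumes Y: "ito_integral M F X H t Y" and "s \<le> t"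
    and H: "(\<lambda>x. H (fst x) (snd x)) \<in> borel_measurable (time_space s)"
  obtains k \<tau> \<xi> where "\<And>n. simple_integrand M F (k n) (\<tau> n) (\<xi> n)"
    "L2_tendsto (time_space s) (\<lambda>n x. simple_process (k n) (\<tau> n) (\<xi> n) (fst x) (snd x))
      (\<lambda>x. H (fst x) (snd x)) sequentially"
    "L2_tendsto M (\<lambda>n. simple_integral X (k n) (\<tau> n) (\<xi> n) t) Y sequentially"
proof -
  obtain k \<tau> \<xi> where \<xi>: "\<And>n::nat. simple_integrand M F (k n) (\<tau> n) (\<xi> n)"
    and lim: "(\<lambda>n. \<integral>\<^sup>+ x. ennreal ((simple_process (k n) (\<tau> n) (\<xi> n) (fst x) (snd x) - H (fst x) (snd x))\<^sup>2)
                 \<partial>time_space t) \<longlonglongrightarrow> 0"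
    and Y': "L2_tendsto M (\<lambda>n. simple_integral X (k n) (\<tau> n) (\<xi> n) t) Y sequentially"
    using Y by (auto simp: ito_integral_def case_prod_beta')
  have Ht: "(\<lambda>x. H (fst x) (snd x)) \<in> borel_measurable (time_space t)"
    by (rule ito_integral_measurable[OF Y])
  have lims: "(\<lambda>n. \<integral>\<^sup>+ x. ennreal ((simple_process (k n) (\<tau> n) (\<xi> n) (fst x) (snd x) - H (fst x) (snd x))\<^sup>2)
                 \<partial>time_space s) \<longlonglongrightarrow> 0"
  proof (rule tendsto_sandwich[OF _ _ tendsto_const lim])
    have "(\<lambda>x. ennreal ((simple_process (k n) (\<tau> n) (\<xi> n) (fst x) (snd x) - H (fst x) (snd x))\<^sup>2)) \<in>
        borel_measurable (time_space r)" if "(\<lambda>x. H (fst x) (snd x)) \<in> borel_measurable (time_space r)" for n r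
      using L2_measurable[OF L2_simple_process[OF \<xi>]] that by simp
    then show "\<forall>\<^sub>F n in sequentially.
       (\<integral>\<^sup>+ x. ennreal ((simple_process (k n) (\<tau> n) (\<xi> n) (fst x) (snd x) - H (fst x) (snd x))\<^sup>2) \<partial>time_space s)
       \<le> (\<integral>\<^sup>+ x. ennreal ((simple_process (k n) (\<tau> n) (\<xi> n) (fst x) (snd x) - H (fst x) (snd x))\<^sup>2) \<partial>time_space t)"
      using H Ht \<open>s \<le> t\<close>
      by (intro always_eventually allI nn_integral_time_mono sigma_finite_measure_axioms) auto
  qed simp
  show thesis
    using that[OF \<xi> L2_tendsto_simple_process[OF \<xi> H lims] Y'] .
qed

lemma L2_integrand:
  assumes "ito_integral M F X H t Y"
  shows "L2 (time_space t) (\<lambda>x. H (fst x) (snd x))"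
  by (rule ito_integral_approx[OF assms order_refl ito_integral_measurable[OF assms]]) (rule L2_tendstoD(1))

lemma bounded_time_space:
  assumes "G \<in> borel_measurable M" "\<And>\<omega>. \<omega> \<in> space M \<Longrightarrow> \<bar>G \<omega>\<bar> \<le> (C::real)"
  shows "(\<lambda>x. G (snd x)) \<in> borel_measurable (time_space t)"
    "\<And>x. x \<in> space (time_space t) \<Longrightarrow> \<bar>G (snd x)\<bar> \<le> C"
  using assms by (auto simp: space_pair_measure)

text \<open>Both sides of \<open>simple_isometry\<close> are continuous in mean square, the left one
  in the simple integrals and the right one in the simple processes.\<close>

lemma ito_isometry:
  assumes a: "a \<in> A - {Base 0}" and b: "b \<in> A - {Base 0}" and t: "0 \<le> t"
    and G: "G \<in> borel_measurable (F 0)" "\<And>\<omega>. \<omega> \<in> space M \<Longrightarrow> \<bar>G \<omega>\<bar> \<le> C"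
    and Y: "ito_integral M F (Z a) H t Y" and Y': "ito_integral M F (Z b) H' t Y'"
  shows "(\<integral>\<omega>. G \<omega> * Y \<omega> * Y' \<omega> \<partial>M) =
    \<kappa> a b * (\<integral>x. G (snd x) * H (fst x) (snd x) * H' (fst x) (snd x) \<partial>time_space t)"
proof -
  obtain k \<tau> \<xi> where \<xi>: "\<And>n. simple_integrand M F (k n) (\<tau> n) (\<xi> n)"
    "L2_tendsto (time_space t) (\<lambda>n x. simple_process (k n) (\<tau> n) (\<xi> n) (fst x) (snd x))
      (\<lambda>x. H (fst x) (snd x)) sequentially"
    "L2_tendsto M (\<lambda>n. simple_integral (Z a) (k n) (\<tau> n) (\<xi> n) t) Y sequentially"
    by (rule ito_integral_approx[OF Y order_refl ito_integral_measurable[OF Y]]) (rule that)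
  obtain k' \<tau>' \<eta> where \<eta>: "\<And>n. simple_integrand M F (k' n) (\<tau>' n) (\<eta> n)"
    "L2_tendsto (time_space t) (\<lambda>n x. simple_process (k' n) (\<tau>' n) (\<eta> n) (fst x) (snd x))
      (\<lambda>x. H' (fst x) (snd x)) sequentially"
    "L2_tendsto M (\<lambda>n. simple_integral (Z b) (k' n) (\<tau>' n) (\<eta> n) t) Y' sequentially"
    by (rule ito_integral_approx[OF Y' order_refl ito_integral_measurable[OF Y']]) (rule that)
  note GM = F_M[OF G(1)]
  have iso_n: "(\<integral>\<omega>. G \<omega> * simple_integral (Z a) (k n) (\<tau> n) (\<xi> n) t \<omega> *
        simple_integral (Z b) (k' n) (\<tau>' n) (\<eta> n) t \<omega> \<partial>M) =
      \<kappa> a b * (\<integral>x. G (snd x) * simple_process (k n) (\<tau> n) (\<xi> n) (fst x) (snd x) *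
        simple_process (k' n) (\<tau>' n) (\<eta> n) (fst x) (snd x) \<partial>time_space t)" for n
    by (rule simple_isometry[OF a b t G \<xi>(1) \<eta>(1)])
  have "(\<lambda>n. \<kappa> a b * (\<integral>x. G (snd x) * simple_process (k n) (\<tau> n) (\<xi> n) (fst x) (snd x) *
        simple_process (k' n) (\<tau>' n) (\<eta> n) (fst x) (snd x) \<partial>time_space t)) \<longlonglongrightarrow> (\<integral>\<omega>. G \<omega> * Y \<omega> * Y' \<omega> \<partial>M)"
    unfolding iso_n[symmetric]
    by (rule L2_tendsto_integral_mult3[OF \<xi>(3) \<eta>(3) GM G(2)])
  moreover have "(\<lambda>n. \<kappa> a b * (\<integral>x. G (snd x) * simple_process (k n) (\<tau> n) (\<xi> n) (fst x) (snd x) *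
        simple_process (k' n) (\<tau>' n) (\<eta> n) (fst x) (snd x) \<partial>time_space t)) \<longlonglongrightarrow>
     \<kappa> a b * (\<integral>x. G (snd x) * H (fst x) (snd x) * H' (fst x) (snd x) \<partial>time_space t)"
    by (intro tendsto_mult_left L2_tendsto_integral_mult3[OF \<xi>(2) \<eta>(2) bounded_time_space[OF GM G(2)]])
  ultimately show ?thesis by (rule LIMSEQ_unique)
qed

text \<open>The definition permits unrelated approximating sequences for the integrals at different
  times. Any two sequences that approximate \<open>H\<close> on \<open>(0, s]\<close> have, by the
  isometry, simple integrals at time \<open>s\<close> whose distance tends to zero, so every such
  sequence computes the given integral \<open>X\<close>.\<close>

lemma simple_integral_stop:
  assumes \<xi>: "\<And>n. simple_integrand M F (k n) (\<tau> n) (\<xi> n)" and a: "a \<in> A - {Base 0}" and "0 \<le> s"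
    and lim: "L2_tendsto (time_space s) (\<lambda>n x. simple_process (k n) (\<tau> n) (\<xi> n) (fst x) (snd x))
      (\<lambda>x. H (fst x) (snd x)) sequentially"
    and X: "ito_integral M F (Z a) H s X"
  shows "L2_tendsto M (\<lambda>n. simple_integral (Z a) (k n) (\<tau> n) (\<xi> n) s) X sequentially"
proof -
  obtain k' \<tau>' \<eta> where \<eta>: "\<And>n. simple_integrand M F (k' n) (\<tau>' n) (\<eta> n)"
    "L2_tendsto (time_space s) (\<lambda>n x. simple_process (k' n) (\<tau>' n) (\<eta> n) (fst x) (snd x))
      (\<lambda>x. H (fst x) (snd x)) sequentially"
    "L2_tendsto M (\<lambda>n. simple_integral (Z a) (k' n) (\<tau>' n) (\<eta> n) s) X sequentially"
    by (rule ito_integral_approx[OF X order_refl ito_integral_measurable[OF X]]) (rule that)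
  define f where "f n = simple_integral (Z a) (k n) (\<tau> n) (\<xi> n) s" for n
  define g where "g n = simple_integral (Z a) (k' n) (\<tau>' n) (\<eta> n) s" for n
  define h where "h = (\<integral>x. H (fst x) (snd x) * H (fst x) (snd x) \<partial>time_space s)"
  have L2: "L2 M (f n)" "L2 M (g n)" for n
    unfolding f_def g_def using L2_simple_integral[OF _ a \<open>0 \<le> s\<close>] \<xi> \<eta>(1) by auto
  \<comment> \<open>All three second moments have the same limit, so the expansion of the squared
    distance cancels in the limit.\<close>
  have 1: "(\<lambda>n. \<integral>\<omega>. f n \<omega> * f n \<omega> \<partial>M) \<longlonglongrightarrow> \<kappa> a a * h"
    "(\<lambda>n. \<integral>\<omega>. f n \<omega> * g n \<omega> \<partial>M) \<longlonglongrightarrow> \<kappa> a a * h"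
    "(\<lambda>n. \<integral>\<omega>. g n \<omega> * g n \<omega> \<partial>M) \<longlonglongrightarrow> \<kappa> a a * h"
    unfolding f_def g_def h_def
    using simple_isometry[OF a a \<open>0 \<le> s\<close>, of "\<lambda>_. 1" 1] \<xi> \<eta>(1)
    by (auto intro!: tendsto_mult_left L2_tendsto_integral_mult lim \<eta>(2))
  have eq: "L2_normsq M (\<lambda>\<omega>. f n \<omega> - g n \<omega>) = (\<integral>\<omega>. f n \<omega> * f n \<omega> \<partial>M) - 2 * (\<integral>\<omega>. f n \<omega> * g n \<omega> \<partial>M) +
      (\<integral>\<omega>. g n \<omega> * g n \<omega> \<partial>M)" for n
  proof -
    have "L2_normsq M (\<lambda>\<omega>. f n \<omega> - g n \<omega>) = (\<integral>\<omega>. f n \<omega> * f n \<omega> - 2 * (f n \<omega> * g n \<omega>) + g n \<omega> * g n \<omega> \<partial>M)"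
      by (simp add: L2_normsq_def power2_eq_square algebra_simps)
    also have "\<dots> = (\<integral>\<omega>. f n \<omega> * f n \<omega> \<partial>M) - 2 * (\<integral>\<omega>. f n \<omega> * g n \<omega> \<partial>M) + (\<integral>\<omega>. g n \<omega> * g n \<omega> \<partial>M)"
      using L2_mult_integrable[OF L2(1)[of n] L2(1)[of n]] L2_mult_integrable[OF L2(1)[of n] L2(2)[of n]]
        L2_mult_integrable[OF L2(2)[of n] L2(2)[of n]] by simp
    finally show ?thesis .
  qed
  have "(\<lambda>n. L2_normsq M (\<lambda>\<omega>. f n \<omega> - g n \<omega>)) \<longlonglongrightarrow> \<kappa> a a * h - 2 * (\<kappa> a a * h) + \<kappa> a a * h"
    unfolding eq by (intro tendsto_add tendsto_diff tendsto_mult_left 1)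
  then have "L2_tendsto M (\<lambda>n \<omega>. f n \<omega> - g n \<omega>) (\<lambda>_. 0) sequentially"
    using L2 by (auto simp: L2_tendsto_def intro!: L2_diff always_eventually)
  from L2_tendsto_add[OF this \<eta>(3)[folded g_def]] show ?thesis by (simp add: f_def)
qed

text \<open>Only the part of each increment after \<open>s\<close> distinguishes the two integrals,
  and it is orthogonal to \<open>K\<close> times its coefficient.\<close>

lemma simple_integral_martingale:
  assumes \<xi>: "simple_integrand M F k \<tau> \<xi>" and a: "a \<in> A - {Base 0}" and "0 \<le> s" "s \<le> t"
    and K: "K \<in> borel_measurable (F s)" "L2 M K"
  shows "(\<integral>\<omega>. K \<omega> * simple_integral (Z a) k \<tau> \<xi> t \<omega> \<partial>M) = (\<integral>\<omega>. K \<omega> * simple_integral (Z a) k \<tau> \<xi> s \<omega> \<partial>M)"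
proof -
  define f where "f r j \<omega> = \<xi> j \<omega> * (Z a (min (\<tau> (Suc j)) r) \<omega> - Z a (min (\<tau> j) r) \<omega>)" for r j \<omega>
  have t: "0 \<le> t" using assms by simp
  have L2: "L2 M (f r j)" if "j < k" "0 \<le> r" for r j
    unfolding f_def using L2_simple_integral_term[OF \<xi> that(1) a that(2)] .
  have eq: "(\<integral>\<omega>. K \<omega> * simple_integral (Z a) k \<tau> \<xi> r \<omega> \<partial>M) = (\<Sum>j<k. \<integral>\<omega>. K \<omega> * f r j \<omega> \<partial>M)" if "0 \<le> r" for r
    unfolding simple_integral_def f_def[symmetric] sum_distrib_left
    using L2_mult_integrable[OF K(2) L2] that by (intro Bochner_Integration.integral_sum) auto
  have "(\<integral>\<omega>. K \<omega> * f t j \<omega> \<partial>M) = (\<integral>\<omega>. K \<omega> * f s j \<omega> \<partial>M)" if "j < k" for j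
  proof -
    note c = simple_integrand_coeff[OF \<xi> that] simple_integrand_times[OF \<xi> less_imp_le[OF that]]
    obtain C where C: "\<And>\<omega>. \<omega> \<in> space M \<Longrightarrow> \<bar>\<xi> j \<omega>\<bar> \<le> C" using c by blast
    \<comment> \<open>The endpoints of the part of the \<open>j\<close>-th interval lying between
      \<open>s\<close> and \<open>t\<close>; it degenerates to \<open>p = q\<close> when the
      interval ends before \<open>s\<close> or starts after \<open>t\<close>.\<close>
    define p q where "p = max s (min (\<tau> j) t)" and "q = max s (min (\<tau> (Suc j)) t)"
    have diff: "f t j \<omega> - f s j \<omega> = \<xi> j \<omega> * (Z a q \<omega> - Z a p \<omega>)" for \<omega>
      using c(1) \<open>s \<le> t\<close> by (auto simp: f_def p_def q_def min_def max_def algebra_simps)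
    have "(\<integral>\<omega>. K \<omega> * f t j \<omega> \<partial>M) - (\<integral>\<omega>. K \<omega> * f s j \<omega> \<partial>M) = (\<integral>\<omega>. K \<omega> * f t j \<omega> - K \<omega> * f s j \<omega> \<partial>M)"
      using L2_mult_integrable[OF K(2) L2] that \<open>0 \<le> s\<close> t by simp
    also have "\<dots> = (\<integral>\<omega>. (\<xi> j \<omega> * K \<omega>) * (Z a q \<omega> - Z a p \<omega>) \<partial>M)"
      unfolding right_diff_distrib[symmetric] diff by (simp add: mult_ac)
    also have "\<dots> = 0"
    proof (cases "\<tau> j \<le> t")
      case True
      have "s \<le> p" "p \<le> q" "\<tau> j \<le> p" using True c(1) by (auto simp: p_def q_def)
      then show ?thesis
        using F_le[OF K(1), of p] F_le[OF c(2), of p] \<open>0 \<le> s\<close>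
        by (intro orth[OF a] L2_mult_bounded[OF K(2) F_M[OF c(2)] C]) auto
    next
      case False
      then show ?thesis using c(1) by (simp add: p_def q_def min_def)
    qed
    finally show ?thesis by simp
  qed
  then show ?thesis using eq \<open>0 \<le> s\<close> t by simp
qed

text \<open>The martingale property in weak form. The approximating sequence is the one belonging to
  time \<open>t\<close>; \<open>simple_integral_stop\<close> makes it usable at time
  \<open>s\<close>.\<close>

lemma ito_martingale:
  assumes a: "a \<in> A - {Base 0}" and "0 \<le> s" "s \<le> t"
    and Y: "ito_integral M F (Z a) H t Y" and X: "ito_integral M F (Z a) H s X"
    and K: "K \<in> borel_measurable (F s)" "L2 M K"
  shows "(\<integral>\<omega>. K \<omega> * Y \<omega> \<partial>M) = (\<integral>\<omega>. K \<omega> * X \<omega> \<partial>M)"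
proof -
  obtain k \<tau> \<xi> where \<xi>: "\<And>n. simple_integrand M F (k n) (\<tau> n) (\<xi> n)"
    "L2_tendsto (time_space s) (\<lambda>n x. simple_process (k n) (\<tau> n) (\<xi> n) (fst x) (snd x))
      (\<lambda>x. H (fst x) (snd x)) sequentially"
    "L2_tendsto M (\<lambda>n. simple_integral (Z a) (k n) (\<tau> n) (\<xi> n) t) Y sequentially"
    by (rule ito_integral_approx[OF Y \<open>s \<le> t\<close> ito_integral_measurable[OF X]]) (rule that)
  note lim = L2_tendsto_integral_mult[OF L2_tendsto_const[OF K(2)]]
  have "(\<lambda>n. \<integral>\<omega>. K \<omega> * simple_integral (Z a) (k n) (\<tau> n) (\<xi> n) s \<omega> \<partial>M) \<longlonglongrightarrow> (\<integral>\<omega>. K \<omega> * Y \<omega> \<partial>M)"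
    using lim[OF \<xi>(3)] simple_integral_martingale[OF \<xi>(1) a assms(2,3) K] by simp
  then show ?thesis
    using lim[OF simple_integral_stop[OF \<xi>(1) a assms(2) \<xi>(2) X]] by (rule LIMSEQ_unique)
qed

lemma ito_integral_0:
  assumes "ito_integral M F X H 0 Y"
  shows "AE \<omega> in M. Y \<omega> = 0"
proof -
  obtain k \<tau> \<xi> where \<xi>: "\<And>n. simple_integrand M F (k n) (\<tau> n) (\<xi> n)"
    "L2_tendsto (time_space 0) (\<lambda>n x. simple_process (k n) (\<tau> n) (\<xi> n) (fst x) (snd x))
      (\<lambda>x. H (fst x) (snd x)) sequentially"
    "L2_tendsto M (\<lambda>n. simple_integral X (k n) (\<tau> n) (\<xi> n) 0) Y sequentially"
    by (rule ito_integral_approx[OF assms order_refl ito_integral_measurable[OF assms]]) (rule that)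
  have "0 \<le> \<tau> n j" if "j \<le> k n" for n j by (rule simple_integrand_times[OF \<xi>(1) that])
  then have "simple_integral X (k n) (\<tau> n) (\<xi> n) 0 = (\<lambda>_. 0)" for n
    by (auto simp: simple_integral_def fun_eq_iff min_absorb2 intro!: sum.neutral)
  with \<xi>(3) have "L2_tendsto M (\<lambda>n _. 0) Y sequentially" by simp
  from L2_tendsto_unique[OF this L2_tendsto_const[OF L2_zero]] show ?thesis by simp
qed

lemma L2_time_space:
  assumes K: "L2 M (K :: 'a \<Rightarrow> real)"
  shows "L2 (time_space t) (\<lambda>x. K (snd x))"
proof -
  interpret pair_sigma_finite "time_measure t" M by (rule pair_time)
  interpret T: finite_measure "time_measure t" by (rule finite_measure_time)
  have "(\<lambda>x. K (snd x)) \<in> borel_measurable (time_space t)" using L2_measurable[OF K] by measurable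
  then show ?thesis
    using integrable_mult_fst_snd(1)[OF _ L2_integrable[OF K], of "\<lambda>_. 1"] by (simp add: L2_def)
qed

text \<open>An integral against time is known here only as a mean-square limit. Its identification
  with a Lebesgue integral is required only after multiplication by a square integrable
  \<open>K\<close> and taking expectations, and this weak form passes to the limit without a
  pathwise argument.\<close>

lemma ito_time:
  assumes t: "0 \<le> t" and Y: "ito_integral M F (Z (Base 0)) H t Y" and K: "L2 M K"
  shows "(\<integral>\<omega>. K \<omega> * Y \<omega> \<partial>M) = (\<integral>x. K (snd x) * H (fst x) (snd x) \<partial>time_space t)"
proof -
  interpret pair_sigma_finite "time_measure t" M by (rule pair_time)
  interpret N: finite_measure "time_space t" by (rule finite_time_space)
  obtain k \<tau> \<xi> where \<xi>: "\<And>n. simple_integrand M F (k n) (\<tau> n) (\<xi> n)"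
    "L2_tendsto (time_space t) (\<lambda>n x. simple_process (k n) (\<tau> n) (\<xi> n) (fst x) (snd x))
      (\<lambda>x. H (fst x) (snd x)) sequentially"
    "L2_tendsto M (\<lambda>n. simple_integral (Z (Base 0)) (k n) (\<tau> n) (\<xi> n) t) Y sequentially"
    by (rule ito_integral_approx[OF Y order_refl ito_integral_measurable[OF Y]]) (rule that)
  have eq: "(\<integral>\<omega>. K \<omega> * simple_integral (Z (Base 0)) (k n) (\<tau> n) (\<xi> n) t \<omega> \<partial>M) =
      (\<integral>x. K (snd x) * simple_process (k n) (\<tau> n) (\<xi> n) (fst x) (snd x) \<partial>time_space t)" for n
  proof -
    define len where "len j = min (\<tau> n (Suc j)) t - min (\<tau> n j) t" for j
    have int: "integrable M (\<lambda>\<omega>. K \<omega> * \<xi> n j \<omega>)" if "j < k n" for j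
    proof -
      note c = simple_integrand_coeff[OF \<xi>(1) that]
      obtain C where C: "\<And>\<omega>. \<omega> \<in> space M \<Longrightarrow> \<bar>\<xi> n j \<omega>\<bar> \<le> C" using c by blast
      show ?thesis by (intro L2_mult_integrable K L2_bounded[OF F_M[OF c(2)] C])
    qed
    have term_eq: "(\<integral>x. K (snd x) * (\<xi> n j (snd x) * indicator {\<tau> n j<..\<tau> n (Suc j)} (fst x)) \<partial>time_space t) =
        len j * (\<integral>\<omega>. K \<omega> * \<xi> n j \<omega> \<partial>M)" if "j < k n" for j
    proof -
      note c = simple_integrand_coeff(1)[OF \<xi>(1) that] simple_integrand_times[OF \<xi>(1), of j n] that
      \<comment> \<open>The indicator is written as its own square to match the product of two
        indicators in \<open>time_measure_integral_indicator\<close>.\<close>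
      have "(\<integral>x. K (snd x) * (\<xi> n j (snd x) * indicator {\<tau> n j<..\<tau> n (Suc j)} (fst x)) \<partial>time_space t) =
         (\<integral>x. (indicator {\<tau> n j<..\<tau> n (Suc j)} (fst x) * indicator {\<tau> n j<..\<tau> n (Suc j)} (fst x)) *
            (K (snd x) * \<xi> n j (snd x)) \<partial>time_space t)"
        by (intro Bochner_Integration.integral_cong) (auto simp: indicator_def)
      also have "\<dots> = max 0 (min (\<tau> n (Suc j)) t - \<tau> n j) * (\<integral>\<omega>. K \<omega> * \<xi> n j \<omega> \<partial>M)"
        using c by (subst integrable_mult_fst_snd(2)[OF _ int[OF that]])
          (auto simp: time_measure_integral_indicator)
      also have "max 0 (min (\<tau> n (Suc j)) t - \<tau> n j) = len j"
        using c by (auto simp: len_def min_def max_def)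
      finally show ?thesis .
    qed
    have "(\<integral>\<omega>. K \<omega> * simple_integral (Z (Base 0)) (k n) (\<tau> n) (\<xi> n) t \<omega> \<partial>M) =
        (\<integral>\<omega>. (\<Sum>j<k n. len j * (K \<omega> * \<xi> n j \<omega>)) \<partial>M)"
      by (simp add: simple_integral_def time_letter len_def sum_distrib_left mult_ac)
    also have "\<dots> = (\<Sum>j<k n. len j * (\<integral>\<omega>. K \<omega> * \<xi> n j \<omega> \<partial>M))"
      using int by (subst Bochner_Integration.integral_sum) auto
    also have "\<dots> = (\<Sum>j<k n. \<integral>x. K (snd x) * (\<xi> n j (snd x) * indicator {\<tau> n j<..\<tau> n (Suc j)} (fst x)) \<partial>time_space t)"
      by (simp add: term_eq)
    also have "\<dots> = (\<integral>x. K (snd x) * simple_process (k n) (\<tau> n) (\<xi> n) (fst x) (snd x) \<partial>time_space t)"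
      unfolding simple_process_def sum_distrib_left
      by (intro Bochner_Integration.integral_sum[symmetric] L2_mult_integrable
          L2_time_space[OF K] L2_simple_process_term[OF \<xi>(1)]) auto
    finally show ?thesis .
  qed
  show ?thesis
    using L2_tendsto_integral_mult[OF L2_tendsto_const[OF K] \<xi>(3), unfolded eq]
      L2_tendsto_integral_mult[OF L2_tendsto_const[OF L2_time_space[OF K]] \<xi>(2)]
    by (rule LIMSEQ_unique)
qed

end

section \<open>Mixed moments of iterated integrals\<close>

text \<open>To an upward jump at \<open>s\<close> attach a rational level \<open>q\<close> between
  the left limit and the value, and a rational \<open>r < s\<close> such that \<open>f\<close> stays
  below \<open>q\<close> on \<open>(r, s)\<close>. The pair determines \<open>s\<close>: a second
  such point \<open>s' > s\<close> would force \<open>f s < q\<close>.\<close>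

lemma countable_left_jumps_up:
  fixes f g :: "real \<Rightarrow> real"
  assumes "\<And>s. s \<in> S \<Longrightarrow> (f \<longlongrightarrow> g s) (at_left s)"
  shows "countable {s \<in> S. g s < f s}"
proof -
  have "\<exists>q\<in>\<rat>. \<exists>r\<in>\<rat>. g s < q \<and> q < f s \<and> r < s \<and> (\<forall>x. r < x \<and> x < s \<longrightarrow> f x < q)"
    if "s \<in> S" "g s < f s" for s
  proof -
    obtain q where q: "q \<in> \<rat>" "g s < q" "q < f s" using Rats_dense_in_real[OF \<open>g s < f s\<close>] by blast
    have "\<forall>\<^sub>F x in at_left s. f x < q" using assms[OF \<open>s \<in> S\<close>] q(2) by (rule order_tendstoD)
    then obtain b where b: "b < s" "\<And>x. b < x \<Longrightarrow> x < s \<Longrightarrow> f x < q"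
      using eventually_at_left[of "s - 1" s] by auto
    obtain r where "r \<in> \<rat>" "b < r" "r < s" using Rats_dense_in_real[OF b(1)] by blast
    with q b show ?thesis by (meson order_less_trans)
  qed
  then obtain q r where qr: "\<And>s. s \<in> S \<Longrightarrow> g s < f s \<Longrightarrow> q s \<in> \<rat> \<and> r s \<in> \<rat> \<and> q s < f s \<and> r s < s \<and>
      (\<forall>x. r s < x \<and> x < s \<longrightarrow> f x < q s)"
    by metis
  have "inj_on (\<lambda>s. (q s, r s)) {s \<in> S. g s < f s}"
  proof (rule inj_onI)
    fix s s' assume "s \<in> {s \<in> S. g s < f s}" "s' \<in> {s \<in> S. g s < f s}" "(q s, r s) = (q s', r s')"
    then show "s = s'"
      using qr[of s] qr[of s'] by (metis (mono_tags, lifting) linorder_neqE_linordered_idom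
          mem_Collect_eq order_less_asym prod.inject)
  qed
  moreover have "countable ((\<lambda>s. (q s, r s)) ` {s \<in> S. g s < f s})"
    by (rule countable_subset[of _ "\<rat> \<times> \<rat>"]) (use qr in \<open>auto intro: countable_rat\<close>)
  ultimately show ?thesis by (metis countable_image_inj_on)
qed

lemma countable_left_jumps:
  fixes f g :: "real \<Rightarrow> real"
  assumes "\<And>s. s \<in> S \<Longrightarrow> (f \<longlongrightarrow> g s) (at_left s)"
  shows "countable {s \<in> S. g s \<noteq> f s}"
proof -
  have "countable {s \<in> S. - g s < - f s}"
    by (rule countable_left_jumps_up) (intro tendsto_minus assms)
  moreover have "{s \<in> S. g s \<noteq> f s} = {s \<in> S. g s < f s} \<union> {s \<in> S. - g s < - f s}" by auto
  ultimately show ?thesis using countable_left_jumps_up[OF assms] by simp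
qed

text \<open>Approximation from the right by grid points: for each mesh only countably many times
  occur, so the discretised process is jointly measurable, and right continuity gives pointwise
  convergence.\<close>

lemma right_continuous_joint_measurable:
  fixes X :: "real \<Rightarrow> 'a \<Rightarrow> real"
  assumes X: "\<And>s. 0 \<le> s \<Longrightarrow> X s \<in> borel_measurable M"
    and cont: "\<And>\<omega> s. \<omega> \<in> space M \<Longrightarrow> 0 \<le> s \<Longrightarrow> continuous (at_right s) (\<lambda>s. X s \<omega>)"
  shows "(\<lambda>x. X (fst x) (snd x)) \<in> borel_measurable (time_measure t \<Otimes>\<^sub>M M)"
proof (rule borel_measurable_LIMSEQ_real)
  \<comment> \<open>Adding 1 places the grid point strictly to the right of \<open>s\<close>, at
    distance at most \<open>1 / (n + 1)\<close>; the maximum keeps it in the range where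
    \<open>X\<close> is known to be measurable.\<close>
  define q where "q n i = max 0 ((real_of_int i + 1) / (real n + 1))" for n i
  define g where "g n s = \<lfloor>s * (real n + 1)\<rfloor>" for n and s :: real
  show "(\<lambda>x. X (q n (g n (fst x))) (snd x)) \<in> borel_measurable (time_measure t \<Otimes>\<^sub>M M)" for n
  proof (rule measurable_compose_countable[where f = "\<lambda>i x. X (q n i) (snd x)"])
    show "(\<lambda>x. X (q n i) (snd x)) \<in> borel_measurable (time_measure t \<Otimes>\<^sub>M M)" for i
      using X[of "q n i"] by (simp add: q_def)
    show "(\<lambda>x. g n (fst x)) \<in> time_measure t \<Otimes>\<^sub>M M \<rightarrow>\<^sub>M count_space UNIV"
      unfolding g_def by measurable
  qed
  fix x assume x: "x \<in> space (time_measure t \<Otimes>\<^sub>M M)"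
  define s \<omega> where "s = fst x" and "\<omega> = snd x"
  have s: "0 < s" "\<omega> \<in> space M" using x by (auto simp: s_def \<omega>_def space_pair_measure)
  have q: "s < q n (g n s)" "q n (g n s) \<le> s + 1 / (real n + 1)" for n
  proof -
    have "s * (real n + 1) < of_int (g n s) + 1" "of_int (g n s) \<le> s * (real n + 1)"
      by (simp_all add: g_def)
    moreover have "0 \<le> g n s" using s by (simp add: g_def)
    ultimately have *: "s * (real n + 1) < of_int (g n s) + 1" "of_int (g n s) + 1 \<le> s * (real n + 1) + 1"
      "q n (g n s) = (of_int (g n s) + 1) / (real n + 1)"
      by (simp_all add: q_def)
    show "s < q n (g n s)" using *(1) by (simp add: *(3) pos_less_divide_eq)
    have "q n (g n s) \<le> (s * (real n + 1) + 1) / (real n + 1)"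
      using *(2) unfolding *(3) by (rule divide_right_mono) simp
    also have "\<dots> = s + 1 / (real n + 1)" by (simp add: add_divide_distrib)
    finally show "q n (g n s) \<le> s + 1 / (real n + 1)" .
  qed
  have "(\<lambda>n. q n (g n s)) \<longlonglongrightarrow> s"
  proof (rule tendsto_sandwich[of "\<lambda>_. s" _ _ "\<lambda>n. s + 1 / (real n + 1)"])
    show "(\<lambda>n. s + 1 / (real n + 1)) \<longlonglongrightarrow> s"
      using tendsto_add[OF tendsto_const LIMSEQ_inverse_real_of_nat, of s]
      by (simp add: inverse_eq_divide add.commute)
    show "(\<lambda>n. s) \<longlonglongrightarrow> s" by simp
  qed (use q in \<open>auto intro!: always_eventually simp: less_imp_le\<close>)
  then have "filterlim (\<lambda>n. q n (g n s)) (at_right s) sequentially"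
    using q(1) by (auto simp: filterlim_at less_imp_neq[THEN not_sym])
  moreover have "((\<lambda>s. X s \<omega>) \<longlongrightarrow> X s \<omega>) (at_right s)"
    using cont[of \<omega> s] s by (simp add: continuous_within)
  ultimately show "(\<lambda>n. X (q n (g n (fst x))) (snd x)) \<longlonglongrightarrow> X (fst x) (snd x)"
    unfolding s_def[symmetric] \<omega>_def[symmetric] by (rule filterlim_compose[rotated])
qed

lemma AE_time_measure_not_in_countable:
  assumes "countable D"
  shows "AE s in time_measure t. s \<notin> D"
proof -
  have "AE s in lborel. s \<notin> D" by (rule AE_not_in[OF countable_imp_null_set_lborel[OF assms]])
  then show ?thesis by (subst AE_restrict_space_iff) auto
qed

lemma integral_time_measure_restrict:
  fixes f :: "real \<Rightarrow> real"
  assumes "0 < s" "s \<le> t"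
  shows "(\<integral>r. indicator {..s} r * f r \<partial>time_measure t) = (\<integral>r. f r \<partial>time_measure s)"
proof -
  have "(\<integral>r. indicator {..s} r * f r \<partial>time_measure t) = (\<integral>r. indicator {0<..t} r *\<^sub>R (indicator {..s} r * f r) \<partial>lborel)"
    by (rule integral_restrict_space) simp
  also have "\<dots> = (\<integral>r. indicator {0<..s} r *\<^sub>R f r \<partial>lborel)"
    using assms by (intro Bochner_Integration.integral_cong) (auto simp: indicator_def)
  also have "\<dots> = (\<integral>r. f r \<partial>time_measure s)"
    by (rule integral_restrict_space[symmetric]) simp
  finally show ?thesis .
qed

text \<open>The square is the union of two triangles that overlap only in the diagonal. This is
  integration by parts for a product of two time integrals.\<close>

lemma integral_square_split:
  fixes K :: "real \<Rightarrow> real \<Rightarrow> real"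
  assumes K: "integrable (time_measure t \<Otimes>\<^sub>M time_measure t) (\<lambda>x. K (fst x) (snd x))"
  shows "(\<integral>s. \<integral>r. K s r \<partial>time_measure t \<partial>time_measure t) =
    (\<integral>s. \<integral>r. K s r \<partial>time_measure s \<partial>time_measure t) +
    (\<integral>r. \<integral>s. K s r \<partial>time_measure r \<partial>time_measure t)"
proof -
  interpret T: finite_measure "time_measure t" by (rule finite_measure_time)
  interpret pair_sigma_finite "time_measure t" "time_measure t" ..
  let ?T = "time_measure t"
  have [measurable]: "snd \<in> borel_measurable (?T \<Otimes>\<^sub>M ?T)"
  proof -
    have "(\<lambda>x. x) \<in> borel_measurable ?T" by (rule measurable_restrict_space1) simp
    then show ?thesis using measurable_compose[OF measurable_snd] by fastforce
  qed
  have Km [measurable]: "(\<lambda>x. K (fst x) (snd x)) \<in> borel_measurable (?T \<Otimes>\<^sub>M ?T)" using K by simp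
  define f where "f s r = indicator {..s} r * K s r" for s r
  define g where "g s r = indicator {..r} s * K s r" for s r
  have f: "integrable (?T \<Otimes>\<^sub>M ?T) (\<lambda>x. f (fst x) (snd x))"
  proof (rule Bochner_Integration.integrable_bound[OF K])
    have "(\<lambda>x. f (fst x) (snd x)) = (\<lambda>x. if snd x \<le> fst x then K (fst x) (snd x) else 0)"
      by (auto simp: f_def fun_eq_iff)
    then show "(\<lambda>x. f (fst x) (snd x)) \<in> borel_measurable (?T \<Otimes>\<^sub>M ?T)" by simp
  qed (auto simp: f_def indicator_def)
  have g: "integrable (?T \<Otimes>\<^sub>M ?T) (\<lambda>x. g (fst x) (snd x))"
  proof (rule Bochner_Integration.integrable_bound[OF K])
    have "(\<lambda>x. g (fst x) (snd x)) = (\<lambda>x. if fst x \<le> snd x then K (fst x) (snd x) else 0)"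
      by (auto simp: g_def fun_eq_iff)
    then show "(\<lambda>x. g (fst x) (snd x)) \<in> borel_measurable (?T \<Otimes>\<^sub>M ?T)" by simp
  qed (auto simp: g_def indicator_def)
  \<comment> \<open>On the diagonal both indicators are one and \<open>K = f + g\<close> fails,
    hence the identity is needed only almost everywhere.\<close>
  have "AE x in ?T \<Otimes>\<^sub>M ?T. fst x \<noteq> snd x"
  proof (rule AE_pair_measure)
    show "{x \<in> space (?T \<Otimes>\<^sub>M ?T). fst x \<noteq> snd x} \<in> sets (?T \<Otimes>\<^sub>M ?T)" by measurable
    show "AE x in ?T. AE y in ?T. fst (x, y) \<noteq> snd (x, y)"
    proof (rule AE_I2)
      fix x
      show "AE y in ?T. fst (x, y) \<noteq> snd (x, y)"
        using AE_time_measure_not_in_countable[of "{x}" t] by auto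
    qed
  qed
  then have "AE x in ?T \<Otimes>\<^sub>M ?T. K (fst x) (snd x) = f (fst x) (snd x) + g (fst x) (snd x)"
    by eventually_elim (auto simp: f_def g_def indicator_def)
  then have "(\<integral>x. K (fst x) (snd x) \<partial>(?T \<Otimes>\<^sub>M ?T)) = (\<integral>x. f (fst x) (snd x) + g (fst x) (snd x) \<partial>(?T \<Otimes>\<^sub>M ?T))"
    using f g by (intro integral_cong_AE) auto
  also have "\<dots> = (\<integral>x. f (fst x) (snd x) \<partial>(?T \<Otimes>\<^sub>M ?T)) + (\<integral>x. g (fst x) (snd x) \<partial>(?T \<Otimes>\<^sub>M ?T))"
    using f g by simp
  also have "(\<integral>x. f (fst x) (snd x) \<partial>(?T \<Otimes>\<^sub>M ?T)) = (\<integral>s. \<integral>r. f s r \<partial>?T \<partial>?T)"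
    using integral_fst'[OF f] by simp
  also have "\<dots> = (\<integral>s. \<integral>r. K s r \<partial>time_measure s \<partial>?T)"
    unfolding f_def by (intro Bochner_Integration.integral_cong refl integral_time_measure_restrict) auto
  also have "(\<integral>x. g (fst x) (snd x) \<partial>(?T \<Otimes>\<^sub>M ?T)) = (\<integral>r. \<integral>s. g s r \<partial>?T \<partial>?T)"
    using integral_snd[of g] g by (simp add: case_prod_beta')
  also have "\<dots> = (\<integral>r. \<integral>s. K s r \<partial>time_measure r \<partial>?T)"
    unfolding g_def by (intro Bochner_Integration.integral_cong refl integral_time_measure_restrict) auto
  also have "(\<integral>x. K (fst x) (snd x) \<partial>(?T \<Otimes>\<^sub>M ?T)) = (\<integral>s. \<integral>r. K s r \<partial>?T \<partial>?T)"
    using integral_fst'[OF K] by simp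
  finally show ?thesis .
qed

section \<open>Iterated integrals and their weighted second moments\<close>

locale ito_words = ito_noise M F A Z \<kappa>
  for M :: "'a measure" and F A Z \<kappa> +
  fixes I :: "letter list \<Rightarrow> real \<Rightarrow> 'a \<Rightarrow> real"
  assumes iterated: "iterated_integrals M F A Z I"
begin

lemma I_Nil [simp]: "I [] t \<omega> = 1"
  using iterated by (simp add: iterated_integrals_def)

lemma I_integral:
  "w \<in> lists A \<Longrightarrow> a \<in> A \<Longrightarrow> 0 \<le> t \<Longrightarrow> ito_integral M F (Z a) (left_limit (I w)) t (I (w @ [a]) t)"
  using iterated by (simp add: iterated_integrals_def)

lemma I_cadlag_adapted:
  assumes "w \<in> lists A"
  shows "cadlag_adapted M F (I w)"
proof (cases w rule: rev_cases)
  case Nil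
  have "I [] = (\<lambda>_ _. 1)" by (intro ext) simp
  with Nil show ?thesis by (auto simp: cadlag_adapted_def cadlag_def)
next
  case (snoc v a)
  then show ?thesis using iterated assms by (auto simp: iterated_integrals_def)
qed

lemma I_adapted: "w \<in> lists A \<Longrightarrow> 0 \<le> t \<Longrightarrow> I w t \<in> borel_measurable (F t)"
  using I_cadlag_adapted by (simp add: cadlag_adapted_def)

lemma L2_I:
  assumes "w \<in> lists A" "0 \<le> t"
  shows "L2 M (I w t)"
proof (cases w rule: rev_cases)
  case Nil
  then have "I w t = (\<lambda>_. 1)" by auto
  then show ?thesis using L2_const[of 1] by simp
next
  case (snoc v a)
  then show ?thesis
    using I_integral[of v a t] assms by (auto simp: ito_integral_def L2_tendsto_def)
qed

lemma I_joint_measurable: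
  assumes "w \<in> lists A"
  shows "(\<lambda>x. I w (fst x) (snd x)) \<in> borel_measurable (time_space t)"
  using I_cadlag_adapted[OF assms] F_M[OF I_adapted[OF assms]]
  by (intro right_continuous_joint_measurable) (auto simp: cadlag_adapted_def cadlag_def)

text \<open>For each path the two sides differ at countably many times only, and Fubini turns this
  into a statement on the product space. The letter \<open>a\<close> enters because measurability of
  the left limit comes from its being integrated against \<open>Z a\<close>.\<close>

lemma AE_left_limit_eq:
  assumes "w \<in> lists A" "a \<in> A" "0 \<le> t"
  shows "AE x in time_space t. left_limit (I w) (fst x) (snd x) = I w (fst x) (snd x)"
proof -
  interpret pair_sigma_finite "time_measure t" M by (rule pair_time)
  note [measurable] = I_joint_measurable[OF assms(1), of t] ito_integral_measurable[OF I_integral[OF assms]]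
  have meas: "{x \<in> space (time_space t). left_limit (I w) (fst x) (snd x) = I w (fst x) (snd x)} \<in> sets (time_space t)"
    by measurable
  have "AE s in time_measure t. left_limit (I w) s \<omega> = I w s \<omega>" if "\<omega> \<in> space M" for \<omega>
  proof -
    have "((\<lambda>s. I w s \<omega>) \<longlongrightarrow> left_limit (I w) s \<omega>) (at_left s)" if "s \<in> {0<..t}" for s
    proof -
      have "\<exists>x. ((\<lambda>s. I w s \<omega>) \<longlongrightarrow> x) (at_left s)"
        using I_cadlag_adapted[OF assms(1)] that \<open>\<omega> \<in> space M\<close> by (simp add: cadlag_adapted_def cadlag_def)
      then obtain x where x: "((\<lambda>s. I w s \<omega>) \<longlongrightarrow> x) (at_left s)" ..
      moreover have "left_limit (I w) s \<omega> = x"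
        unfolding left_limit_def by (rule tendsto_Lim[OF _ x]) simp
      ultimately show ?thesis by simp
    qed
    then have "countable {s \<in> {0<..t}. left_limit (I w) s \<omega> \<noteq> I w s \<omega>}" by (rule countable_left_jumps)
    from AE_time_measure_not_in_countable[OF this, where t = t] AE_space[of "time_measure t"]
    show ?thesis by eventually_elim simp
  qed
  then have "AE \<omega> in M. AE s in time_measure t. left_limit (I w) s \<omega> = I w s \<omega>" by (rule AE_I2)
  then have "AE s in time_measure t. AE \<omega> in M. left_limit (I w) s \<omega> = I w s \<omega>"
    using AE_commute[of "\<lambda>s \<omega>. left_limit (I w) s \<omega> = I w s \<omega>"] meas by simp
  then show ?thesis by (intro AE_pair_measure[OF meas]) simp
qed

lemma L2_I_time:
  assumes "w \<in> lists A" "a \<in> A" "0 \<le> t"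
  shows "L2 (time_space t) (\<lambda>x. I w (fst x) (snd x))"
  using L2_integrand[OF I_integral[OF assms]] AE_left_limit_eq[OF assms] I_joint_measurable[OF assms(1)]
  by (rule L2_cong_AE)

lemma I_isometry:
  assumes u: "u \<in> lists A" and v: "v \<in> lists A"
    and a: "a \<in> A - {Base 0}" and b: "b \<in> A - {Base 0}" and t: "0 \<le> t"
    and G: "G \<in> borel_measurable (F 0)" "\<And>\<omega>. \<omega> \<in> space M \<Longrightarrow> \<bar>G \<omega>\<bar> \<le> C"
  shows "(\<integral>\<omega>. G \<omega> * I (u @ [a]) t \<omega> * I (v @ [b]) t \<omega> \<partial>M) =
    \<kappa> a b * (\<integral>s. \<integral>\<omega>. G \<omega> * I u s \<omega> * I v s \<omega> \<partial>M \<partial>time_measure t)"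
proof -
  interpret pair_sigma_finite "time_measure t" M by (rule pair_time)
  have ab: "a \<in> A" "b \<in> A" using a b by auto
  note GM = bounded_time_space[OF F_M[OF G(1)] G(2)]
  note [measurable] = GM(1)[of t] I_joint_measurable[OF u, of t] I_joint_measurable[OF v, of t]
    ito_integral_measurable[OF I_integral[OF u ab(1) t]] ito_integral_measurable[OF I_integral[OF v ab(2) t]]
  have int: "integrable (time_space t) (\<lambda>x. G (snd x) * I u (fst x) (snd x) * I v (fst x) (snd x))"
    by (intro L2_mult_integrable L2_mult_bounded[OF L2_I_time[OF u ab(1) t] GM] L2_I_time[OF v ab(2) t])
  have "(\<integral>\<omega>. G \<omega> * I (u @ [a]) t \<omega> * I (v @ [b]) t \<omega> \<partial>M) = \<kappa> a b *
      (\<integral>x. G (snd x) * left_limit (I u) (fst x) (snd x) * left_limit (I v) (fst x) (snd x) \<partial>time_space t)"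
    by (rule ito_isometry[OF a b t G I_integral[OF u ab(1) t] I_integral[OF v ab(2) t]])
  also have "(\<integral>x. G (snd x) * left_limit (I u) (fst x) (snd x) * left_limit (I v) (fst x) (snd x) \<partial>time_space t) =
      (\<integral>x. G (snd x) * I u (fst x) (snd x) * I v (fst x) (snd x) \<partial>time_space t)"
  proof (rule integral_cong_AE)
    show "AE x in time_space t. G (snd x) * left_limit (I u) (fst x) (snd x) * left_limit (I v) (fst x) (snd x) =
        G (snd x) * I u (fst x) (snd x) * I v (fst x) (snd x)"
      using AE_left_limit_eq[OF u ab(1) t] AE_left_limit_eq[OF v ab(2) t] by eventually_elim simp
  qed measurable
  also have "\<dots> = (\<integral>s. \<integral>\<omega>. G \<omega> * I u s \<omega> * I v s \<omega> \<partial>M \<partial>time_measure t)"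
    using integral_fst'[OF int] by simp
  finally show ?thesis .
qed

lemma I_time:
  assumes u: "u \<in> lists A" and time_in: "Base 0 \<in> A" and t: "0 \<le> t" and K: "L2 M K"
  shows "(\<integral>\<omega>. K \<omega> * I (u @ [Base 0]) t \<omega> \<partial>M) = (\<integral>s. \<integral>\<omega>. K \<omega> * I u s \<omega> \<partial>M \<partial>time_measure t)"
proof -
  interpret pair_sigma_finite "time_measure t" M by (rule pair_time)
  note [measurable] = I_joint_measurable[OF u, of t] L2_measurable[OF L2_time_space[OF K], of t]
    ito_integral_measurable[OF I_integral[OF u time_in t]]
  have int: "integrable (time_space t) (\<lambda>x. K (snd x) * I u (fst x) (snd x))"
    by (intro L2_mult_integrable L2_time_space[OF K] L2_I_time[OF u time_in t])
  have "(\<integral>\<omega>. K \<omega> * I (u @ [Base 0]) t \<omega> \<partial>M) =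
      (\<integral>x. K (snd x) * left_limit (I u) (fst x) (snd x) \<partial>time_space t)"
    by (rule ito_time[OF t I_integral[OF u time_in t] K])
  also have "\<dots> = (\<integral>x. K (snd x) * I u (fst x) (snd x) \<partial>time_space t)"
  proof (rule integral_cong_AE)
    show "AE x in time_space t. K (snd x) * left_limit (I u) (fst x) (snd x) = K (snd x) * I u (fst x) (snd x)"
      using AE_left_limit_eq[OF u time_in t] by eventually_elim simp
  qed measurable
  also have "\<dots> = (\<integral>s. \<integral>\<omega>. K \<omega> * I u s \<omega> \<partial>M \<partial>time_measure t)"
    using integral_fst'[OF int] by simp
  finally show ?thesis .
qed

text \<open>A word whose last letter is noise is an integral against a martingale, and the empty
  word gives a constant.\<close>

lemma I_martingale:
  assumes v: "v \<in> lists A" "v = [] \<or> last v \<noteq> Base 0" and st: "0 \<le> s" "s \<le> t"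
    and K: "K \<in> borel_measurable (F s)" "L2 M K"
  shows "(\<integral>\<omega>. K \<omega> * I v t \<omega> \<partial>M) = (\<integral>\<omega>. K \<omega> * I v s \<omega> \<partial>M)"
proof (cases v rule: rev_cases)
  case (snoc w a)
  then have "w \<in> lists A" "a \<in> A - {Base 0}" using v by auto
  then show ?thesis
    unfolding snoc using st by (intro ito_martingale[OF _ st I_integral I_integral K]) auto
qed simp

lemma I_0:
  assumes "w \<in> lists A" "a \<in> A"
  shows "AE \<omega> in M. I (w @ [a]) 0 \<omega> = 0"
  by (rule ito_integral_0[OF I_integral[OF assms]]) simp

text \<open>Both words ending in the time letter: split the square of integration times along the diagonal.\<close>

lemma I_time_time:
  assumes u: "u \<in> lists A" and v: "v \<in> lists A" and time_in: "Base 0 \<in> A" and t: "0 \<le> t"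
    and G: "G \<in> borel_measurable (F 0)" "\<And>\<omega>. \<omega> \<in> space M \<Longrightarrow> \<bar>G \<omega>\<bar> \<le> C"
  shows "(\<integral>\<omega>. G \<omega> * I (u @ [Base 0]) t \<omega> * I (v @ [Base 0]) t \<omega> \<partial>M) =
    (\<integral>s. \<integral>\<omega>. G \<omega> * I u s \<omega> * I (v @ [Base 0]) s \<omega> \<partial>M \<partial>time_measure t) +
    (\<integral>s. \<integral>\<omega>. G \<omega> * I (u @ [Base 0]) s \<omega> * I v s \<omega> \<partial>M \<partial>time_measure t)"
proof -
  let ?T = "time_measure t"
  interpret P: pair_sigma_finite ?T M by (rule pair_time)
  interpret T: finite_measure ?T by (rule finite_measure_time)
  interpret TT: pair_sigma_finite ?T ?T ..
  note GM = F_M[OF G(1)]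
  have u0: "u @ [Base 0] \<in> lists A" and v0: "v @ [Base 0] \<in> lists A" using u v time_in by auto
  define K where "K s r = (\<integral>\<omega>. G \<omega> * I u s \<omega> * I v r \<omega> \<partial>M)" for s r
  have GI: "L2 M (\<lambda>\<omega>. G \<omega> * I w s \<omega>)" if "w \<in> lists A" "0 \<le> s" for w s
    by (rule L2_mult_bounded[OF L2_I[OF that] GM G(2)])
  have inner1: "(\<integral>\<omega>. G \<omega> * I u s \<omega> * I (v @ [Base 0]) r \<omega> \<partial>M) = (\<integral>r. K s r \<partial>time_measure r)"
    if "0 \<le> s" "0 \<le> r" for s r
    unfolding K_def by (rule I_time[OF v time_in that(2) GI[OF u that(1)]])
  have inner2: "(\<integral>\<omega>. G \<omega> * I (u @ [Base 0]) r \<omega> * I v s \<omega> \<partial>M) = (\<integral>r. K r s \<partial>time_measure r)"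
    if "0 \<le> s" "0 \<le> r" for s r
    using I_time[OF u time_in that(2) GI[OF v that(1)]] unfolding K_def by (simp add: mult_ac)
  \<comment> \<open>Fubini on the square needs an integrable bound for \<open>K\<close>: since
    \<open>2ab\<close> is at most the sum of the squares, \<open>K s r\<close> is dominated by
    \<open>C\<close> times the sum of the second moments at \<open>s\<close> and at
    \<open>r\<close>.\<close>
  have K_int: "integrable (?T \<Otimes>\<^sub>M ?T) (\<lambda>x. K (fst x) (snd x))"
  proof (rule Bochner_Integration.integrable_bound)
    define h where "h w s = (\<integral>\<omega>. (norm (I w s \<omega>))\<^sup>2 \<partial>M)" for w s
    have h: "integrable ?T (h w)" if "w \<in> lists A" for w
      using P.integrable_fst'[OF L2_integrable[OF L2_I_time[OF that time_in t]]] by (simp add: h_def[abs_def])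
    show "integrable (?T \<Otimes>\<^sub>M ?T) (\<lambda>x. C * (h u (fst x) * 1) + C * (1 * h v (snd x)))"
      using TT.integrable_mult_fst_snd(1)[OF h[OF u], of "\<lambda>_. 1"]
        TT.integrable_mult_fst_snd(1)[OF _ h[OF v], of "\<lambda>_. 1"]
      by (intro Bochner_Integration.integrable_add integrable_mult_right) simp_all
    have m1: "(\<lambda>x. (fst (fst x), snd x)) \<in> (?T \<Otimes>\<^sub>M ?T) \<Otimes>\<^sub>M M \<rightarrow>\<^sub>M time_space t"
      and m2: "(\<lambda>x. (snd (fst x), snd x)) \<in> (?T \<Otimes>\<^sub>M ?T) \<Otimes>\<^sub>M M \<rightarrow>\<^sub>M time_space t"
      by measurable
    have "(\<lambda>x. G (snd x) * I u (fst (fst x)) (snd x) * I v (snd (fst x)) (snd x)) \<in>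
        borel_measurable ((?T \<Otimes>\<^sub>M ?T) \<Otimes>\<^sub>M M)"
      using measurable_compose[OF m1 I_joint_measurable[OF u, of t]]
        measurable_compose[OF m2 I_joint_measurable[OF v, of t]] GM by simp
    then show "(\<lambda>x. K (fst x) (snd x)) \<in> borel_measurable (?T \<Otimes>\<^sub>M ?T)"
      unfolding K_def
      by (intro borel_measurable_lebesgue_integral) (simp add: case_prod_beta')
    show "AE x in ?T \<Otimes>\<^sub>M ?T. norm (K (fst x) (snd x)) \<le> norm (C * (h u (fst x) * 1) + C * (1 * h v (snd x)))"
    proof (rule AE_I2)
      fix x assume "x \<in> space (?T \<Otimes>\<^sub>M ?T)"
      then have x: "0 \<le> fst x" "0 \<le> snd x" by (auto simp: space_pair_measure)
      have "\<bar>K (fst x) (snd x)\<bar> \<le> (\<integral>\<omega>. \<bar>G \<omega> * I u (fst x) \<omega> * I v (snd x) \<omega>\<bar> \<partial>M)"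
        unfolding K_def by (rule integral_abs_bound)
      also have "\<dots> \<le> (\<integral>\<omega>. C * (norm (I u (fst x) \<omega>))\<^sup>2 + C * (norm (I v (snd x) \<omega>))\<^sup>2 \<partial>M)"
      proof (rule integral_mono)
        show "integrable M (\<lambda>\<omega>. \<bar>G \<omega> * I u (fst x) \<omega> * I v (snd x) \<omega>\<bar>)"
          by (intro integrable_abs L2_mult_integrable GI L2_I u v x)
        show "integrable M (\<lambda>\<omega>. C * (norm (I u (fst x) \<omega>))\<^sup>2 + C * (norm (I v (snd x) \<omega>))\<^sup>2)"
          using L2_integrable[OF L2_I[OF u x(1)]] L2_integrable[OF L2_I[OF v x(2)]] by simp
        fix \<omega> assume \<omega>: "\<omega> \<in> space M"
        define a b where "a = \<bar>I u (fst x) \<omega>\<bar>" and "b = \<bar>I v (snd x) \<omega>\<bar>"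
        have "0 \<le> a" "0 \<le> b" by (auto simp: a_def b_def)
        have "0 \<le> C" using G(2)[OF \<omega>] by simp
        have "2 * (a * b) \<le> a\<^sup>2 + b\<^sup>2"
          using zero_le_power2[of "a - b"] by (simp add: power2_eq_square algebra_simps)
        moreover have "0 \<le> a * b" using \<open>0 \<le> a\<close> \<open>0 \<le> b\<close> by simp
        ultimately have "a * b \<le> a\<^sup>2 + b\<^sup>2" by linarith
        then have "\<bar>G \<omega>\<bar> * (a * b) \<le> C * (a\<^sup>2 + b\<^sup>2)"
          using G(2)[OF \<omega>] \<open>0 \<le> a * b\<close> \<open>0 \<le> C\<close> by (intro mult_mono) auto
        then show "\<bar>G \<omega> * I u (fst x) \<omega> * I v (snd x) \<omega>\<bar> \<le>
            C * (norm (I u (fst x) \<omega>))\<^sup>2 + C * (norm (I v (snd x) \<omega>))\<^sup>2"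
          by (simp add: abs_mult a_def b_def algebra_simps)
      qed
      also have "\<dots> = C * h u (fst x) + C * h v (snd x)"
        using L2_integrable[OF L2_I[OF u x(1)]] L2_integrable[OF L2_I[OF v x(2)]] by (simp add: h_def)
      finally show "norm (K (fst x) (snd x)) \<le> norm (C * (h u (fst x) * 1) + C * (1 * h v (snd x)))"
        by simp
    qed
  qed
  have "(\<integral>\<omega>. G \<omega> * I (u @ [Base 0]) t \<omega> * I (v @ [Base 0]) t \<omega> \<partial>M) =
      (\<integral>\<omega>. G \<omega> * I (v @ [Base 0]) t \<omega> * I (u @ [Base 0]) t \<omega> \<partial>M)"
    by (simp add: mult_ac)
  also have "\<dots> = (\<integral>s. \<integral>\<omega>. G \<omega> * I (v @ [Base 0]) t \<omega> * I u s \<omega> \<partial>M \<partial>?T)"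
    by (rule I_time[OF u time_in t GI[OF v0 t]])
  also have "\<dots> = (\<integral>s. \<integral>r. K s r \<partial>?T \<partial>?T)"
    using inner1[OF _ t] by (intro Bochner_Integration.integral_cong refl) (simp add: mult_ac)
  also have "\<dots> = (\<integral>s. \<integral>r. K s r \<partial>time_measure s \<partial>?T) + (\<integral>r. \<integral>s. K s r \<partial>time_measure r \<partial>?T)"
    by (rule integral_square_split[OF K_int])
  also have "(\<integral>s. \<integral>r. K s r \<partial>time_measure s \<partial>?T) = (\<integral>s. \<integral>\<omega>. G \<omega> * I u s \<omega> * I (v @ [Base 0]) s \<omega> \<partial>M \<partial>?T)"
    by (intro Bochner_Integration.integral_cong refl inner1[symmetric]) auto
  also have "(\<integral>r. \<integral>s. K s r \<partial>time_measure r \<partial>?T) = (\<integral>s. \<integral>\<omega>. G \<omega> * I (u @ [Base 0]) s \<omega> * I v s \<omega> \<partial>M \<partial>?T)"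
    by (intro Bochner_Integration.integral_cong refl inner2[symmetric]) auto
  finally show ?thesis .
qed

text \<open>This says weakly that the conditional moment given \<open>F 0\<close> is deterministic.
  The induction removes last letters: two noise letters by the isometry, a time letter facing a
  noise letter or an empty word by \<open>one_time\<close>, two time letters by
  \<open>I_time_time\<close>. Since \<open>\<kappa>\<close> vanishes on the time letter, the same
  cases occur in \<open>moment_poly_rec\<close>.\<close>

theorem word_moments:
  assumes "u \<in> lists A" "v \<in> lists A" "0 \<le> t"
    and G: "G \<in> borel_measurable (F 0)" "\<And>\<omega>. \<omega> \<in> space M \<Longrightarrow> \<bar>G \<omega>\<bar> \<le> C"
  shows "(\<integral>\<omega>. G \<omega> * I u t \<omega> * I v t \<omega> \<partial>M) = moment_poly \<kappa> (Base 0) u v t * (\<integral>\<omega>. G \<omega> \<partial>M)"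
  using assms(1-3)
proof (induction "length u + length v" arbitrary: u v t rule: less_induct)
  case less
  let ?mp = "moment_poly \<kappa> (Base 0)" and ?E = "\<integral>\<omega>. G \<omega> \<partial>M"
  note GM = F_M[OF G(1)]
  have GI: "L2 M (\<lambda>\<omega>. G \<omega> * I w s \<omega>)" if "w \<in> lists A" "0 \<le> s" for w s
    by (rule L2_mult_bounded[OF L2_I[OF that] GM G(2)])
  have GIm: "(\<lambda>\<omega>. G \<omega> * I w s \<omega>) \<in> borel_measurable (F s)" if "w \<in> lists A" "0 \<le> s" for w s
    using F_le[OF G(1) that(2)] I_adapted[OF that] by simp
  have IH: "(\<integral>s. \<integral>\<omega>. G \<omega> * I u' s \<omega> * I v' s \<omega> \<partial>M \<partial>time_measure t) =
      (\<integral>s. ?mp u' v' s \<partial>time_measure t) * ?E"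
    if "length u' + length v' < length u + length v" "u' \<in> lists A" "v' \<in> lists A" for u' v'
  proof -
    have "(\<integral>s. \<integral>\<omega>. G \<omega> * I u' s \<omega> * I v' s \<omega> \<partial>M \<partial>time_measure t) = (\<integral>s. ?mp u' v' s * ?E \<partial>time_measure t)"
      using that by (intro Bochner_Integration.integral_cong refl less.hyps) auto
    then show ?thesis by simp
  qed
  \<comment> \<open>After moving the time integral outside, the other word still stands at time
    \<open>t\<close>. Being a martingale, it may be replaced by its value at the running time
    \<open>s\<close>, because \<open>G * I w' s\<close> is known at \<open>s\<close>.\<close>
  have one_time: "(\<integral>\<omega>. G \<omega> * I w t \<omega> * I (w' @ [Base 0]) t \<omega> \<partial>M) =
      (\<integral>s. \<integral>\<omega>. G \<omega> * I w s \<omega> * I w' s \<omega> \<partial>M \<partial>time_measure t)"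
    if w: "w \<in> lists A" "w' \<in> lists A" "Base 0 \<in> A" "w = [] \<or> last w \<noteq> Base 0" for w w'
  proof -
    have "(\<integral>\<omega>. G \<omega> * I w t \<omega> * I (w' @ [Base 0]) t \<omega> \<partial>M) =
        (\<integral>s. \<integral>\<omega>. G \<omega> * I w t \<omega> * I w' s \<omega> \<partial>M \<partial>time_measure t)"
      using w less.prems by (intro I_time GI) auto
    also have "\<dots> = (\<integral>s. \<integral>\<omega>. G \<omega> * I w s \<omega> * I w' s \<omega> \<partial>M \<partial>time_measure t)"
    proof (rule Bochner_Integration.integral_cong[OF refl])
      fix s assume "s \<in> space (time_measure t)"
      then have s: "0 \<le> s" "s \<le> t" by auto
      have "(\<integral>\<omega>. (G \<omega> * I w' s \<omega>) * I w t \<omega> \<partial>M) = (\<integral>\<omega>. (G \<omega> * I w' s \<omega>) * I w s \<omega> \<partial>M)"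
        using w s by (intro I_martingale GIm GI) auto
      then show "(\<integral>\<omega>. G \<omega> * I w t \<omega> * I w' s \<omega> \<partial>M) = (\<integral>\<omega>. G \<omega> * I w s \<omega> * I w' s \<omega> \<partial>M)"
        by (simp add: mult_ac)
    qed
    finally show ?thesis .
  qed
  \<comment> \<open>Such a word is a martingale started at zero, and \<open>G\<close> is known at
    time zero.\<close>
  have one_mart: "(\<integral>\<omega>. G \<omega> * I (w @ [a]) t \<omega> \<partial>M) = 0" if "w \<in> lists A" "a \<in> A - {Base 0}" for w a
  proof -
    have "(\<integral>\<omega>. G \<omega> * I (w @ [a]) t \<omega> \<partial>M) = (\<integral>\<omega>. G \<omega> * I (w @ [a]) 0 \<omega> \<partial>M)"
      using that less.prems L2_bounded[OF GM G(2)] by (intro I_martingale G) auto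
    also have "\<dots> = 0"
      using I_0[of w a] that by (intro integral_eq_zero_AE) auto
    finally show ?thesis .
  qed
  show ?case
  proof (cases u rule: rev_cases)
    case Nil
    show ?thesis
    proof (cases v rule: rev_cases)
      case Nil
      then show ?thesis using \<open>u = []\<close> by simp
    next
      case (snoc v' b)
      have v': "v' \<in> lists A" "b \<in> A" using less.prems snoc by auto
      show ?thesis
      proof (cases "b = Base 0")
        case True
        then show ?thesis
          using one_time[of "[]" v'] IH[of "[]" v'] v' \<open>u = []\<close> snoc less.prems
          by (subst moment_poly_rec) auto
      next
        case False
        then show ?thesis
          using one_mart[of v' b] v' \<open>u = []\<close> snoc less.prems by (subst moment_poly_rec) auto
      qed
    qed
  next
    case (snoc u' a)
    have u': "u' \<in> lists A" "a \<in> A" using less.prems snoc by auto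
    have comm: "(\<integral>\<omega>. G \<omega> * I u t \<omega> * I v t \<omega> \<partial>M) = (\<integral>\<omega>. G \<omega> * I v t \<omega> * I u t \<omega> \<partial>M)"
      by (simp add: mult_ac)
    show ?thesis
    proof (cases v rule: rev_cases)
      case Nil
      show ?thesis
      proof (cases "a = Base 0")
        case True
        then show ?thesis
          using one_time[of "[]" u'] IH[of u' "[]"] u' \<open>u = u' @ [a]\<close> Nil less.prems
          by (subst moment_poly_rec) auto
      next
        case False
        then show ?thesis
          using one_mart[of u' a] u' \<open>u = u' @ [a]\<close> Nil less.prems by (subst moment_poly_rec) auto
      qed
    next
      case v: (snoc v' b)
      have v': "v' \<in> lists A" "b \<in> A" using less.prems v by auto
      consider (tt) "a = Base 0" "b = Base 0" | (tm) "a = Base 0" "b \<noteq> Base 0"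
        | (mt) "a \<noteq> Base 0" "b = Base 0" | (mm) "a \<noteq> Base 0" "b \<noteq> Base 0" by blast
      then show ?thesis
      proof cases
        case tt
        then show ?thesis
          using I_time_time[of u' v' t, OF _ _ _ _ G] IH[of u' v] IH[of u v'] u' v' snoc v less.prems
          by (subst moment_poly_rec) (auto simp: \<kappa>_time algebra_simps)
      next
        case tm
        then show ?thesis
          using comm one_time[of v u'] IH[of u' v] u' v' snoc v less.prems
          by (subst moment_poly_rec) (auto simp: \<kappa>_time mult_ac)
      next
        case mt
        then show ?thesis
          using one_time[of u v'] IH[of u v'] u' v' snoc v less.prems
          by (subst moment_poly_rec) (auto simp: \<kappa>_time \<kappa>_sym[of _ "Base 0"])
      next
        case mm
        then show ?thesis
          using I_isometry[of u' v' a b t, OF _ _ _ _ _ G] IH[of u' v'] u' v' snoc v less.prems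
          by (subst moment_poly_rec) auto
      qed
    qed
  qed
qed

end

section \<open>Moments of Poisson integrals\<close>

lemma kernel_nn_integral_measurable:
  assumes sets_eq: "\<And>\<omega>. \<omega> \<in> space M \<Longrightarrow> sets (Q \<omega>) = sets N"
    and meas: "\<And>B. B \<in> sets N \<Longrightarrow> (\<lambda>\<omega>. emeasure (Q \<omega>) B) \<in> borel_measurable M"
    and g: "g \<in> borel_measurable N"
  shows "(\<lambda>\<omega>. \<integral>\<^sup>+z. g z \<partial>Q \<omega>) \<in> borel_measurable M"
proof -
  have Qm: "f \<in> borel_measurable (Q \<omega>)" if "\<omega> \<in> space M" "f \<in> borel_measurable N" for f :: "_ \<Rightarrow> ennreal" and \<omega>
    using that sets_eq[OF that(1)] by (simp cong: measurable_cong_sets)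
  have sp: "space (Q \<omega>) = space N" if "\<omega> \<in> space M" for \<omega> using sets_eq[OF that] by (rule sets_eq_imp_space_eq)
  show ?thesis using g
  proof (induction rule: borel_measurable_induct)
    case (cong f g)
    have "(\<integral>\<^sup>+z. f z \<partial>Q \<omega>) = (\<integral>\<^sup>+z. g z \<partial>Q \<omega>)" if "\<omega> \<in> space M" for \<omega>
      using cong(3) sp[OF that] by (intro nn_integral_cong) auto
    then show ?case using cong(4) by (simp cong: measurable_cong)
  next
    case (set B)
    have "(\<integral>\<^sup>+z. indicator B z \<partial>Q \<omega>) = emeasure (Q \<omega>) B" if "\<omega> \<in> space M" for \<omega>
      using set sets_eq[OF that] by simp
    then show ?case using meas[OF set] by (simp cong: measurable_cong)
  next
    case (mult u c)
    have "(\<integral>\<^sup>+z. c * u z \<partial>Q \<omega>) = c * (\<integral>\<^sup>+z. u z \<partial>Q \<omega>)" if "\<omega> \<in> space M" for \<omega>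
      using Qm[OF that mult(2)] by (rule nn_integral_cmult)
    then show ?case using mult(4) by (simp cong: measurable_cong)
  next
    case (add u v)
    have "(\<integral>\<^sup>+z. v z + u z \<partial>Q \<omega>) = (\<integral>\<^sup>+z. v z \<partial>Q \<omega>) + (\<integral>\<^sup>+z. u z \<partial>Q \<omega>)" if "\<omega> \<in> space M" for \<omega>
      using Qm[OF that add.hyps(3)] Qm[OF that add.hyps(1)] by (rule nn_integral_add)
    then show ?case using add.IH by (simp cong: measurable_cong)
  next
    case (seq U)
    have "(\<integral>\<^sup>+z. (SUP i. U i) z \<partial>Q \<omega>) = (SUP i. \<integral>\<^sup>+z. U i z \<partial>Q \<omega>)" if "\<omega> \<in> space M" for \<omega>
      unfolding SUP_apply using seq.hyps(3) Qm[OF that seq.hyps(1)] by (rule nn_integral_monotone_convergence_SUP)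
    then show ?case using seq.IH by (simp cong: measurable_cong)
  qed
qed

lemma kernel_integral_measurable:
  fixes g :: "'b \<Rightarrow> real"
  assumes sets_eq: "\<And>\<omega>. \<omega> \<in> space M \<Longrightarrow> sets (Q \<omega>) = sets N"
    and meas: "\<And>B. B \<in> sets N \<Longrightarrow> (\<lambda>\<omega>. emeasure (Q \<omega>) B) \<in> borel_measurable M"
    and g: "g \<in> borel_measurable N"
  shows "(\<lambda>\<omega>. \<integral>z. g z \<partial>Q \<omega>) \<in> borel_measurable M"
proof -
  note km = kernel_nn_integral_measurable[OF sets_eq meas]
  \<comment> \<open>The real integral is zero by convention where \<open>g\<close> is not absolutely
    integrable, so the formula branches on that measurable event.\<close>
  have "(\<integral>z. g z \<partial>Q \<omega>) = (if (\<integral>\<^sup>+z. ennreal \<bar>g z\<bar> \<partial>Q \<omega>) < \<infinity> then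
      enn2real (\<integral>\<^sup>+z. ennreal (g z) \<partial>Q \<omega>) - enn2real (\<integral>\<^sup>+z. ennreal (- g z) \<partial>Q \<omega>) else 0)"
    if "\<omega> \<in> space M" for \<omega>
  proof -
    have "g \<in> borel_measurable (Q \<omega>)" using g sets_eq[OF that] by (simp cong: measurable_cong_sets)
    then have "integrable (Q \<omega>) g \<longleftrightarrow> (\<integral>\<^sup>+z. ennreal \<bar>g z\<bar> \<partial>Q \<omega>) < \<infinity>"
      by (simp add: integrable_iff_bounded)
    then show ?thesis by (auto simp: real_lebesgue_integral_def not_integrable_integral_eq)
  qed
  moreover have "(\<lambda>\<omega>. if (\<integral>\<^sup>+z. ennreal \<bar>g z\<bar> \<partial>Q \<omega>) < \<infinity> then
      enn2real (\<integral>\<^sup>+z. ennreal (g z) \<partial>Q \<omega>) - enn2real (\<integral>\<^sup>+z. ennreal (- g z) \<partial>Q \<omega>) else 0) \<in> borel_measurable M"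
  proof -
    have [measurable]: "(\<lambda>\<omega>. \<integral>\<^sup>+z. ennreal \<bar>g z\<bar> \<partial>Q \<omega>) \<in> borel_measurable M"
      "(\<lambda>\<omega>. \<integral>\<^sup>+z. ennreal (g z) \<partial>Q \<omega>) \<in> borel_measurable M"
      "(\<lambda>\<omega>. \<integral>\<^sup>+z. ennreal (- g z) \<partial>Q \<omega>) \<in> borel_measurable M"
      using g by (auto intro!: km)
    show ?thesis by measurable
  qed
  ultimately show ?thesis by (simp cong: measurable_cong)
qed

text \<open>A weighted Campbell formula: an identity for counts of sets extends to integrals of
  nonnegative functions. The weight \<open>Y\<close> makes it possible to apply the lemma twice and
  obtain second moments.\<close>

lemma kernel_weighted_moment:
  assumes sets_eq: "\<And>\<omega>. \<omega> \<in> space M \<Longrightarrow> sets (Q \<omega>) = sets N"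
    and meas: "\<And>B. B \<in> sets N \<Longrightarrow> (\<lambda>\<omega>. emeasure (Q \<omega>) B) \<in> borel_measurable M"
    and Y: "Y \<in> borel_measurable M" and \<nu>: "sets \<nu> = sets N"
    and moment: "\<And>B. B \<in> sets N \<Longrightarrow> (\<integral>\<^sup>+\<omega>. Y \<omega> * emeasure (Q \<omega>) B \<partial>M) = emeasure \<nu> B"
    and g: "g \<in> borel_measurable N"
  shows "(\<integral>\<^sup>+\<omega>. Y \<omega> * (\<integral>\<^sup>+z. g z \<partial>Q \<omega>) \<partial>M) = (\<integral>\<^sup>+z. g z \<partial>\<nu>)"
proof -
  have Qm: "f \<in> borel_measurable (Q \<omega>)" if "\<omega> \<in> space M" "f \<in> borel_measurable N" for f :: "_ \<Rightarrow> ennreal" and \<omega>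
    using that sets_eq[OF that(1)] by (simp cong: measurable_cong_sets)
  have \<nu>m: "f \<in> borel_measurable \<nu>" if "f \<in> borel_measurable N" for f :: "_ \<Rightarrow> ennreal"
    using that \<nu> by (simp cong: measurable_cong_sets)
  have sp: "space (Q \<omega>) = space N" if "\<omega> \<in> space M" for \<omega> using sets_eq[OF that] by (rule sets_eq_imp_space_eq)
  have sp\<nu>: "space \<nu> = space N" using \<nu> by (rule sets_eq_imp_space_eq)
  note km = kernel_nn_integral_measurable[OF sets_eq meas]
  have Ykm: "(\<lambda>\<omega>. Y \<omega> * (\<integral>\<^sup>+z. f z \<partial>Q \<omega>)) \<in> borel_measurable M" if "f \<in> borel_measurable N" for f
    using Y km[OF _ _ that] by simp
  show ?thesis using g
  proof (induction rule: borel_measurable_induct)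
    case (cong f g)
    have "(\<integral>\<^sup>+\<omega>. Y \<omega> * (\<integral>\<^sup>+z. f z \<partial>Q \<omega>) \<partial>M) = (\<integral>\<^sup>+\<omega>. Y \<omega> * (\<integral>\<^sup>+z. g z \<partial>Q \<omega>) \<partial>M)"
      using cong(3) sp by (intro nn_integral_cong arg_cong2[where f = times] refl) auto
    moreover have "(\<integral>\<^sup>+z. f z \<partial>\<nu>) = (\<integral>\<^sup>+z. g z \<partial>\<nu>)" using cong(3) sp\<nu> by (intro nn_integral_cong) auto
    ultimately show ?case using cong(4) by simp
  next
    case (set B)
    have "(\<integral>\<^sup>+\<omega>. Y \<omega> * (\<integral>\<^sup>+z. indicator B z \<partial>Q \<omega>) \<partial>M) = (\<integral>\<^sup>+\<omega>. Y \<omega> * emeasure (Q \<omega>) B \<partial>M)"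
      using set sets_eq by (intro nn_integral_cong) simp
    then show ?case using moment[OF set] set \<nu> by simp
  next
    case (mult u c)
    have "(\<integral>\<^sup>+\<omega>. Y \<omega> * (\<integral>\<^sup>+z. c * u z \<partial>Q \<omega>) \<partial>M) = (\<integral>\<^sup>+\<omega>. c * (Y \<omega> * (\<integral>\<^sup>+z. u z \<partial>Q \<omega>)) \<partial>M)"
      using Qm[OF _ mult(2)] by (intro nn_integral_cong) (simp add: nn_integral_cmult mult_ac)
    also have "\<dots> = c * (\<integral>\<^sup>+z. u z \<partial>\<nu>)" using Ykm[OF mult(2)] mult(4) by (simp add: nn_integral_cmult)
    finally show ?case using \<nu>m[OF mult(2)] by (simp add: nn_integral_cmult)
  next
    case (add u v)
    have "(\<integral>\<^sup>+\<omega>. Y \<omega> * (\<integral>\<^sup>+z. v z + u z \<partial>Q \<omega>) \<partial>M) =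
        (\<integral>\<^sup>+\<omega>. Y \<omega> * (\<integral>\<^sup>+z. v z \<partial>Q \<omega>) + Y \<omega> * (\<integral>\<^sup>+z. u z \<partial>Q \<omega>) \<partial>M)"
      using Qm[OF _ add.hyps(1)] Qm[OF _ add.hyps(3)] by (intro nn_integral_cong) (simp add: nn_integral_add distrib_left)
    also have "\<dots> = (\<integral>\<^sup>+z. v z \<partial>\<nu>) + (\<integral>\<^sup>+z. u z \<partial>\<nu>)"
      using Ykm[OF add.hyps(1)] Ykm[OF add.hyps(3)] add.IH by (simp add: nn_integral_add)
    finally show ?case using \<nu>m[OF add.hyps(1)] \<nu>m[OF add.hyps(3)] by (simp add: nn_integral_add)
  next
    case (seq U)
    have "(\<integral>\<^sup>+\<omega>. Y \<omega> * (\<integral>\<^sup>+z. (SUP i. U i) z \<partial>Q \<omega>) \<partial>M) =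
        (\<integral>\<^sup>+\<omega>. (SUP i. Y \<omega> * (\<integral>\<^sup>+z. U i z \<partial>Q \<omega>)) \<partial>M)"
    proof (rule nn_integral_cong)
      fix \<omega> assume "\<omega> \<in> space M"
      then have "(\<integral>\<^sup>+z. (SUP i. U i) z \<partial>Q \<omega>) = (SUP i. \<integral>\<^sup>+z. U i z \<partial>Q \<omega>)"
        unfolding SUP_apply using seq.hyps(3) Qm[OF _ seq.hyps(1)] by (intro nn_integral_monotone_convergence_SUP)
      then show "Y \<omega> * (\<integral>\<^sup>+z. (SUP i. U i) z \<partial>Q \<omega>) = (SUP i. Y \<omega> * (\<integral>\<^sup>+z. U i z \<partial>Q \<omega>))"
        by (simp add: SUP_mult_left_ennreal)
    qed
    also have "\<dots> = (SUP i. \<integral>\<^sup>+\<omega>. Y \<omega> * (\<integral>\<^sup>+z. U i z \<partial>Q \<omega>) \<partial>M)"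
      using seq.hyps(3) Ykm[OF seq.hyps(1)]
      by (intro nn_integral_monotone_convergence_SUP)
        (auto simp: incseq_def le_fun_def intro!: mult_left_mono nn_integral_mono)
    also have "\<dots> = (SUP i. \<integral>\<^sup>+z. U i z \<partial>\<nu>)" using seq.IH by simp
    also have "\<dots> = (\<integral>\<^sup>+z. (SUP i. U i) z \<partial>\<nu>)"
      unfolding SUP_apply using seq.hyps(3) \<nu>m[OF seq.hyps(1)] by (rule nn_integral_monotone_convergence_SUP[symmetric])
    finally show ?case .
  qed
qed

section \<open>First and second moments of Poisson integrals\<close>

text \<open>Everything follows from the total mass and the identity
  \<open>(k + 1) * p (k + 1) = r * p k\<close>, which lowers the power of \<open>k\<close> by one;
  the terms at zero vanish, so the index shift is harmless.\<close>

lemma poisson_sums: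
  fixes r :: real
  defines "p \<equiv> \<lambda>k. r ^ k / fact k * exp (- r)"
  shows "p sums 1" "(\<lambda>k. real k * p k) sums r" "(\<lambda>k. (real k)\<^sup>2 * p k) sums (r + r\<^sup>2)"
proof -
  have "(\<lambda>k. r ^ k / fact k) sums exp r"
    using exp_converges[of r] by (simp add: scaleR_conv_of_real divide_inverse mult.commute)
  from sums_mult2[OF this, of "exp (- r)"] show 0: "p sums 1" by (simp add: p_def exp_minus_inverse)
  have 1: "(\<lambda>k. real (Suc k) * p (Suc k)) = (\<lambda>k. r * p k)"
    by (auto simp: p_def simp del: of_nat_Suc)
  have 2: "(\<lambda>k. (real (Suc k))\<^sup>2 * p (Suc k)) = (\<lambda>k. r * p k + r * (real k * p k))"
  proof
    fix k
    have "real (Suc k) * p (Suc k) = r * p k" using fun_cong[OF 1, of k] by simp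
    then have "(real (Suc k))\<^sup>2 * p (Suc k) = real (Suc k) * (r * p k)" by (simp only: power2_eq_square mult.assoc)
    then show "(real (Suc k))\<^sup>2 * p (Suc k) = r * p k + r * (real k * p k)" by (simp add: algebra_simps)
  qed
  have "(\<lambda>k. real (Suc k) * p (Suc k)) sums r" unfolding 1 using sums_mult[OF 0, of r] by simp
  then show 3: "(\<lambda>k. real k * p k) sums r" by (subst (asm) sums_Suc_iff) simp
  have "(\<lambda>k. (real (Suc k))\<^sup>2 * p (Suc k)) sums (r + r * r)"
    unfolding 2 using sums_add[OF sums_mult[OF 0, of r] sums_mult[OF 3, of r]] by simp
  then show "(\<lambda>k. (real k)\<^sup>2 * p k) sums (r + r\<^sup>2)"
    by (subst (asm) sums_Suc_iff) (simp add: power2_eq_square)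
qed

lemma (in prob_space) poisson_count_moments:
  fixes X :: "'a \<Rightarrow> ennreal"
  assumes X [measurable]: "X \<in> borel_measurable M" and r: "0 \<le> r"
    and dist: "\<And>k. measure M {\<omega> \<in> space M. X \<omega> = of_nat k} = r ^ k / fact k * exp (- r)"
  shows "(\<integral>\<^sup>+\<omega>. X \<omega> \<partial>M) = ennreal r" "(\<integral>\<^sup>+\<omega>. X \<omega> * X \<omega> \<partial>M) = ennreal (r + r\<^sup>2)"
proof -
  define p where "p k = r ^ k / fact k * exp (- r)" for k
  have p: "0 \<le> p k" for k using r by (simp add: p_def)
  define E where "E k = {\<omega> \<in> space M. X \<omega> = of_nat k}" for k
  have E [measurable]: "E k \<in> events" for k unfolding E_def by measurable
  have emE: "emeasure M (E k) = ennreal (p k)" for k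
    using dist[of k] by (simp add: E_def p_def emeasure_eq_measure)
  have E_disj: "disjoint_family E" by (auto simp: disjoint_family_on_def E_def)
  \<comment> \<open>The Poisson weights exhaust the total probability, hence \<open>X\<close>, which
    may a priori be infinite or not an integer, is almost surely a natural number.\<close>
  have "suminf (\<lambda>k. ennreal (p k)) = 1"
    using poisson_sums(1)[of r] p by (subst suminf_ennreal_eq[where x = 1]) (auto simp: p_def[abs_def])
  then have "emeasure M (\<Union>k. E k) = 1"
    using suminf_emeasure[of E M, OF _ E_disj] E by (simp add: emE image_subset_iff)
  then have "prob (\<Union>k. E k) = 1" by (simp add: emeasure_eq_measure ennreal_eq_1)
  then have AE: "AE \<omega> in M. \<omega> \<in> (\<Union>k. E k)" by (subst (asm) prob_eq_1) auto
  have moment: "(\<integral>\<^sup>+\<omega>. f (X \<omega>) \<partial>M) = ennreal s"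
    if f: "\<And>k. f (of_nat k) = ennreal (h k)" "\<And>k. 0 \<le> h k" and s: "(\<lambda>k. h k * p k) sums s"
      and fm: "f \<in> borel_measurable borel" for f h s
  proof -
    have "(\<integral>\<^sup>+\<omega>. f (X \<omega>) \<partial>M) = (\<integral>\<^sup>+\<omega>. suminf (\<lambda>k. ennreal (h k) * indicator (E k) \<omega>) \<partial>M)"
    proof (rule nn_integral_cong_AE, use AE in eventually_elim)
      fix \<omega> assume "\<omega> \<in> (\<Union>k. E k)"
      then obtain k where k: "\<omega> \<in> E k" by blast
      have "suminf (\<lambda>k. ennreal (h k) * indicator (E k) \<omega>) = (\<Sum>j\<in>{k}. ennreal (h j) * indicator (E j) \<omega>)"
        using k by (intro suminf_finite) (auto simp: E_def indicator_def)
      also have "\<dots> = f (X \<omega>)" using k f(1)[of k] by (simp add: E_def)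
      finally show "f (X \<omega>) = suminf (\<lambda>k. ennreal (h k) * indicator (E k) \<omega>)" by simp
    qed
    also have "\<dots> = suminf (\<lambda>k. \<integral>\<^sup>+\<omega>. ennreal (h k) * indicator (E k) \<omega> \<partial>M)"
      by (intro nn_integral_suminf) simp
    also have "\<dots> = suminf (\<lambda>k. ennreal (h k * p k))"
      using f(2) p by (simp add: nn_integral_cmult_indicator emE ennreal_mult)
    also have "\<dots> = ennreal s"
      using s f(2) p by (intro suminf_ennreal_eq) auto
    finally show ?thesis .
  qed
  have of_nat: "(of_nat k :: ennreal) = ennreal (real k)" for k by (simp add: ennreal_of_nat_eq_real_of_nat)
  show "(\<integral>\<^sup>+\<omega>. X \<omega> \<partial>M) = ennreal r"
    by (rule moment[of "\<lambda>x. x" real]) (use poisson_sums(2)[of r] in \<open>auto simp: of_nat p_def\<close>)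
  show "(\<integral>\<^sup>+\<omega>. X \<omega> * X \<omega> \<partial>M) = ennreal (r + r\<^sup>2)"
    by (rule moment[of "\<lambda>x. x * x" "\<lambda>k. (real k)\<^sup>2"])
      (use poisson_sums(3)[of r] in \<open>auto simp: of_nat p_def power2_eq_square ennreal_mult\<close>)
qed

text \<open>The isometry depends only on the first two moments of the counts; \<open>second\<close>
  expresses that the covariance of the counts of \<open>B\<close> and \<open>C\<close> is the
  intensity of their intersection.\<close>

locale poisson_moments = prob_space M + fin: finite_measure \<Lambda>
  for M :: "'a measure" and \<Lambda> :: "'b measure" +
  fixes Q :: "'a \<Rightarrow> 'b measure"
  assumes sets_Q: "\<And>\<omega>. \<omega> \<in> space M \<Longrightarrow> sets (Q \<omega>) = sets \<Lambda>"
    and meas_Q: "\<And>B. B \<in> sets \<Lambda> \<Longrightarrow> (\<lambda>\<omega>. emeasure (Q \<omega>) B) \<in> borel_measurable M"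
    and first: "\<And>B. B \<in> sets \<Lambda> \<Longrightarrow> (\<integral>\<^sup>+\<omega>. emeasure (Q \<omega>) B \<partial>M) = emeasure \<Lambda> B"
    and second: "\<And>B C. B \<in> sets \<Lambda> \<Longrightarrow> C \<in> sets \<Lambda> \<Longrightarrow>
      (\<integral>\<^sup>+\<omega>. emeasure (Q \<omega>) B * emeasure (Q \<omega>) C \<partial>M) =
        emeasure \<Lambda> (B \<inter> C) + emeasure \<Lambda> B * emeasure \<Lambda> C"
begin

lemma nn_measurable: "g \<in> borel_measurable \<Lambda> \<Longrightarrow> (\<lambda>\<omega>. \<integral>\<^sup>+z. g z \<partial>Q \<omega>) \<in> borel_measurable M"
  by (rule kernel_nn_integral_measurable[OF sets_Q meas_Q])

lemma nn_first:
  assumes "g \<in> borel_measurable \<Lambda>"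
  shows "(\<integral>\<^sup>+\<omega>. \<integral>\<^sup>+z. g z \<partial>Q \<omega> \<partial>M) = (\<integral>\<^sup>+z. g z \<partial>\<Lambda>)"
  using kernel_weighted_moment[OF sets_Q meas_Q, where Y = "\<lambda>_. 1" and \<nu> = \<Lambda>] first assms by simp

text \<open>The two arguments are generalised from sets to functions one after the other. Each time
  the right-hand side of the moment identity is read as a measure with a density, so that
  \<open>kernel_weighted_moment\<close> applies: first with weight
  \<open>emeasure (Q \<omega>) B\<close>, then with the integral of \<open>g\<close> as
  weight.\<close>

lemma nn_second:
  assumes g: "g \<in> borel_measurable \<Lambda>" and h: "h \<in> borel_measurable \<Lambda>"
  shows "(\<integral>\<^sup>+\<omega>. (\<integral>\<^sup>+z. g z \<partial>Q \<omega>) * (\<integral>\<^sup>+z. h z \<partial>Q \<omega>) \<partial>M) =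
    (\<integral>\<^sup>+z. g z * h z \<partial>\<Lambda>) + (\<integral>\<^sup>+z. g z \<partial>\<Lambda>) * (\<integral>\<^sup>+z. h z \<partial>\<Lambda>)"
proof -
  have 1: "(\<integral>\<^sup>+\<omega>. emeasure (Q \<omega>) B * (\<integral>\<^sup>+z. g z \<partial>Q \<omega>) \<partial>M) =
      (\<integral>\<^sup>+z. g z \<partial>density \<Lambda> (\<lambda>z. indicator B z + emeasure \<Lambda> B))" if B: "B \<in> sets \<Lambda>" for B
  proof (rule kernel_weighted_moment[OF sets_Q meas_Q meas_Q[OF B] _ _ g])
    fix C assume C: "C \<in> sets \<Lambda>"
    have "emeasure (density \<Lambda> (\<lambda>z. indicator B z + emeasure \<Lambda> B)) C =
        (\<integral>\<^sup>+z. indicator (B \<inter> C) z + emeasure \<Lambda> B * indicator C z \<partial>\<Lambda>)"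
      using B C by (subst emeasure_density) (auto intro!: nn_integral_cong simp: indicator_def)
    then show "(\<integral>\<^sup>+\<omega>. emeasure (Q \<omega>) B * emeasure (Q \<omega>) C \<partial>M) =
        emeasure (density \<Lambda> (\<lambda>z. indicator B z + emeasure \<Lambda> B)) C"
      using B C second[OF B C] by (simp add: nn_integral_add nn_integral_cmult)
  qed auto
  have "(\<integral>\<^sup>+\<omega>. (\<integral>\<^sup>+z. g z \<partial>Q \<omega>) * (\<integral>\<^sup>+z. h z \<partial>Q \<omega>) \<partial>M) =
      (\<integral>\<^sup>+z. h z \<partial>density \<Lambda> (\<lambda>z. g z + (\<integral>\<^sup>+z. g z \<partial>\<Lambda>)))"
  proof (rule kernel_weighted_moment[OF sets_Q meas_Q nn_measurable[OF g] _ _ h])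
    fix B assume B: "B \<in> sets \<Lambda>"
    have "(\<integral>\<^sup>+\<omega>. (\<integral>\<^sup>+z. g z \<partial>Q \<omega>) * emeasure (Q \<omega>) B \<partial>M) =
        (\<integral>\<^sup>+z. (indicator B z + emeasure \<Lambda> B) * g z \<partial>\<Lambda>)"
      using 1[OF B] g B by (simp add: nn_integral_density mult.commute)
    also have "\<dots> = (\<integral>\<^sup>+z. g z * indicator B z \<partial>\<Lambda>) + (\<integral>\<^sup>+z. g z \<partial>\<Lambda>) * emeasure \<Lambda> B"
    proof -
      have "(\<integral>\<^sup>+z. (indicator B z + emeasure \<Lambda> B) * g z \<partial>\<Lambda>) =
          (\<integral>\<^sup>+z. g z * indicator B z + emeasure \<Lambda> B * g z \<partial>\<Lambda>)"
        by (simp add: distrib_left mult.commute)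
      then show ?thesis using g B by (simp add: nn_integral_add nn_integral_multc mult.commute)
    qed
    also have "\<dots> = emeasure (density \<Lambda> (\<lambda>z. g z + (\<integral>\<^sup>+z. g z \<partial>\<Lambda>))) B"
      using g B by (simp add: emeasure_density distrib_right nn_integral_add nn_integral_cmult)
    finally show "(\<integral>\<^sup>+\<omega>. (\<integral>\<^sup>+z. g z \<partial>Q \<omega>) * emeasure (Q \<omega>) B \<partial>M) =
        emeasure (density \<Lambda> (\<lambda>z. g z + (\<integral>\<^sup>+z. g z \<partial>\<Lambda>))) B" .
  qed auto
  also have "\<dots> = (\<integral>\<^sup>+z. g z * h z \<partial>\<Lambda>) + (\<integral>\<^sup>+z. g z \<partial>\<Lambda>) * (\<integral>\<^sup>+z. h z \<partial>\<Lambda>)"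
    using g h by (simp add: nn_integral_density distrib_right nn_integral_add nn_integral_cmult)
  finally show ?thesis .
qed

lemma Q_measurable: "\<omega> \<in> space M \<Longrightarrow> f \<in> borel_measurable \<Lambda> \<Longrightarrow> f \<in> borel_measurable (Q \<omega>)"
  using sets_Q by (simp cong: measurable_cong_sets)

lemma AE_finite:
  assumes "L2 \<Lambda> (g :: _ \<Rightarrow> real)"
  shows "AE \<omega> in M. (\<integral>\<^sup>+z. ennreal \<bar>g z\<bar> \<partial>Q \<omega>) \<noteq> \<infinity>"
proof (rule nn_integral_PInf_AE)
  have gm: "(\<lambda>z. ennreal \<bar>g z\<bar>) \<in> borel_measurable \<Lambda>" using L2_measurable[OF assms] by simp
  show "(\<lambda>\<omega>. \<integral>\<^sup>+z. ennreal \<bar>g z\<bar> \<partial>Q \<omega>) \<in> borel_measurable M" by (rule nn_measurable[OF gm])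
  have "(\<integral>\<^sup>+z. ennreal \<bar>g z\<bar> \<partial>\<Lambda>) = ennreal (\<integral>z. \<bar>g z\<bar> \<partial>\<Lambda>)"
    using fin.L2_integrable_real[OF assms] by (intro nn_integral_eq_integral) auto
  then show "(\<integral>\<^sup>+\<omega>. \<integral>\<^sup>+z. ennreal \<bar>g z\<bar> \<partial>Q \<omega> \<partial>M) \<noteq> \<infinity>" by (simp add: nn_first[OF gm])
qed

lemma AE_integrable:
  assumes "L2 \<Lambda> (g :: _ \<Rightarrow> real)"
  shows "AE \<omega> in M. integrable (Q \<omega>) g"
  using AE_finite[OF assms] AE_space
  by eventually_elim (use Q_measurable[OF _ L2_measurable[OF assms]] in \<open>auto simp: integrable_iff_bounded less_top\<close>)

lemma nonneg_moments:
  fixes g h :: "'b \<Rightarrow> real"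
  assumes g: "L2 \<Lambda> g" "\<And>z. 0 \<le> g z" and h: "L2 \<Lambda> h" "\<And>z. 0 \<le> h z"
  shows "(\<lambda>\<omega>. \<integral>z. g z \<partial>Q \<omega>) \<in> borel_measurable M"
    "(\<integral>\<omega>. \<integral>z. g z \<partial>Q \<omega> \<partial>M) = (\<integral>z. g z \<partial>\<Lambda>)"
    "integrable M (\<lambda>\<omega>. (\<integral>z. g z \<partial>Q \<omega>) * (\<integral>z. h z \<partial>Q \<omega>))"
    "(\<integral>\<omega>. (\<integral>z. g z \<partial>Q \<omega>) * (\<integral>z. h z \<partial>Q \<omega>) \<partial>M) =
      (\<integral>z. g z * h z \<partial>\<Lambda>) + (\<integral>z. g z \<partial>\<Lambda>) * (\<integral>z. h z \<partial>\<Lambda>)"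
proof -
  have gm: "(\<lambda>z. ennreal (f z)) \<in> borel_measurable \<Lambda>" if "L2 \<Lambda> f" for f :: "'b \<Rightarrow> real"
    using L2_measurable[OF that] by simp
  have eq: "(\<integral>z. f z \<partial>Q \<omega>) = enn2real (\<integral>\<^sup>+z. ennreal (f z) \<partial>Q \<omega>)"
    if "\<omega> \<in> space M" "L2 \<Lambda> f" "\<And>z. 0 \<le> f z" for f \<omega>
    using Q_measurable[OF that(1) L2_measurable[OF that(2)]] that(3)
    by (intro integral_eq_nn_integral) auto
  have meas: "(\<lambda>\<omega>. \<integral>z. f z \<partial>Q \<omega>) \<in> borel_measurable M" if "L2 \<Lambda> f" "\<And>z. 0 \<le> f z" for f :: "'b \<Rightarrow> real"
    using nn_measurable[OF gm[OF that(1)]] eq[OF _ that] by (simp cong: measurable_cong)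
  have AE_eq: "AE \<omega> in M. ennreal (\<integral>z. f z \<partial>Q \<omega>) = (\<integral>\<^sup>+z. ennreal (f z) \<partial>Q \<omega>)"
    if "L2 \<Lambda> f" "\<And>z. 0 \<le> f z" for f :: "'b \<Rightarrow> real"
    using AE_integrable[OF that(1)] by eventually_elim (simp add: nn_integral_eq_integral that(2))
  have \<Lambda>_eq: "(\<integral>\<^sup>+z. ennreal (f z) \<partial>\<Lambda>) = ennreal (\<integral>z. f z \<partial>\<Lambda>)" if "L2 \<Lambda> f" "\<And>z. 0 \<le> f z" for f :: "'b \<Rightarrow> real"
    using fin.L2_integrable_real[OF that(1)] that(2) by (intro nn_integral_eq_integral) auto
  have pos: "0 \<le> (\<integral>z. f z \<partial>N)" if "\<And>z. 0 \<le> f z" for f :: "'b \<Rightarrow> real" and N using that by simp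
  show gQ: "(\<lambda>\<omega>. \<integral>z. g z \<partial>Q \<omega>) \<in> borel_measurable M" by (rule meas[OF g])
  have "(\<integral>\<^sup>+\<omega>. ennreal (\<integral>z. g z \<partial>Q \<omega>) \<partial>M) = (\<integral>\<^sup>+\<omega>. \<integral>\<^sup>+z. ennreal (g z) \<partial>Q \<omega> \<partial>M)"
    by (rule nn_integral_cong_AE[OF AE_eq[OF g]])
  also have "\<dots> = ennreal (\<integral>z. g z \<partial>\<Lambda>)" by (simp add: nn_first[OF gm[OF g(1)]] \<Lambda>_eq[OF g])
  finally show "(\<integral>\<omega>. \<integral>z. g z \<partial>Q \<omega> \<partial>M) = (\<integral>z. g z \<partial>\<Lambda>)"
    using gQ pos[OF g(2)] by (subst integral_eq_nn_integral) auto
  have "AE \<omega> in M. ennreal ((\<integral>z. g z \<partial>Q \<omega>) * (\<integral>z. h z \<partial>Q \<omega>)) =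
      (\<integral>\<^sup>+z. ennreal (g z) \<partial>Q \<omega>) * (\<integral>\<^sup>+z. ennreal (h z) \<partial>Q \<omega>)"
    using AE_eq[OF g] AE_eq[OF h] by eventually_elim (simp add: ennreal_mult pos g(2) h(2))
  then have "(\<integral>\<^sup>+\<omega>. ennreal ((\<integral>z. g z \<partial>Q \<omega>) * (\<integral>z. h z \<partial>Q \<omega>)) \<partial>M) =
      (\<integral>\<^sup>+\<omega>. (\<integral>\<^sup>+z. ennreal (g z) \<partial>Q \<omega>) * (\<integral>\<^sup>+z. ennreal (h z) \<partial>Q \<omega>) \<partial>M)"
    by (rule nn_integral_cong_AE)
  also have "\<dots> = (\<integral>\<^sup>+z. ennreal (g z * h z) \<partial>\<Lambda>) + ennreal (\<integral>z. g z \<partial>\<Lambda>) * ennreal (\<integral>z. h z \<partial>\<Lambda>)"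
    using g(2) h(2) by (simp add: nn_second[OF gm[OF g(1)] gm[OF h(1)]] \<Lambda>_eq[OF g] \<Lambda>_eq[OF h] ennreal_mult)
  also have "(\<integral>\<^sup>+z. ennreal (g z * h z) \<partial>\<Lambda>) = ennreal (\<integral>z. g z * h z \<partial>\<Lambda>)"
    using L2_mult_integrable[OF g(1) h(1)] g(2) h(2) by (intro nn_integral_eq_integral) auto
  finally have *: "(\<integral>\<^sup>+\<omega>. ennreal ((\<integral>z. g z \<partial>Q \<omega>) * (\<integral>z. h z \<partial>Q \<omega>)) \<partial>M) =
      ennreal ((\<integral>z. g z * h z \<partial>\<Lambda>) + (\<integral>z. g z \<partial>\<Lambda>) * (\<integral>z. h z \<partial>\<Lambda>))"
    using g(2) h(2) by (simp add: ennreal_mult ennreal_plus pos)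
  have m: "(\<lambda>\<omega>. (\<integral>z. g z \<partial>Q \<omega>) * (\<integral>z. h z \<partial>Q \<omega>)) \<in> borel_measurable M"
    using gQ meas[OF h] by simp
  show "integrable M (\<lambda>\<omega>. (\<integral>z. g z \<partial>Q \<omega>) * (\<integral>z. h z \<partial>Q \<omega>))"
    using * g(2) h(2) m by (intro integrableI_nonneg) (auto simp: pos)
  show "(\<integral>\<omega>. (\<integral>z. g z \<partial>Q \<omega>) * (\<integral>z. h z \<partial>Q \<omega>) \<partial>M) =
      (\<integral>z. g z * h z \<partial>\<Lambda>) + (\<integral>z. g z \<partial>\<Lambda>) * (\<integral>z. h z \<partial>\<Lambda>)"
    using m g(2) h(2) by (subst integral_eq_nn_integral) (auto simp: pos * simp del: ennreal_plus)
qed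

lemma integral_measurable: "L2 \<Lambda> (g :: _ \<Rightarrow> real) \<Longrightarrow> (\<lambda>\<omega>. \<integral>z. g z \<partial>Q \<omega>) \<in> borel_measurable M"
  by (rule kernel_integral_measurable[OF sets_Q meas_Q L2_measurable])

lemma L2_pos_neg_parts:
  assumes "L2 \<Lambda> (g :: _ \<Rightarrow> real)"
  shows "L2 \<Lambda> (\<lambda>z. max 0 (g z))" "L2 \<Lambda> (\<lambda>z. max 0 (- g z))"
  using L2_measurable[OF assms] L2_integrable[OF assms]
  by (auto intro!: L2_bound[where f = "\<lambda>z. (norm (g z))\<^sup>2"] simp: max_def)

text \<open>Reduction to positive and negative parts. The integral of \<open>g\<close> is the
  difference of those of its parts only where these are integrable, hence the almost sure
  identities; products are then expanded both over the probability space and over the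
  intensity.\<close>

lemma signed_moments:
  fixes g h :: "'b \<Rightarrow> real"
  assumes g: "L2 \<Lambda> g" and h: "L2 \<Lambda> h"
  shows "L2 M (\<lambda>\<omega>. \<integral>z. g z \<partial>Q \<omega>)"
    "(\<integral>\<omega>. \<integral>z. g z \<partial>Q \<omega> \<partial>M) = (\<integral>z. g z \<partial>\<Lambda>)"
    "(\<integral>\<omega>. (\<integral>z. g z \<partial>Q \<omega>) * (\<integral>z. h z \<partial>Q \<omega>) \<partial>M) =
      (\<integral>z. g z * h z \<partial>\<Lambda>) + (\<integral>z. g z \<partial>\<Lambda>) * (\<integral>z. h z \<partial>\<Lambda>)"
proof -
  define X where "X f \<omega> = (\<integral>z. f z \<partial>Q \<omega>)" for f :: "'b \<Rightarrow> real" and \<omega>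
  define P where "P f z = max 0 (f z)" for f :: "'b \<Rightarrow> real" and z
  define N where "N f z = max 0 (- f z)" for f :: "'b \<Rightarrow> real" and z
  have PN: "P f z - N f z = f z" "0 \<le> P f z" "0 \<le> N f z" for f z by (auto simp: P_def N_def)
  have L: "L2 \<Lambda> (P f)" "L2 \<Lambda> (N f)" if "L2 \<Lambda> f" for f
    using L2_pos_neg_parts[OF that] by (simp_all add: P_def[abs_def] N_def[abs_def])
  have m: "X f \<in> borel_measurable M" if "L2 \<Lambda> f" for f
    using integral_measurable[OF that] by (simp add: X_def[abs_def])
  have AE: "AE \<omega> in M. X (P f) \<omega> - X (N f) \<omega> = X f \<omega>" if "L2 \<Lambda> f" for f
    using AE_integrable[OF L(1)[OF that]] AE_integrable[OF L(2)[OF that]]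
    by eventually_elim (simp add: X_def PN(1) flip: Bochner_Integration.integral_diff)
  have L2X: "L2 M (X f)" if "L2 \<Lambda> f" "\<And>z. 0 \<le> f z" for f
    using m[OF that(1)] nonneg_moments(3)[OF that that] by (simp add: L2_def X_def power2_eq_square)
  have L2X': "L2 M (X f)" if "L2 \<Lambda> f" for f
    using L2_diff[OF L2X[OF L(1)[OF that] PN(2)] L2X[OF L(2)[OF that] PN(3)]] AE[OF that] m[OF that]
    by (rule L2_cong_AE)
  show "L2 M (\<lambda>\<omega>. \<integral>z. g z \<partial>Q \<omega>)" using L2X'[OF g] by (simp add: X_def[abs_def])
  have split: "(\<integral>z. f z \<partial>\<Lambda>) = (\<integral>z. P f z \<partial>\<Lambda>) - (\<integral>z. N f z \<partial>\<Lambda>)" if "L2 \<Lambda> f" for f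
    using fin.L2_integrable_real[OF L(1)[OF that]] fin.L2_integrable_real[OF L(2)[OF that]]
    by (simp add: PN(1) flip: Bochner_Integration.integral_diff)
  have first': "(\<integral>\<omega>. X f \<omega> \<partial>M) = (\<integral>z. f z \<partial>\<Lambda>)" if "L2 \<Lambda> f" for f
  proof -
    have "(\<integral>\<omega>. X f \<omega> \<partial>M) = (\<integral>\<omega>. X (P f) \<omega> - X (N f) \<omega> \<partial>M)"
      using AE[OF that] m[OF that] m[OF L(1)[OF that]] m[OF L(2)[OF that]]
      by (intro integral_cong_AE) auto
    also have "\<dots> = (\<integral>\<omega>. X (P f) \<omega> \<partial>M) - (\<integral>\<omega>. X (N f) \<omega> \<partial>M)"
      using L2X'[OF L(1)[OF that]] L2X'[OF L(2)[OF that]]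
      by (intro Bochner_Integration.integral_diff L2_integrable_real)
    also have "\<dots> = (\<integral>z. f z \<partial>\<Lambda>)"
      using nonneg_moments(2)[OF L(1)[OF that] PN(2) L(1)[OF that] PN(2)]
        nonneg_moments(2)[OF L(2)[OF that] PN(3) L(2)[OF that] PN(3)] split[OF that]
      by (simp add: X_def)
    finally show ?thesis .
  qed
  then show "(\<integral>\<omega>. \<integral>z. g z \<partial>Q \<omega> \<partial>M) = (\<integral>z. g z \<partial>\<Lambda>)" using g by (simp add: X_def)
  have sec: "(\<integral>\<omega>. X e \<omega> * X f \<omega> \<partial>M) = (\<integral>z. e z * f z \<partial>\<Lambda>) + (\<integral>z. e z \<partial>\<Lambda>) * (\<integral>z. f z \<partial>\<Lambda>)"
    if "L2 \<Lambda> e" "L2 \<Lambda> f" "\<And>z. 0 \<le> e z" "\<And>z. 0 \<le> f z" for e f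
    using nonneg_moments(4)[OF that(1,3,2,4)] by (simp add: X_def)
  have bil: "(\<integral>\<omega>. (a \<omega> - b \<omega>) * (c \<omega> - e \<omega>) \<partial>R) = (\<integral>\<omega>. a \<omega> * c \<omega> \<partial>R) - (\<integral>\<omega>. a \<omega> * e \<omega> \<partial>R) -
      (\<integral>\<omega>. b \<omega> * c \<omega> \<partial>R) + (\<integral>\<omega>. b \<omega> * e \<omega> \<partial>R)"
    if "L2 R a" "L2 R b" "L2 R c" "L2 R e" for a b c e :: "'c \<Rightarrow> real" and R
    using that by (simp add: left_diff_distrib right_diff_distrib L2_mult_integrable)
  have "(\<integral>\<omega>. X g \<omega> * X h \<omega> \<partial>M) = (\<integral>\<omega>. (X (P g) \<omega> - X (N g) \<omega>) * (X (P h) \<omega> - X (N h) \<omega>) \<partial>M)"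
  proof (rule integral_cong_AE)
    show "AE \<omega> in M. X g \<omega> * X h \<omega> = (X (P g) \<omega> - X (N g) \<omega>) * (X (P h) \<omega> - X (N h) \<omega>)"
      using AE[OF g] AE[OF h] by eventually_elim simp
  qed (use m[OF g] m[OF h] L[OF g, THEN m] L[OF h, THEN m] in auto)
  also have "\<dots> = (\<integral>z. (P g z - N g z) * (P h z - N h z) \<partial>\<Lambda>) +
      ((\<integral>z. P g z \<partial>\<Lambda>) - (\<integral>z. N g z \<partial>\<Lambda>)) * ((\<integral>z. P h z \<partial>\<Lambda>) - (\<integral>z. N h z \<partial>\<Lambda>))"
    using L[OF g] L[OF h] L[OF g, THEN L2X'] L[OF h, THEN L2X']
    by (simp add: bil sec PN(2,3)) (simp add: algebra_simps)
  finally show "(\<integral>\<omega>. (\<integral>z. g z \<partial>Q \<omega>) * (\<integral>z. h z \<partial>Q \<omega>) \<partial>M) =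
      (\<integral>z. g z * h z \<partial>\<Lambda>) + (\<integral>z. g z \<partial>\<Lambda>) * (\<integral>z. h z \<partial>\<Lambda>)"
    using split[OF g] split[OF h] by (simp add: X_def PN(1))
qed

lemma compensated_moments:
  fixes g h :: "'b \<Rightarrow> real"
  assumes g: "L2 \<Lambda> g" and h: "L2 \<Lambda> h"
  defines "C \<equiv> \<lambda>f \<omega>. (\<integral>z. f z \<partial>Q \<omega>) - (\<integral>z. f z \<partial>\<Lambda>)"
  shows "L2 M (C g)" "(\<integral>\<omega>. C g \<omega> \<partial>M) = 0" "(\<integral>\<omega>. C g \<omega> * C h \<omega> \<partial>M) = (\<integral>z. g z * h z \<partial>\<Lambda>)"
proof -
  note L = signed_moments(1)[OF g g] signed_moments(1)[OF h h]
  show "L2 M (C g)" unfolding C_def by (intro L2_diff L L2_const)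
  show "(\<integral>\<omega>. C g \<omega> \<partial>M) = 0"
    using L2_integrable_real[OF L(1)] signed_moments(2)[OF g g] by (simp add: C_def prob_space)
  have "(\<integral>\<omega>. C g \<omega> * C h \<omega> \<partial>M) = (\<integral>\<omega>. (\<integral>z. g z \<partial>Q \<omega>) * (\<integral>z. h z \<partial>Q \<omega>) -
      (\<integral>z. h z \<partial>\<Lambda>) * (\<integral>z. g z \<partial>Q \<omega>) - (\<integral>z. g z \<partial>\<Lambda>) * (\<integral>z. h z \<partial>Q \<omega>) + (\<integral>z. g z \<partial>\<Lambda>) * (\<integral>z. h z \<partial>\<Lambda>) \<partial>M)"
    by (simp add: C_def algebra_simps)
  also have "\<dots> = (\<integral>z. g z * h z \<partial>\<Lambda>)"
    using L2_mult_integrable[OF L] L2_integrable_real[OF L(1)] L2_integrable_real[OF L(2)]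
      signed_moments(2)[OF g g] signed_moments(2)[OF h h] signed_moments(3)[OF g h]
    by (simp add: prob_space)
  finally show "(\<integral>\<omega>. C g \<omega> * C h \<omega> \<partial>M) = (\<integral>z. g z * h z \<partial>\<Lambda>)" .
qed

end

section \<open>Compensated integrals over jumps above a threshold\<close>

lemma sets_intensity:
  assumes "sets \<rho> = sets borel"
  shows "sets (intensity \<rho>) = sets borel"
proof -
  have "sets (intensity \<rho>) = sets (borel \<Otimes>\<^sub>M borel :: (real \<times> real) measure)"
    unfolding intensity_def using assms by (intro sets_pair_measure_cong) auto
  then show ?thesis unfolding borel_prod .
qed

lemma borel_measurable_fst: "fst \<in> borel_measurable (borel :: (real \<times> real) measure)"
  by (rule borel_measurable_continuous_onI) (intro continuous_intros)

text \<open>Restriction by a density keeps the full space and its Borel sets, so that measures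
  restricted to different windows need no change of sigma-algebra.\<close>

abbreviation on_set :: "'b measure \<Rightarrow> 'b set \<Rightarrow> 'b measure" where
  "on_set q K \<equiv> density q (\<lambda>z. ennreal (indicator K z))"

abbreviation large_jumps :: "real \<Rightarrow> real set" where
  "large_jumps \<delta> \<equiv> {v. \<bar>v\<bar> > \<delta>}"

lemma emeasure_density_indicator:
  assumes "A \<in> sets M" "B \<in> sets M"
  shows "emeasure (on_set M A) B = emeasure M (B \<inter> A)"
proof -
  have "emeasure (on_set M A) B = (\<integral>\<^sup>+z. indicator (B \<inter> A) z \<partial>M)"
    using assms by (subst emeasure_density)
      (auto intro!: nn_integral_cong simp: indicator_def simp del: nn_integral_indicator)
  then show ?thesis using assms by simp
qed

text \<open>Finite intensity on \<open>K\<close> gives genuine Poisson counts for all Borel subsets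
  of \<open>K\<close>. Overlapping sets are handled through the atoms \<open>B \<inter> C\<close>,
  \<open>B - C\<close> and \<open>C - B\<close>: distinct atoms are independent, and only the common
  atom contributes a variance.\<close>

lemma (in prob_space) poisson_measure_moments:
  assumes \<rho>: "sets \<rho> = sets borel" and Q: "poisson_measure M \<rho> Q"
    and K: "K \<in> sets borel" "emeasure (intensity \<rho>) K < \<infinity>"
  shows "poisson_moments M (on_set (intensity \<rho>) K)
    (\<lambda>\<omega>. on_set (Q \<omega>) K)"
proof -
  let ?\<Lambda> = "on_set (intensity \<rho>) K"
  let ?Q = "\<lambda>\<omega>. on_set (Q \<omega>) K"
  note si = sets_intensity[OF \<rho>]
  have sQ: "sets (Q \<omega>) = sets borel" if "\<omega> \<in> space M" for \<omega>
    using Q that by (simp add: poisson_measure_def)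
  have meas: "(\<lambda>\<omega>. emeasure (Q \<omega>) B) \<in> borel_measurable M" if "B \<in> sets borel" for B
    using Q that by (simp add: poisson_measure_def)
  have fin: "emeasure (intensity \<rho>) B < \<infinity>" if "B \<in> sets borel" "B \<subseteq> K" for B
    using emeasure_mono[OF that(2), of "intensity \<rho>"] K si by (auto intro: le_less_trans)
  define \<mu> where "\<mu> B = emeasure (intensity \<rho>) B" for B
  have \<mu>_eq: "\<mu> B = ennreal (measure (intensity \<rho>) B)" if "B \<in> sets borel" "B \<subseteq> K" for B
    using fin[OF that] unfolding \<mu>_def by (intro emeasure_eq_ennreal_measure) auto
  have dist: "measure M {\<omega> \<in> space M. emeasure (Q \<omega>) B = of_nat k} =
      measure (intensity \<rho>) B ^ k / fact k * exp (- measure (intensity \<rho>) B)"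
    if "B \<in> sets borel" "B \<subseteq> K" for B k
    using Q that fin[OF that] by (simp add: poisson_measure_def)
  have mom1: "(\<integral>\<^sup>+\<omega>. emeasure (Q \<omega>) B \<partial>M) = \<mu> B" if "B \<in> sets borel" "B \<subseteq> K" for B
    using poisson_count_moments(1)[OF meas[OF that(1)] measure_nonneg dist[OF that]] \<mu>_eq[OF that] by simp
  have mom2: "(\<integral>\<^sup>+\<omega>. emeasure (Q \<omega>) B * emeasure (Q \<omega>) B \<partial>M) = \<mu> B + \<mu> B * \<mu> B"
    if "B \<in> sets borel" "B \<subseteq> K" for B
    using poisson_count_moments(2)[OF meas[OF that(1)] measure_nonneg dist[OF that]] \<mu>_eq[OF that]
    by (simp add: power2_eq_square ennreal_mult)
  have indep: "(\<integral>\<^sup>+\<omega>. emeasure (Q \<omega>) B * emeasure (Q \<omega>) C \<partial>M) = \<mu> B * \<mu> C"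
    if BC: "B \<in> sets borel" "B \<subseteq> K" "C \<in> sets borel" "C \<subseteq> K" "B \<inter> C = {}" for B C
  proof -
    \<comment> \<open>Independence of counts is postulated for finite families, so the two sets are
      packed into a family indexed by \<open>{..<2}\<close>.\<close>
    define S where "S j = (if j = 0 then B else C)" for j :: nat
    have "(\<forall>j<2. S j \<in> sets borel) \<and> disjoint_family_on S {..<2}"
      using BC by (auto simp: S_def disjoint_family_on_def)
    then have "indep_vars (\<lambda>_. borel) (\<lambda>j \<omega>. emeasure (Q \<omega>) (S j)) {..<2}"
      using Q by (auto simp: poisson_measure_def)
    then have "(\<integral>\<^sup>+\<omega>. (\<Prod>j<2. emeasure (Q \<omega>) (S j)) \<partial>M) = (\<Prod>j<2. \<integral>\<^sup>+\<omega>. emeasure (Q \<omega>) (S j) \<partial>M)"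
      by (intro indep_vars_nn_integral) auto
    then show ?thesis using mom1[OF BC(1,2)] mom1[OF BC(3,4)] by (simp add: S_def numeral_2_eq_2)
  qed
  have second: "(\<integral>\<^sup>+\<omega>. emeasure (Q \<omega>) B * emeasure (Q \<omega>) C \<partial>M) = \<mu> (B \<inter> C) + \<mu> B * \<mu> C"
    if BC: "B \<in> sets borel" "B \<subseteq> K" "C \<in> sets borel" "C \<subseteq> K" for B C
  proof -
    define X where "X = B \<inter> C"
    define Y where "Y = B - C"
    define Z where "Z = C - B"
    have XYZ: "X \<in> sets borel" "Y \<in> sets borel" "Z \<in> sets borel" "X \<subseteq> K" "Y \<subseteq> K" "Z \<subseteq> K"
      using BC by (auto simp: X_def Y_def Z_def)
    have un: "B = X \<union> Y" "C = X \<union> Z" "X \<inter> Y = {}" "X \<inter> Z = {}" "Y \<inter> X = {}" "Y \<inter> Z = {}"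
      by (auto simp: X_def Y_def Z_def)
    have add: "emeasure N B = emeasure N X + emeasure N Y" "emeasure N C = emeasure N X + emeasure N Z"
      if "sets N = sets borel" for N
      using plus_emeasure[of X N Y] plus_emeasure[of X N Z] XYZ un that by auto
    note [measurable] = meas[OF XYZ(1)] meas[OF XYZ(2)] meas[OF XYZ(3)]
    have "(\<integral>\<^sup>+\<omega>. emeasure (Q \<omega>) B * emeasure (Q \<omega>) C \<partial>M) =
       (\<integral>\<^sup>+\<omega>. emeasure (Q \<omega>) X * emeasure (Q \<omega>) X + emeasure (Q \<omega>) X * emeasure (Q \<omega>) Z +
         emeasure (Q \<omega>) Y * emeasure (Q \<omega>) X + emeasure (Q \<omega>) Y * emeasure (Q \<omega>) Z \<partial>M)"
      by (intro nn_integral_cong) (simp add: add[OF sQ] distrib_left distrib_right add.assoc)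
    also have "\<dots> = \<mu> X + \<mu> X * \<mu> X + \<mu> X * \<mu> Z + \<mu> Y * \<mu> X + \<mu> Y * \<mu> Z"
      using XYZ un by (simp add: nn_integral_add mom2 indep)
    also have "\<dots> = \<mu> X + (\<mu> X + \<mu> Y) * (\<mu> X + \<mu> Z)"
      by (simp add: distrib_left distrib_right add.assoc)
    also have "\<dots> = \<mu> (B \<inter> C) + \<mu> B * \<mu> C"
      using add[OF si] by (simp add: \<mu>_def X_def[symmetric])
    finally show ?thesis .
  qed
  have \<Lambda>_em: "emeasure ?\<Lambda> B = \<mu> (B \<inter> K)" if "B \<in> sets borel" for B
    unfolding \<mu>_def using K si that by (intro emeasure_density_indicator) auto
  have Q_em: "emeasure (?Q \<omega>) B = emeasure (Q \<omega>) (B \<inter> K)" if "\<omega> \<in> space M" "B \<in> sets borel" for \<omega> B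
    using K sQ[OF that(1)] that by (intro emeasure_density_indicator) auto
  show ?thesis
  proof (intro poisson_moments.intro poisson_moments_axioms.intro prob_space_axioms)
    have "emeasure ?\<Lambda> (space ?\<Lambda>) = \<mu> (space ?\<Lambda> \<inter> K)"
      using si by (intro \<Lambda>_em) (metis sets.top sets_density)
    then show "finite_measure ?\<Lambda>"
      using fin[of "space ?\<Lambda> \<inter> K"] K si unfolding \<mu>_def
      by (intro finite_measureI) (metis Int_lower2 infinity_ennreal_def less_irrefl sets.Int sets.top sets_density)
    show "sets (?Q \<omega>) = sets ?\<Lambda>" if "\<omega> \<in> space M" for \<omega> using sQ[OF that] si by simp
    show "(\<lambda>\<omega>. emeasure (?Q \<omega>) B) \<in> borel_measurable M" if "B \<in> sets ?\<Lambda>" for B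
      using that si K meas[of "B \<inter> K"] by (subst measurable_cong[OF Q_em]) auto
    show "(\<integral>\<^sup>+\<omega>. emeasure (?Q \<omega>) B \<partial>M) = emeasure ?\<Lambda> B" if "B \<in> sets ?\<Lambda>" for B
      using that si K mom1[of "B \<inter> K"] \<Lambda>_em[of B] by (subst nn_integral_cong[OF Q_em]) auto
    show "(\<integral>\<^sup>+\<omega>. emeasure (?Q \<omega>) B * emeasure (?Q \<omega>) C \<partial>M) =
        emeasure ?\<Lambda> (B \<inter> C) + emeasure ?\<Lambda> B * emeasure ?\<Lambda> C" if "B \<in> sets ?\<Lambda>" "C \<in> sets ?\<Lambda>" for B C
    proof -
      have BC: "B \<in> sets borel" "C \<in> sets borel" using that si by auto
      have "(\<integral>\<^sup>+\<omega>. emeasure (?Q \<omega>) B * emeasure (?Q \<omega>) C \<partial>M) =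
          (\<integral>\<^sup>+\<omega>. emeasure (Q \<omega>) (B \<inter> K) * emeasure (Q \<omega>) (C \<inter> K) \<partial>M)"
        using BC by (intro nn_integral_cong) (simp add: Q_em)
      also have "\<dots> = \<mu> ((B \<inter> K) \<inter> (C \<inter> K)) + \<mu> (B \<inter> K) * \<mu> (C \<inter> K)"
        using BC K by (intro second) auto
      also have "(B \<inter> K) \<inter> (C \<inter> K) = (B \<inter> C) \<inter> K" by auto
      finally show ?thesis using BC by (simp add: \<Lambda>_em)
    qed
  qed
qed

text \<open>With \<open>s = 0\<close> this is the approximating expression in
  \<open>compensated_integral\<close>; a general \<open>s\<close> describes an increment by noise
  after time \<open>s\<close> alone.\<close>

definition jump_part :: "real \<Rightarrow> (real \<times> real) measure \<Rightarrow> real measure \<Rightarrow> (real \<Rightarrow> real) \<Rightarrow> real \<Rightarrow> real \<Rightarrow> real" where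
  "jump_part \<delta> q \<rho> g s t =
     (LINT z:large_jumps \<delta> \<times> {s<..t}|q. g (fst z)) - (t - s) * (LINT v:large_jumps \<delta>|\<rho>. g v)"

lemma large_jumps_borel [measurable]: "large_jumps \<delta> \<in> sets borel" by measurable

text \<open>Chebyshev's inequality: on large jumps the integrand \<open>min 1 (v\<^sup>2)\<close> is
  at least \<open>min 1 (\<delta>\<^sup>2)\<close>.\<close>

lemma emeasure_large_jumps:
  assumes \<rho>: "levy_measure \<rho>" and "0 < \<delta>"
  shows "emeasure \<rho> (large_jumps \<delta>) < \<infinity>"
proof -
  have sets: "sets \<rho> = sets borel" using \<rho> by (simp add: levy_measure_def)
  have D: "large_jumps \<delta> \<in> sets \<rho>" unfolding sets by simp
  have m: "(\<lambda>v. ennreal (min 1 (v\<^sup>2))) \<in> borel_measurable \<rho>"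
    unfolding measurable_cong_sets[OF sets refl] by measurable
  have "(\<integral>\<^sup>+v. ennreal (min 1 (\<delta>\<^sup>2)) * indicator (large_jumps \<delta>) v \<partial>\<rho>) \<le> (\<integral>\<^sup>+v. ennreal (min 1 (v\<^sup>2)) \<partial>\<rho>)"
  proof (intro nn_integral_mono)
    fix v
    have "\<delta>\<^sup>2 \<le> v\<^sup>2" if "\<delta> < \<bar>v\<bar>" using that \<open>0 < \<delta>\<close> by (simp add: abs_le_square_iff[symmetric])
    then show "ennreal (min 1 (\<delta>\<^sup>2)) * indicator (large_jumps \<delta>) v \<le> ennreal (min 1 (v\<^sup>2))"
      by (auto simp: indicator_def intro!: ennreal_leI)
  qed
  also have "\<dots> < \<infinity>" using \<rho> by (simp add: levy_measure_def)
  finally have "ennreal (min 1 (\<delta>\<^sup>2)) * emeasure \<rho> (large_jumps \<delta>) < \<infinity>"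
    using D by (simp add: nn_integral_cmult)
  moreover have "0 < min 1 (\<delta>\<^sup>2)" using \<open>0 < \<delta>\<close> by simp
  ultimately show ?thesis by (auto simp: ennreal_mult_less_top simp del: min_less_iff_conj)
qed

lemma emeasure_intensity_Times:
  assumes "sets \<rho> = sets borel" "B \<in> sets borel" "0 \<le> s" "s \<le> t"
  shows "emeasure (intensity \<rho>) (B \<times> {s<..t}) = emeasure \<rho> B * ennreal (t - s)"
proof -
  interpret L: sigma_finite_measure "density lborel (indicator {0<..}) :: real measure"
    by (subst sigma_finite_measure.sigma_finite_iff_density_finite[OF sigma_finite_lborel])
      (auto simp: indicator_def)
  have "emeasure (density lborel (indicator {0<..})) {s<..t} = (\<integral>\<^sup>+x. indicator {s<..t} x \<partial>lborel)"
    using assms by (subst emeasure_density)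
      (auto intro!: nn_integral_cong simp: indicator_def simp del: nn_integral_indicator)
  then have "emeasure (density lborel (indicator {0<..})) {s<..t} = ennreal (t - s)"
    using assms by simp
  then show ?thesis
    unfolding intensity_def using assms by (subst L.emeasure_pair_measure_Times) auto
qed

text \<open>Pushing the intensity forward to the jump size reduces its integrals to integrals over
  \<open>\<rho>\<close>. Comparing values on sets takes the place of Fubini's theorem, which asks
  for sigma-finiteness of both factors.\<close>

lemma distr_intensity_fst:
  assumes \<rho>: "sets \<rho> = sets borel" and st: "0 \<le> s" "s \<le> t"
  shows "distr (on_set (intensity \<rho>) (large_jumps \<delta> \<times> {s<..t})) borel fst =
    density \<rho> (\<lambda>v. ennreal ((t - s) * indicator (large_jumps \<delta>) v))" (is "distr ?\<Lambda> borel fst = ?R")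
proof (rule measure_eqI)
  show "sets (distr ?\<Lambda> borel fst) = sets ?R" using \<rho> by simp
  fix B assume "B \<in> sets (distr ?\<Lambda> borel fst)"
  then have B: "B \<in> sets borel" by simp
  have K: "large_jumps \<delta> \<times> {s<..t} \<in> sets borel"
    unfolding borel_prod[symmetric] by (rule pair_measureI) auto
  have s\<Lambda>: "sets ?\<Lambda> = sets borel" using sets_intensity[OF \<rho>] by simp
  have m: "fst \<in> borel_measurable ?\<Lambda>"
    unfolding measurable_cong_sets[OF s\<Lambda> refl] by (rule borel_measurable_fst)
  have pre: "fst -` B \<inter> space ?\<Lambda> \<in> sets borel" using measurable_sets[OF m B] s\<Lambda> by simp
  have sp: "space ?\<Lambda> = UNIV" using sets_eq_imp_space_eq[OF s\<Lambda>] by simp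
  have "emeasure (distr ?\<Lambda> borel fst) B = emeasure ?\<Lambda> (fst -` B \<inter> space ?\<Lambda>)"
    using m B by (rule emeasure_distr)
  also have "\<dots> = emeasure (intensity \<rho>) ((fst -` B \<inter> space ?\<Lambda>) \<inter> (large_jumps \<delta> \<times> {s<..t}))"
    using K pre sets_intensity[OF \<rho>] by (intro emeasure_density_indicator) auto
  also have "(fst -` B \<inter> space ?\<Lambda>) \<inter> (large_jumps \<delta> \<times> {s<..t}) = (B \<inter> large_jumps \<delta>) \<times> {s<..t}"
    unfolding sp by auto
  also have "emeasure (intensity \<rho>) \<dots> = emeasure \<rho> (B \<inter> large_jumps \<delta>) * ennreal (t - s)"
    using B by (intro emeasure_intensity_Times \<rho> st) auto
  also have "\<dots> = (\<integral>\<^sup>+v. ennreal (t - s) * indicator (B \<inter> large_jumps \<delta>) v \<partial>\<rho>)"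
    using B \<rho> by (simp add: nn_integral_cmult_indicator mult.commute)
  also have "\<dots> = emeasure ?R B"
  proof (subst emeasure_density)
    show "(\<lambda>v. ennreal ((t - s) * indicator (large_jumps \<delta>) v)) \<in> borel_measurable \<rho>"
      unfolding measurable_cong_sets[OF \<rho> refl] by measurable
  qed (use B \<rho> in \<open>auto intro!: nn_integral_cong simp: indicator_def\<close>)
  finally show "emeasure (distr ?\<Lambda> borel fst) B = emeasure ?R B" .
qed

lemma jump_part_density:
  fixes g :: "real \<Rightarrow> real" and s t :: real
  assumes "sets q = sets borel" "K = large_jumps \<delta> \<times> {s<..t}" "g \<in> borel_measurable borel"
  shows "(LINT z:K|q. g (fst z)) = (\<integral>z. g (fst z) \<partial>on_set q K)"
    and "set_integrable q K (\<lambda>z. g (fst z)) \<longleftrightarrow> integrable (on_set q K) (\<lambda>z. g (fst z))"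
proof -
  have K: "K \<in> sets borel"
    unfolding assms(2) borel_prod[symmetric] by (rule pair_measureI) auto
  have m: "(\<lambda>z. g (fst z)) \<in> borel_measurable q"
    unfolding measurable_cong_sets[OF assms(1) refl]
    by (rule measurable_compose[OF borel_measurable_fst assms(3)])
  have i: "(indicator K :: _ \<Rightarrow> real) \<in> borel_measurable q" using K assms(1) by simp
  show "(LINT z:K|q. g (fst z)) = (\<integral>z. g (fst z) \<partial>on_set q K)"
    unfolding set_lebesgue_integral_def using m i by (intro integral_density[symmetric]) auto
  show "set_integrable q K (\<lambda>z. g (fst z)) \<longleftrightarrow> integrable (on_set q K) (\<lambda>z. g (fst z))"
    unfolding set_integrable_def using m i by (intro integrable_density[symmetric]) auto
qed

context prob_space
begin

context
  fixes \<rho> :: "real measure" and Q :: "'a \<Rightarrow> (real \<times> real) measure" and \<delta> s t :: real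
  assumes levy: "levy_measure \<rho>" and poisson: "poisson_measure M \<rho> Q" and \<delta>: "0 < \<delta>"
    and st: "0 \<le> s" "s \<le> t"
begin

lemma sets_levy: "sets \<rho> = sets borel"
  using levy by (simp add: levy_measure_def)

lemma jump_intensity_integral:
  fixes f :: "real \<Rightarrow> real"
  assumes f: "f \<in> borel_measurable borel"
  defines "\<Lambda> \<equiv> on_set (intensity \<rho>) (large_jumps \<delta> \<times> {s<..t})"
  shows "(\<integral>z. f (fst z) \<partial>\<Lambda>) = (t - s) * (LINT v:large_jumps \<delta>|\<rho>. f v)"
    and "integrable \<rho> f \<Longrightarrow> integrable \<Lambda> (\<lambda>z. f (fst z))"
    and "(\<lambda>z. f (fst z)) \<in> borel_measurable \<Lambda>"
proof -
  have s\<Lambda>: "sets \<Lambda> = sets borel" using sets_intensity[OF sets_levy] by (simp add: \<Lambda>_def)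
  have fst: "fst \<in> borel_measurable \<Lambda>"
    unfolding measurable_cong_sets[OF s\<Lambda> refl] by (rule borel_measurable_fst)
  show "(\<lambda>z. f (fst z)) \<in> borel_measurable \<Lambda>" by (rule measurable_compose[OF fst f])
  note d = distr_intensity_fst[OF sets_levy st, of \<delta>, folded \<Lambda>_def]
  have f': "f \<in> borel_measurable \<rho>" using f unfolding measurable_cong_sets[OF sets_levy refl] .
  have i: "(\<lambda>v. (t - s) * indicator (large_jumps \<delta>) v) \<in> borel_measurable \<rho>"
    unfolding measurable_cong_sets[OF sets_levy refl] by measurable
  have nn: "AE v in \<rho>. 0 \<le> (t - s) * indicator (large_jumps \<delta>) v" using st by simp
  have "(\<integral>z. f (fst z) \<partial>\<Lambda>) = (\<integral>v. f v \<partial>distr \<Lambda> borel fst)" by (rule integral_distr[OF fst f, symmetric])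
  also have "\<dots> = (\<integral>v. ((t - s) * indicator (large_jumps \<delta>) v) *\<^sub>R f v \<partial>\<rho>)"
    unfolding d by (rule integral_density[OF f' i nn])
  also have "\<dots> = (t - s) * (LINT v:large_jumps \<delta>|\<rho>. f v)"
    by (simp add: set_lebesgue_integral_def mult.assoc)
  finally show "(\<integral>z. f (fst z) \<partial>\<Lambda>) = (t - s) * (LINT v:large_jumps \<delta>|\<rho>. f v)" .
  assume "integrable \<rho> f"
  moreover have "large_jumps \<delta> \<in> sets \<rho>" unfolding sets_levy by simp
  ultimately have "integrable \<rho> (\<lambda>v. (t - s) * (indicator (large_jumps \<delta>) v *\<^sub>R f v))"
    by (intro integrable_mult_right integrable_mult_indicator)
  then have "integrable (distr \<Lambda> borel fst) f"
    unfolding d integrable_density[OF f' i nn] by (simp add: mult.assoc)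
  then show "integrable \<Lambda> (\<lambda>z. f (fst z))" unfolding integrable_distr_eq[OF fst f] .
qed

lemma jump_poisson_moments:
  "poisson_moments M (on_set (intensity \<rho>) (large_jumps \<delta> \<times> {s<..t}))
    (\<lambda>\<omega>. on_set (Q \<omega>) (large_jumps \<delta> \<times> {s<..t}))"
proof (rule poisson_measure_moments[OF sets_levy poisson])
  show "large_jumps \<delta> \<times> {s<..t} \<in> sets borel"
    unfolding borel_prod[symmetric] by (rule pair_measureI) auto
  show "emeasure (intensity \<rho>) (large_jumps \<delta> \<times> {s<..t}) < \<infinity>"
    using emeasure_large_jumps[OF levy \<delta>] emeasure_intensity_Times[OF sets_levy _ st, of "large_jumps \<delta>"]
    by (simp add: ennreal_mult_less_top)
qed

lemma L2_jump_intensity: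
  fixes f :: "real \<Rightarrow> real"
  assumes "L2 \<rho> f"
  shows "L2 (on_set (intensity \<rho>) (large_jumps \<delta> \<times> {s<..t})) (\<lambda>z. f (fst z))"
proof -
  have f: "f \<in> borel_measurable borel"
    using L2_measurable[OF assms] unfolding measurable_cong_sets[OF sets_levy refl] .
  then have "(\<lambda>v. (norm (f v))\<^sup>2) \<in> borel_measurable borel" by simp
  from jump_intensity_integral(2)[OF this L2_integrable[OF assms]] jump_intensity_integral(3)[OF f]
  show ?thesis by (simp add: L2_def)
qed

lemma jump_part_eq:
  assumes "L2 \<rho> f" "\<omega> \<in> space M"
  shows "jump_part \<delta> (Q \<omega>) \<rho> f s t =
    (\<integral>z. f (fst z) \<partial>on_set (Q \<omega>) (large_jumps \<delta> \<times> {s<..t})) -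
    (\<integral>z. f (fst z) \<partial>on_set (intensity \<rho>) (large_jumps \<delta> \<times> {s<..t}))"
proof -
  have f: "f \<in> borel_measurable borel"
    using L2_measurable[OF assms(1)] unfolding measurable_cong_sets[OF sets_levy refl] .
  have "sets (Q \<omega>) = sets borel" using poisson assms(2) by (simp add: poisson_measure_def)
  from jump_part_density(1)[OF this refl f] show ?thesis
    by (simp add: jump_part_def jump_intensity_integral(1)[OF f])
qed

lemma jump_part_moments:
  assumes g: "L2 \<rho> g" and h: "L2 \<rho> h"
  shows "L2 M (\<lambda>\<omega>. jump_part \<delta> (Q \<omega>) \<rho> g s t)"
    "(\<integral>\<omega>. jump_part \<delta> (Q \<omega>) \<rho> g s t \<partial>M) = 0"
    "(\<integral>\<omega>. jump_part \<delta> (Q \<omega>) \<rho> g s t * jump_part \<delta> (Q \<omega>) \<rho> h s t \<partial>M) =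
      (t - s) * (LINT v:large_jumps \<delta>|\<rho>. g v * h v)"
proof -
  interpret P: poisson_moments M "on_set (intensity \<rho>) (large_jumps \<delta> \<times> {s<..t})"
    "\<lambda>\<omega>. on_set (Q \<omega>) (large_jumps \<delta> \<times> {s<..t})"
    by (rule jump_poisson_moments)
  note m = P.compensated_moments[OF L2_jump_intensity[OF g] L2_jump_intensity[OF h]]
  have gh: "(\<lambda>v. g v * h v) \<in> borel_measurable borel"
    using L2_measurable[OF g] L2_measurable[OF h] unfolding measurable_cong_sets[OF sets_levy refl] by simp
  show "L2 M (\<lambda>\<omega>. jump_part \<delta> (Q \<omega>) \<rho> g s t)"
    using m(1) by (simp add: L2_def jump_part_eq[OF g] cong: measurable_cong Bochner_Integration.integrable_cong)
  show "(\<integral>\<omega>. jump_part \<delta> (Q \<omega>) \<rho> g s t \<partial>M) = 0"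
    using m(2) by (simp add: jump_part_eq[OF g] cong: Bochner_Integration.integral_cong)
  show "(\<integral>\<omega>. jump_part \<delta> (Q \<omega>) \<rho> g s t * jump_part \<delta> (Q \<omega>) \<rho> h s t \<partial>M) =
      (t - s) * (LINT v:large_jumps \<delta>|\<rho>. g v * h v)"
    using m(3) by (simp add: jump_part_eq[OF g] jump_part_eq[OF h] jump_intensity_integral(1)[OF gh]
        cong: Bochner_Integration.integral_cong)
qed

lemma AE_jump_set_integrable:
  fixes f :: "real \<Rightarrow> real"
  assumes f: "L2 \<rho> f"
  shows "AE \<omega> in M. set_integrable (Q \<omega>) (large_jumps \<delta> \<times> {s<..t}) (\<lambda>z. f (fst z))"
proof -
  interpret P: poisson_moments M "on_set (intensity \<rho>) (large_jumps \<delta> \<times> {s<..t})"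
    "\<lambda>\<omega>. on_set (Q \<omega>) (large_jumps \<delta> \<times> {s<..t})"
    by (rule jump_poisson_moments)
  have fb: "f \<in> borel_measurable borel"
    using L2_measurable[OF f] unfolding measurable_cong_sets[OF sets_levy refl] .
  have sQ: "sets (Q \<omega>) = sets borel" if "\<omega> \<in> space M" for \<omega>
    using poisson that by (simp add: poisson_measure_def)
  show ?thesis
    using P.AE_integrable[OF L2_jump_intensity[OF f]] AE_space
    by eventually_elim (use jump_part_density(2)[OF sQ refl fb] in auto)
qed

end

text \<open>Additivity over adjacent windows holds where the integrand is integrable on both, and
  this is known almost surely only.\<close>

lemma AE_jump_part_diff:
  assumes \<rho>: "levy_measure \<rho>" and Q: "poisson_measure M \<rho> Q" and \<delta>: "0 < \<delta>"
    and st: "0 \<le> s" "s \<le> t" and f: "L2 \<rho> f"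
  shows "AE \<omega> in M. jump_part \<delta> (Q \<omega>) \<rho> f 0 t - jump_part \<delta> (Q \<omega>) \<rho> f 0 s = jump_part \<delta> (Q \<omega>) \<rho> f s t"
  using AE_jump_set_integrable[OF \<rho> Q \<delta> order_refl st(1) f] AE_jump_set_integrable[OF \<rho> Q \<delta> st f]
proof eventually_elim
  case (elim \<omega>)
  have "large_jumps \<delta> \<times> {0<..t} = (large_jumps \<delta> \<times> {0<..s}) \<union> (large_jumps \<delta> \<times> {s<..t})"
    using st by auto
  then have "(LINT z:large_jumps \<delta> \<times> {0<..t}|Q \<omega>. f (fst z)) =
      (LINT z:large_jumps \<delta> \<times> {0<..s}|Q \<omega>. f (fst z)) + (LINT z:large_jumps \<delta> \<times> {s<..t}|Q \<omega>. f (fst z))"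
    using elim by (simp only:) (intro set_integral_Un, auto)
  then show ?case by (simp add: jump_part_def algebra_simps)
qed

text \<open>The window lies after time \<open>s\<close>, so only counts of sets after
  \<open>s\<close> are involved. With \<open>S\<close> the sigma-algebra of the later noise, this
  makes independence of the past applicable.\<close>

lemma jump_part_measurable:
  assumes sp: "space S = space M" and sQ: "\<And>\<omega>. \<omega> \<in> space M \<Longrightarrow> sets (Q \<omega>) = sets borel"
    and meas: "\<And>B. B \<in> sets borel \<Longrightarrow> B \<subseteq> UNIV \<times> {s<..} \<Longrightarrow> (\<lambda>\<omega>. emeasure (Q \<omega>) B) \<in> borel_measurable S"
    and f: "f \<in> borel_measurable borel"
  shows "(\<lambda>\<omega>. jump_part \<delta> (Q \<omega>) \<rho> f s t) \<in> borel_measurable S"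
proof -
  let ?K = "large_jumps \<delta> \<times> {s<..t}"
  have K: "?K \<in> sets borel" unfolding borel_prod[symmetric] by (rule pair_measureI) auto
  have ff: "(\<lambda>z. f (fst z)) \<in> borel_measurable (borel :: (real \<times> real) measure)"
    by (rule measurable_compose[OF borel_measurable_fst f])
  have "(\<lambda>\<omega>. \<integral>z. f (fst z) \<partial>on_set (Q \<omega>) ?K) \<in> borel_measurable S"
  proof (rule kernel_integral_measurable[OF _ _ ff])
    show "sets (on_set (Q \<omega>) ?K) = sets borel" if "\<omega> \<in> space S" for \<omega>
      using sQ that sp by simp
    fix B :: "(real \<times> real) set" assume B: "B \<in> sets borel"
    have "emeasure (on_set (Q \<omega>) ?K) B = emeasure (Q \<omega>) (B \<inter> ?K)" if "\<omega> \<in> space S" for \<omega>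
      using that sp sQ[of \<omega>] B K by (intro emeasure_density_indicator) auto
    then show "(\<lambda>\<omega>. emeasure (on_set (Q \<omega>) ?K) B) \<in> borel_measurable S"
      using meas[of "B \<inter> ?K"] B K by (subst measurable_cong) (auto intro!: meas)
  qed
  moreover have "(LINT z:?K|Q \<omega>. f (fst z)) = (\<integral>z. f (fst z) \<partial>on_set (Q \<omega>) ?K)"
    if "\<omega> \<in> space S" for \<omega>
    using that sp sQ by (intro jump_part_density(1) refl f) auto
  ultimately have "(\<lambda>\<omega>. LINT z:?K|Q \<omega>. f (fst z)) \<in> borel_measurable S"
    by (subst measurable_cong) auto
  then show ?thesis unfolding jump_part_def by simp
qed

end

section \<open>The driving noise\<close>

lemma (in prob_space) indep_set_expectation_mult:
  fixes X Y :: "'a \<Rightarrow> real"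
  assumes ind: "indep_set \<A> \<B>" and S: "space S = space M" "sets S \<subseteq> \<A>"
    and T: "space T = space M" "sets T \<subseteq> \<B>"
    and X: "X \<in> borel_measurable S" "integrable M X" and Y: "Y \<in> borel_measurable T" "integrable M Y"
  shows "(\<integral>\<omega>. X \<omega> * Y \<omega> \<partial>M) = (\<integral>\<omega>. X \<omega> \<partial>M) * (\<integral>\<omega>. Y \<omega> \<partial>M)"
proof (rule indep_var_lebesgue_integral[OF _ X(2) Y(2)])
  have sub: "sigma_sets (space M) {f -` B \<inter> space M |B. B \<in> sets borel} \<subseteq> sets R"
    if "f \<in> borel_measurable R" "space R = space M" for f :: "'a \<Rightarrow> real" and R
  proof -
    have "{f -` B \<inter> space M |B. B \<in> sets borel} \<subseteq> sets R"
      using measurable_sets[OF that(1)] that(2) by auto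
    from sets.sigma_sets_subset[OF this] show ?thesis using that(2) by simp
  qed
  have "indep_set (sigma_sets (space M) {X -` A \<inter> space M |A. A \<in> sets borel})
      (sigma_sets (space M) {Y -` A \<inter> space M |A. A \<in> sets borel})"
    unfolding indep_set_def
    by (rule indep_sets_mono_sets[OF ind[unfolded indep_set_def]])
      (use sub[OF X(1) S(1)] sub[OF Y(1) T(1)] S(2) T(2) in \<open>auto split: bool.splits\<close>)
  then show "indep_var borel X borel Y"
    unfolding indep_var_eq using X(2) Y(2) by auto
qed

lemma (in prob_space) indep_sets_indep_set:
  assumes "indep_sets E I" "i \<in> I" "j \<in> I" "i \<noteq> j"
  shows "indep_set (E i) (E j)"
proof (rule indep_setI)
  show "E i \<subseteq> events" "E j \<subseteq> events" using assms by (auto simp: indep_sets_def)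
  fix a b assume ab: "a \<in> E i" "b \<in> E j"
  have "prob (\<Inter>k\<in>{i, j}. (if k = i then a else b)) = (\<Prod>k\<in>{i, j}. prob (if k = i then a else b))"
    using assms ab by (intro indep_setsD[OF assms(1)]) auto
  then show "prob (a \<inter> b) = prob a * prob b" using assms(4) by (auto simp: Int_commute)
qed

lemma L2_tendsto_compose:
  assumes "L2_tendsto M X Y G" "filterlim f G H"
  shows "L2_tendsto M (\<lambda>i. X (f i)) Y H"
  using assms unfolding L2_tendsto_def
  by (auto dest: eventually_compose_filterlim filterlim_compose)

lemma (in prob_space) wiener_increment_moments:
  assumes W: "wiener_process M F X" and st: "0 \<le> s" "s \<le> t"
  shows "L2 M (\<lambda>\<omega>. X t \<omega> - X s \<omega>)" "(\<integral>\<omega>. X t \<omega> - X s \<omega> \<partial>M) = 0"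
    "(\<integral>\<omega>. (X t \<omega> - X s \<omega>) * (X t \<omega> - X s \<omega>) \<partial>M) = t - s"
proof -
  \<comment> \<open>A normal density is specified for \<open>s < t\<close> only; on the degenerate
    interval the increment is zero.\<close>
  consider "s = t" | "s < t" using st by linarith
  then have "L2 M (\<lambda>\<omega>. X t \<omega> - X s \<omega>) \<and> (\<integral>\<omega>. X t \<omega> - X s \<omega> \<partial>M) = 0 \<and>
    (\<integral>\<omega>. (X t \<omega> - X s \<omega>) * (X t \<omega> - X s \<omega>) \<partial>M) = t - s"
  proof cases
    case 2
    define \<sigma> where "\<sigma> = sqrt (t - s)"
    have \<sigma>: "0 < \<sigma>" "\<sigma>\<^sup>2 = t - s" using 2 by (auto simp: \<sigma>_def)
    have D: "distributed M lborel (\<lambda>\<omega>. X t \<omega> - X s \<omega>) (normal_density 0 \<sigma>)"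
      using W st 2 by (simp add: wiener_process_def \<sigma>_def)
    have m: "(\<lambda>\<omega>. X t \<omega> - X s \<omega>) \<in> borel_measurable M"
      using distributed_measurable[OF D] by simp
    have "integrable M (\<lambda>\<omega>. (X t \<omega> - X s \<omega>)\<^sup>2)"
      using distributed_integrable[OF D, of "\<lambda>x. x\<^sup>2"] integrable_normal_moment[OF \<sigma>(1), of 0 2] by simp
    moreover have "(\<integral>\<omega>. X t \<omega> - X s \<omega> \<partial>M) = 0"
      using distributed_integral[OF D, of "\<lambda>x. x"] integral_normal_moment_nz_1[OF \<sigma>(1), of 0] by simp
    moreover have "(\<integral>\<omega>. (X t \<omega> - X s \<omega>)\<^sup>2 \<partial>M) = \<sigma>\<^sup>2"
      using distributed_integral[OF D, of "\<lambda>x. x\<^sup>2"] integral_normal_moment_even[OF \<sigma>(1), of 0 1] by simp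
    ultimately show ?thesis using m \<sigma> by (simp add: L2_def power2_eq_square)
  qed (simp add: L2_def)
  then show "L2 M (\<lambda>\<omega>. X t \<omega> - X s \<omega>)" "(\<integral>\<omega>. X t \<omega> - X s \<omega> \<partial>M) = 0"
    "(\<integral>\<omega>. (X t \<omega> - X s \<omega>) * (X t \<omega> - X s \<omega>) \<partial>M) = t - s" by auto
qed

fun letter_index :: "letter \<Rightarrow> nat" where
  "letter_index (Base i) = i"
| "letter_index (Power i p) = i"

section \<open>Orthogonality and covariance of the letter processes\<close>

context levy_noise
begin

abbreviation proc :: "letter \<Rightarrow> real \<Rightarrow> 'a \<Rightarrow> real" where
  "proc \<equiv> letter_process d W J"

definition noise_letters :: "letter set" where
  "noise_letters = Base ` {1..l} \<union> {Power i p | i p. i \<in> {d<..l} \<and> 1 \<le> p}"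

text \<open>The increment of the process of a letter over \<open>(s, t]\<close>, with the jumps of size at most
  \<open>1 / (n + 1)\<close> removed; unlike the increment itself it is exactly a function of the noise after \<open>s\<close>.\<close>

fun noise_approx :: "nat \<Rightarrow> letter \<Rightarrow> real \<Rightarrow> real \<Rightarrow> 'a \<Rightarrow> real" where
  "noise_approx n (Base i) s t \<omega> =
     (if i \<le> d then W i t \<omega> - W i s \<omega>
      else jump_part (inverse (real (Suc n))) (Q i \<omega>) (\<rho> i) (\<lambda>v. v ^ 1) s t)"
| "noise_approx n (Power i p) s t \<omega> = jump_part (inverse (real (Suc n))) (Q i \<omega>) (\<rho> i) (\<lambda>v. v ^ p) s t"

text \<open>A jump letter \<open>Base i\<close> behaves like \<open>Power i 1\<close>; the rule
  merges the two so that later proofs distinguish only Wiener and jump letters.\<close>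

lemma noise_letters_cases:
  assumes "a \<in> noise_letters"
  obtains (wiener) i where "a = Base i" "i \<in> {1..d}" "letter_index a = i"
      "\<And>t. proc a t = W i t"
      "\<And>n s t. noise_approx n a s t = (\<lambda>\<omega>. W i t \<omega> - W i s \<omega>)"
  | (jump) i p where "i \<in> {d<..l}" "1 \<le> p" "letter_index a = i"
      "\<And>t. proc a t = J i p t"
      "\<And>n s t. noise_approx n a s t =
         (\<lambda>\<omega>. jump_part (inverse (real (Suc n))) (Q i \<omega>) (\<rho> i) (\<lambda>v. v ^ p) s t)"
proof (cases a)
  case (Base i)
  then have i: "i \<in> {1..l}" using assms by (auto simp: noise_letters_def)
  show thesis
  proof (cases "i \<le> d")
    case True
    then show thesis using Base i wiener[of i] by (auto simp: fun_eq_iff)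
  next
    case False
    then show thesis using Base i by (intro jump[of i 1]) (auto simp: fun_eq_iff)
  qed
next
  case (Power i p)
  then have "i \<in> {d<..l}" "1 \<le> p" using assms by (auto simp: noise_letters_def)
  then show thesis using Power by (intro jump[of i p]) (auto simp: fun_eq_iff)
qed

lemma noise_letter_index: "a \<in> noise_letters \<Longrightarrow> letter_index a \<in> {1..l}"
  using d_le_l by (auto simp: noise_letters_def)

lemma L2_power:
  assumes "i \<in> {d<..l}" "1 \<le> p"
  shows "L2 (\<rho> i) (\<lambda>v. v ^ p)"
  using J_integral[OF assms] by (simp add: compensated_integral_def)

lemma sets_Q_borel: "i \<in> {d<..l} \<Longrightarrow> \<omega> \<in> space M \<Longrightarrow> sets (Q i \<omega>) = sets borel"
  using poisson by (simp add: poisson_measure_def)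

abbreviation noise_sigma :: "real \<Rightarrow> nat \<Rightarrow> 'a measure" where
  "noise_sigma s i \<equiv> sigma (space M) (noise_after M d W Q s i)"

lemma noise_after_Pow: "noise_after M d W Q s i \<subseteq> Pow (space M)"
  by (auto simp: noise_after_def)

lemma noise_sigma_simps [simp]:
  "space (noise_sigma s i) = space M"
  "sets (noise_sigma s i) = sigma_sets (space M) (noise_after M d W Q s i)"
  using noise_after_Pow by simp_all

lemma noise_increment_measurable:
  assumes "i \<le> d" "s \<le> u"
  shows "(\<lambda>\<omega>. W i u \<omega> - W i s \<omega>) \<in> borel_measurable (noise_sigma s i)"
proof (rule measurableI)
  fix B :: "real set" assume "B \<in> sets borel"
  then have "(\<lambda>\<omega>. W i u \<omega> - W i s \<omega>) -` B \<inter> space M \<in> noise_after M d W Q s i"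
    unfolding noise_after_def using assms by auto
  then show "(\<lambda>\<omega>. W i u \<omega> - W i s \<omega>) -` B \<inter> space (noise_sigma s i) \<in> sets (noise_sigma s i)"
    unfolding noise_sigma_simps by (rule sigma_sets.Basic)
qed simp

lemma noise_count_measurable:
  assumes "\<not> i \<le> d" "B \<in> sets borel" "B \<subseteq> UNIV \<times> {s<..}"
  shows "(\<lambda>\<omega>. emeasure (Q i \<omega>) B) \<in> borel_measurable (noise_sigma s i)"
proof (rule measurableI)
  fix C :: "ennreal set" assume "C \<in> sets borel"
  then have "(\<lambda>\<omega>. emeasure (Q i \<omega>) B) -` C \<inter> space M \<in> noise_after M d W Q s i"
    unfolding noise_after_def using assms by auto
  then show "(\<lambda>\<omega>. emeasure (Q i \<omega>) B) -` C \<inter> space (noise_sigma s i) \<in> sets (noise_sigma s i)"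
    unfolding noise_sigma_simps by (rule sigma_sets.Basic)
qed simp

lemma noise_approx_measurable:
  assumes a: "a \<in> noise_letters" and st: "0 \<le> s" "s \<le> t"
  shows "noise_approx n a s t \<in> borel_measurable (noise_sigma s (letter_index a))"
  using a
proof (cases rule: noise_letters_cases)
  case (wiener i)
  then show ?thesis unfolding wiener(3,5) using st by (intro noise_increment_measurable) auto
next
  case (jump i p)
  show ?thesis unfolding jump
  proof (rule jump_part_measurable)
  qed (use jump sets_Q_borel noise_count_measurable in auto)
qed

lemma noise_approx_moments:
  assumes a: "a \<in> noise_letters" and st: "0 \<le> s" "s \<le> t"
  shows "L2 M (noise_approx n a s t)" "(\<integral>\<omega>. noise_approx n a s t \<omega> \<partial>M) = 0"
proof -
  have "L2 M (noise_approx n a s t) \<and> (\<integral>\<omega>. noise_approx n a s t \<omega> \<partial>M) = 0"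
    using a
  proof (cases rule: noise_letters_cases)
    case (wiener i)
    then show ?thesis
      using wiener_increment_moments[OF levy_noise.wiener[OF levy_noise_axioms] st, of i] by auto
  next
    case (jump i p)
    then show ?thesis
      using jump_part_moments[OF levy[of i] poisson[of i] _ st L2_power[of i p] L2_power[of i p]] by auto
  qed
  then show "L2 M (noise_approx n a s t)" "(\<integral>\<omega>. noise_approx n a s t \<omega> \<partial>M) = 0" by auto
qed

text \<open>\<open>compensated_integral\<close> provides limits for windows starting at time zero.
  Subtracting the limits at \<open>s\<close> and at \<open>t\<close> gives the increment, and
  additivity over windows identifies the approximants.\<close>

lemma noise_approx_tendsto:
  assumes a: "a \<in> noise_letters" and st: "0 \<le> s" "s \<le> t"
  shows "L2_tendsto M (\<lambda>n. noise_approx n a s t)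
    (\<lambda>\<omega>. proc a t \<omega> - proc a s \<omega>) sequentially"
  using a
proof (cases rule: noise_letters_cases)
  case (wiener i)
  show ?thesis
    using L2_tendsto_const[OF noise_approx_moments(1)[OF a st, of 0]] unfolding wiener(4,5) .
next
  case (jump i p)
  have lim0: "filterlim (\<lambda>n. inverse (real (Suc n))) (at_right 0) sequentially"
    using LIMSEQ_inverse_real_of_nat by (auto simp: filterlim_at intro!: always_eventually)
  have lim: "L2_tendsto M (\<lambda>n \<omega>. jump_part (inverse (real (Suc n))) (Q i \<omega>) (\<rho> i) (\<lambda>v. v ^ p) 0 r) (J i p r) sequentially"
    if "0 \<le> r" for r
  proof -
    have "L2_tendsto M (\<lambda>\<delta> \<omega>. jump_part \<delta> (Q i \<omega>) (\<rho> i) (\<lambda>v. v ^ p) 0 r) (J i p r) (at_right 0)"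
      using J_integral[OF jump(1,2)] that by (simp add: compensated_integral_def jump_part_def)
    from L2_tendsto_compose[OF this lim0] show ?thesis .
  qed
  have t: "0 \<le> t" using st by simp
  show ?thesis
  proof (rule L2_tendsto_cong_AE[OF L2_tendsto_diff[OF lim[OF t] lim[OF st(1)]]])
    have "noise_approx n a s t \<in> borel_measurable M" for n
      using noise_approx_moments(1)[OF a st] by (rule L2_measurable)
    then show "\<forall>\<^sub>F n in sequentially. noise_approx n a s t \<in> borel_measurable M \<and>
       (AE \<omega> in M. jump_part (inverse (real (Suc n))) (Q i \<omega>) (\<rho> i) (\<lambda>v. v ^ p) 0 t -
          jump_part (inverse (real (Suc n))) (Q i \<omega>) (\<rho> i) (\<lambda>v. v ^ p) 0 s = noise_approx n a s t \<omega>)"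
      unfolding jump
      by (intro always_eventually allI conjI
          AE_jump_part_diff[OF levy[OF jump(1)] poisson[OF jump(1)] _ st L2_power[OF jump(1,2)]]) auto
    have "L2 M (\<lambda>\<omega>. J i p t \<omega> - J i p s \<omega>)"
      using L2_tendstoD(1)[OF lim] st t by (intro L2_diff) auto
    then show "(\<lambda>\<omega>. proc a t \<omega> - proc a s \<omega>) \<in> borel_measurable M"
      unfolding jump by (rule L2_measurable)
    show "AE \<omega> in M. J i p t \<omega> - J i p s \<omega> = proc a t \<omega> - proc a s \<omega>"
      unfolding jump by simp
  qed
qed

text \<open>Increments from \<open>s\<close> are differences of increments from zero, and points
  after \<open>s\<close> lie after zero. Thus independence of the noises from time zero on covers
  every later interval.\<close>

lemma noise_sigma_mono:
  assumes "0 \<le> s" "i \<in> {1..l}"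
  shows "sets (noise_sigma s i) \<subseteq> sets (noise_sigma 0 i)"
proof -
  have "noise_after M d W Q s i \<subseteq> sets (noise_sigma 0 i)"
  proof (cases "i \<le> d")
    case True
    have inc: "(\<lambda>\<omega>. W i u \<omega> - W i 0 \<omega>) \<in> borel_measurable (noise_sigma 0 i)" if "0 \<le> u" for u
      by (rule noise_increment_measurable[OF True that])
    show ?thesis
    proof
      fix E assume "E \<in> noise_after M d W Q s i"
      then obtain u C where E: "E = (\<lambda>\<omega>. W i u \<omega> - W i s \<omega>) -` C \<inter> space M" "s \<le> u" "C \<in> sets borel"
        using True by (auto simp: noise_after_def)
      have "(\<lambda>\<omega>. (W i u \<omega> - W i 0 \<omega>) - (W i s \<omega> - W i 0 \<omega>)) \<in> borel_measurable (noise_sigma 0 i)"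
        using assms(1) E(2) by (intro borel_measurable_diff[OF inc inc]) auto
      from measurable_sets[OF this E(3)] show "E \<in> sets (noise_sigma 0 i)" by (simp add: E(1))
    qed
  next
    case False
    show ?thesis
    proof
      fix E assume "E \<in> noise_after M d W Q s i"
      then obtain B C where E: "E = (\<lambda>\<omega>. emeasure (Q i \<omega>) B) -` C \<inter> space M" "B \<in> sets borel"
        "B \<subseteq> UNIV \<times> {s<..}" "C \<in> sets borel"
        using False by (auto simp: noise_after_def)
      have "B \<subseteq> UNIV \<times> {0<..}" using E(3) assms(1) by force
      then have "E \<in> noise_after M d W Q 0 i" unfolding noise_after_def using E False by auto
      then show "E \<in> sets (noise_sigma 0 i)" by (simp add: sigma_sets.Basic)
    qed
  qed
  then show ?thesis
    using sets.sigma_sets_subset[of "noise_after M d W Q s i" "noise_sigma 0 i"] by simp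
qed

text \<open>The point is that the rate \<open>c\<close> depends on the threshold but not on the
  interval. Letters of different noises are independent and centred, so the rate is zero; letters of
  one noise are both Wiener or both jump letters.\<close>

lemma noise_approx_covariance:
  assumes a: "a \<in> noise_letters" and b: "b \<in> noise_letters"
  shows "\<exists>c. \<forall>s t. 0 \<le> s \<longrightarrow> s \<le> t \<longrightarrow>
    (\<integral>\<omega>. noise_approx n a s t \<omega> * noise_approx n b s t \<omega> \<partial>M) = (t - s) * c"
proof (cases "letter_index a = letter_index b")
  case False
  have "(\<integral>\<omega>. noise_approx n a s t \<omega> * noise_approx n b s t \<omega> \<partial>M) = (t - s) * 0" if st: "0 \<le> s" "s \<le> t" for s t
  proof -
    have "indep_set (sets (noise_sigma 0 (letter_index a))) (sets (noise_sigma 0 (letter_index b)))"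
      using indep_sets_indep_set[OF noises_independent noise_letter_index[OF a] noise_letter_index[OF b] False]
      by simp
    from indep_set_expectation_mult[OF this _ noise_sigma_mono[OF st(1) noise_letter_index[OF a]]
      _ noise_sigma_mono[OF st(1) noise_letter_index[OF b]] noise_approx_measurable[OF a st]
      L2_integrable_real[OF noise_approx_moments(1)[OF a st]] noise_approx_measurable[OF b st]
      L2_integrable_real[OF noise_approx_moments(1)[OF b st]]]
    show ?thesis by (simp add: noise_approx_moments(2)[OF a st])
  qed
  then show ?thesis by blast
next
  case True
  show ?thesis
    using a
  proof (cases rule: noise_letters_cases)
    case aw: (wiener i)
    from b show ?thesis
    proof (cases rule: noise_letters_cases)
      case (wiener j)
      then have "i = j" using aw True by simp
      then show ?thesis
        using aw wiener wiener_increment_moments(3)[OF levy_noise.wiener[OF levy_noise_axioms], of i]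
        by (intro exI[of _ 1]) auto
    next
      case (jump j p)
      then show ?thesis using aw True by auto
    qed
  next
    case aj: (jump i p)
    from b show ?thesis
    proof (cases rule: noise_letters_cases)
      case (wiener j)
      then show ?thesis using aj True by auto
    next
      case (jump j q)
      then have "i = j" using aj True by simp
      show ?thesis
      proof (intro exI allI impI)
        fix s t :: real assume st: "0 \<le> s" "s \<le> t"
        show "(\<integral>\<omega>. noise_approx n a s t \<omega> * noise_approx n b s t \<omega> \<partial>M) =
            (t - s) * (LINT v:large_jumps (inverse (real (Suc n)))|\<rho> i. v ^ p * v ^ q)"
          unfolding aj(5) jump(5) \<open>i = j\<close>[symmetric]
          by (rule jump_part_moments(3)[OF levy[OF aj(1)] poisson[OF aj(1)] _ st L2_power[OF aj(1,2)] L2_power[OF aj(1) jump(2)]])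
            simp
      qed
    qed
  qed
qed

abbreviation future_sigma :: "real \<Rightarrow> 'a measure" where
  "future_sigma s \<equiv> sigma (space M) (\<Union>i\<in>{1..l}. noise_after M d W Q s i)"

lemma noise_approx_future:
  assumes a: "a \<in> noise_letters" and st: "0 \<le> s" "s \<le> t"
  shows "noise_approx n a s t \<in> borel_measurable (future_sigma s)"
proof (rule measurable_from_subalg[OF _ noise_approx_measurable[OF a st]])
  have "(\<Union>i\<in>{1..l}. noise_after M d W Q s i) \<subseteq> Pow (space M)" using noise_after_Pow by blast
  then show "subalgebra (future_sigma s) (noise_sigma s (letter_index a))"
    using noise_letter_index[OF a] by (auto simp: subalgebra_def intro!: sigma_sets_mono' subsetD[OF sigma_sets_mono'])
qed

lemma past_future_expectation:
  fixes \<xi> X :: "'a \<Rightarrow> real"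
  assumes "0 \<le> s" "\<xi> \<in> borel_measurable (F s)" "integrable M \<xi>"
    and "X \<in> borel_measurable (future_sigma s)" "integrable M X"
  shows "(\<integral>\<omega>. \<xi> \<omega> * X \<omega> \<partial>M) = (\<integral>\<omega>. \<xi> \<omega> \<partial>M) * (\<integral>\<omega>. X \<omega> \<partial>M)"
proof (rule indep_set_expectation_mult[OF past_independent[OF assms(1)] _ order_refl _ _ assms(2,3,4,5)])
  have P: "(\<Union>i\<in>{1..l}. noise_after M d W Q s i) \<subseteq> Pow (space M)" using noise_after_Pow by blast
  show "space (F s) = space M" using subalg by (simp add: subalgebra_def)
  show "space (future_sigma s) = space M" using P by simp
  show "sets (future_sigma s) \<subseteq> sigma_sets (space M) (\<Union>i\<in>{1..l}. noise_after M d W Q s i)" using P by simp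
qed

text \<open>The covariation per unit time, read off on \<open>(0, 1]\<close>. It is set to zero when
  the time letter occurs, since time has no martingale part.\<close>

definition noise_cov :: "letter \<Rightarrow> letter \<Rightarrow> real" where
  "noise_cov a b = (if a = Base 0 \<or> b = Base 0 then 0 else
     (\<integral>\<omega>. (proc a 1 \<omega> - proc a 0 \<omega>) *
           (proc b 1 \<omega> - proc b 0 \<omega>) \<partial>M))"

text \<open>The approximants are measurable for the noise after \<open>s\<close>, hence independent
  of \<open>\<xi>\<close>, and centred. The increment itself is only a limit of such variables, so
  independence is used before the limit.\<close>

lemma noise_orthogonal:
  assumes a: "a \<in> noise_letters" and st: "0 \<le> s" "s \<le> t" and \<xi>: "\<xi> \<in> borel_measurable (F s)" "L2 M \<xi>"
  shows "(\<integral>\<omega>. \<xi> \<omega> * (proc a t \<omega> - proc a s \<omega>) \<partial>M) = 0"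
proof -
  have "(\<integral>\<omega>. \<xi> \<omega> * noise_approx n a s t \<omega> \<partial>M) = 0" for n
    using past_future_expectation[OF st(1) \<xi>(1) L2_integrable_real[OF \<xi>(2)] noise_approx_future[OF a st]
        L2_integrable_real[OF noise_approx_moments(1)[OF a st]]] noise_approx_moments(2)[OF a st]
    by simp
  then have "(\<lambda>n. 0) \<longlonglongrightarrow> (\<integral>\<omega>. \<xi> \<omega> * (proc a t \<omega> - proc a s \<omega>) \<partial>M)"
    using L2_tendsto_integral_mult[OF L2_tendsto_const[OF \<xi>(2)] noise_approx_tendsto[OF a st]] by simp
  then show ?thesis by (simp add: LIMSEQ_const_iff)
qed

lemma noise_isometry:
  assumes a: "a \<in> noise_letters" and b: "b \<in> noise_letters" and st: "0 \<le> s" "s \<le> t"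
    and \<xi>: "\<xi> \<in> borel_measurable (F s)" "\<And>\<omega>. \<omega> \<in> space M \<Longrightarrow> \<bar>\<xi> \<omega>\<bar> \<le> C"
  shows "(\<integral>\<omega>. \<xi> \<omega> * (proc a t \<omega> - proc a s \<omega>) *
      (proc b t \<omega> - proc b s \<omega>) \<partial>M) =
    noise_cov a b * (t - s) * (\<integral>\<omega>. \<xi> \<omega> \<partial>M)"
proof -
  have \<xi>M: "\<xi> \<in> borel_measurable M" using measurable_from_subalg[OF subalg \<xi>(1)] .
  have \<xi>int: "integrable M \<xi>" using \<xi>M \<xi>(2) by (intro integrable_const_bound[where B = C]) auto
  obtain c where c: "\<And>n s t. 0 \<le> s \<Longrightarrow> s \<le> t \<Longrightarrow>
      (\<integral>\<omega>. noise_approx n a s t \<omega> * noise_approx n b s t \<omega> \<partial>M) = (t - s) * c n"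
    using noise_approx_covariance[OF a b] by metis
  have ab: "a \<noteq> Base 0" "b \<noteq> Base 0" using a b by (auto simp: noise_letters_def)
  \<comment> \<open>As the rates do not depend on the interval, the limit may be computed on
    \<open>(0, 1]\<close>, where it is \<open>noise_cov a b\<close> by definition.\<close>
  have "c \<longlonglongrightarrow> noise_cov a b"
    using L2_tendsto_integral_mult[OF noise_approx_tendsto[OF a, of 0 1] noise_approx_tendsto[OF b, of 0 1]] ab
    by (simp add: c noise_cov_def)
  then have "(\<lambda>n. (\<integral>\<omega>. \<xi> \<omega> \<partial>M) * ((t - s) * c n)) \<longlonglongrightarrow> (\<integral>\<omega>. \<xi> \<omega> \<partial>M) * ((t - s) * noise_cov a b)"
    by (intro tendsto_mult_left)
  moreover have "(\<integral>\<omega>. \<xi> \<omega> * noise_approx n a s t \<omega> * noise_approx n b s t \<omega> \<partial>M) = (\<integral>\<omega>. \<xi> \<omega> \<partial>M) * ((t - s) * c n)" for n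
  proof -
    have "(\<integral>\<omega>. \<xi> \<omega> * (noise_approx n a s t \<omega> * noise_approx n b s t \<omega>) \<partial>M) =
        (\<integral>\<omega>. \<xi> \<omega> \<partial>M) * (\<integral>\<omega>. noise_approx n a s t \<omega> * noise_approx n b s t \<omega> \<partial>M)"
      using noise_approx_future[OF a st] noise_approx_future[OF b st]
      by (intro past_future_expectation[OF st(1) \<xi>(1) \<xi>int] L2_mult_integrable
          noise_approx_moments(1)[OF a st] noise_approx_moments(1)[OF b st]) auto
    then show ?thesis by (simp add: c st mult.assoc)
  qed
  ultimately have "(\<lambda>n. (\<integral>\<omega>. \<xi> \<omega> * noise_approx n a s t \<omega> * noise_approx n b s t \<omega> \<partial>M)) \<longlonglongrightarrow>
      (\<integral>\<omega>. \<xi> \<omega> \<partial>M) * ((t - s) * noise_cov a b)" by simp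
  from LIMSEQ_unique[OF this L2_tendsto_integral_mult3[OF noise_approx_tendsto[OF a st] noise_approx_tendsto[OF b st] \<xi>M \<xi>(2)]]
  show ?thesis by (simp add: mult_ac)
qed

lemma L2_letter_process:
  assumes a: "a \<in> noise_letters" and t: "0 \<le> t"
  shows "L2 M (proc a t)"
  using a
proof (cases rule: noise_letters_cases)
  case (wiener i)
  note w = levy_noise.wiener[OF levy_noise_axioms wiener(2)]
  have "W i t \<in> borel_measurable (F t)" using w t by (simp add: wiener_process_def)
  then have "W i t \<in> borel_measurable M" by (rule measurable_from_subalg[OF subalg])
  moreover have "AE \<omega> in M. W i t \<omega> - W i 0 \<omega> = W i t \<omega>"
    using w by (intro AE_I2) (simp add: wiener_process_def)
  ultimately show ?thesis
    unfolding wiener(4) using L2_cong_AE[OF wiener_increment_moments(1)[OF w order_refl t]] by blast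
next
  case (jump i p)
  then show ?thesis using J_integral[OF jump(1,2)] t by (auto simp: compensated_integral_def L2_tendsto_def)
qed

lemma letter_process_adapted:
  assumes a: "a \<in> noise_letters" and t: "0 \<le> t"
  shows "proc a t \<in> borel_measurable (F t)"
  using a
proof (cases rule: noise_letters_cases)
  case (wiener i)
  then show ?thesis using levy_noise.wiener[OF levy_noise_axioms wiener(2)] t by (simp add: wiener_process_def)
next
  case (jump i p)
  then show ?thesis using J_adapted[OF jump(1,2)] t by (simp add: cadlag_adapted_def)
qed

lemma ito_noise_letters:
  assumes "A - {Base 0} \<subseteq> noise_letters"
  shows "ito_noise M F A proc noise_cov"
proof (intro ito_noise.intro ito_noise_axioms.intro prob_space_axioms)
  show "subalgebra (F t) (F s)" if "s \<le> t" for s t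
    using sets_F_mono[OF that] by (simp add: subalgebra_def space_F)
  show "noise_cov a b = noise_cov b a" for a b by (simp add: noise_cov_def mult.commute)
  show "noise_cov (Base 0) b = 0" for b by (simp add: noise_cov_def)
  show "subalgebra M (F t)" for t by (rule subalg)
  fix a b and \<xi> :: "'a \<Rightarrow> real" and s t C :: real
  show "proc (Base 0) t \<omega> = t" for \<omega> by simp
  assume "a \<in> A - {Base 0}"
  then have a: "a \<in> noise_letters" using assms by blast
  show "proc a t \<in> borel_measurable (F t)" if "0 \<le> t" by (rule letter_process_adapted[OF a that])
  show "L2 M (proc a t)" if "0 \<le> t" by (rule L2_letter_process[OF a that])
  assume st: "0 \<le> s" "s \<le> t" and \<xi>: "\<xi> \<in> borel_measurable (F s)"
  show "(\<integral>\<omega>. \<xi> \<omega> * (proc a t \<omega> - proc a s \<omega>) \<partial>M) = 0" if "L2 M \<xi>"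
    by (rule noise_orthogonal[OF a st \<xi> that])
  assume "b \<in> A - {Base 0}" and bd: "\<And>\<omega>. \<omega> \<in> space M \<Longrightarrow> \<bar>\<xi> \<omega>\<bar> \<le> C"
  then have b: "b \<in> noise_letters" using assms by blast
  show "(\<integral>\<omega>. \<xi> \<omega> * (proc a t \<omega> - proc a s \<omega>) *
      (proc b t \<omega> - proc b s \<omega>) \<partial>M) =
    noise_cov a b * (t - s) * (\<integral>\<omega>. \<xi> \<omega> \<partial>M)"
    by (rule noise_isometry[OF a b st \<xi> bd])
qed

lemma alphabet_noise_letters: "alphabet M d l J - {Base 0} \<subseteq> noise_letters"
  by (auto simp: alphabet_def noise_letters_def image_iff)

end

section \<open>Reversal preserves the mean-square norm\<close>

lemma lookup_scaleR_poly_mapping: "Poly_Mapping.lookup (c *\<^sub>R p) x = (c::real) *\<^sub>R Poly_Mapping.lookup p x"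
proof -
  have "finite {i. c *\<^sub>R Poly_Mapping.lookup p i \<noteq> 0}"
    by (rule finite_subset[OF _ finite_keys[of p]]) (auto simp: in_keys_iff)
  then show ?thesis by (simp add: scaleR_poly_mapping_def)
qed

lemma poly_integral_superset:
  assumes "finite K" "Poly_Mapping.keys p \<subseteq> K"
  shows "poly_integral I p t \<omega> = (\<Sum>w\<in>K. Poly_Mapping.lookup p w * I w t \<omega>)"
  unfolding poly_integral_def using assms
  by (intro sum.mono_neutral_left) (auto simp: in_keys_iff)

lemma poly_integral_zero: "poly_integral I 0 t \<omega> = 0"
  by (simp add: poly_integral_def)

lemma poly_integral_add: "poly_integral I (p + q) t \<omega> = poly_integral I p t \<omega> + poly_integral I q t \<omega>"
proof -
  let ?K = "Poly_Mapping.keys p \<union> Poly_Mapping.keys q"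
  have "Poly_Mapping.keys (p + q) \<subseteq> ?K" by (rule Poly_Mapping.keys_add)
  then show ?thesis
    using poly_integral_superset[of ?K p I t \<omega>] poly_integral_superset[of ?K q I t \<omega>]
      poly_integral_superset[of ?K "p + q" I t \<omega>]
    by (simp add: lookup_add distrib_right sum.distrib)
qed

lemma poly_integral_scaleR: "poly_integral I (c *\<^sub>R p) t \<omega> = c * poly_integral I p t \<omega>"
proof -
  have "Poly_Mapping.keys (c *\<^sub>R p) \<subseteq> Poly_Mapping.keys p"
    by (auto simp: in_keys_iff lookup_scaleR_poly_mapping)
  then show ?thesis
    using poly_integral_superset[of "Poly_Mapping.keys p" "c *\<^sub>R p" I t \<omega>]
    by (simp add: poly_integral_def lookup_scaleR_poly_mapping sum_distrib_left mult.assoc)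
qed

lemma poly_integral_sum: "poly_integral I (\<Sum>x\<in>S. f x) t \<omega> = (\<Sum>x\<in>S. poly_integral I (f x) t \<omega>)"
  by (induction S rule: infinite_finite_induct) (auto simp: poly_integral_zero poly_integral_add)

lemma poly_integral_word: "poly_integral I (word w) t \<omega> = I w t \<omega>"
  by (simp add: poly_integral_def word_def)

text \<open>Reversing the polynomial is the same as reversing the words inside \<open>I\<close>. The
  second form is used below, as it keeps polynomial and coefficients fixed.\<close>

lemma poly_integral_reversal:
  "poly_integral I (reversal p) t \<omega> = poly_integral (\<lambda>w. I (rev w)) p t \<omega>"
  unfolding reversal_def poly_integral_sum poly_integral_scaleR poly_integral_word
  by (simp add: poly_integral_def)

lemma poly_integral_sign_reversal:
  "poly_integral I (sign_reversal (word w)) t \<omega> = (- 1) ^ length w * I (rev w) t \<omega>"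
  unfolding sign_reversal_def poly_integral_sum poly_integral_scaleR poly_integral_word
  by (simp add: word_def)

section \<open>Norm invariance of finite word sums under reversal\<close>

context ito_words
begin

text \<open>Expanding the square leaves weights \<open>U j \<omega> \<bullet> U k \<omega>\<close>
  that are bounded and \<open>F 0\<close>-measurable, as \<open>word_moments\<close> requires. The
  words enter the result only through \<open>moment_poly\<close>, which makes its invariance under
  reversal visible.\<close>

lemma bounded_word_sum_normsq:
  fixes U :: "'j \<Rightarrow> 'a \<Rightarrow> 'b::euclidean_space"
  assumes S: "finite S" and x: "\<And>j. j \<in> S \<Longrightarrow> x j \<in> lists A" and t: "0 \<le> t"
    and U: "\<And>j. j \<in> S \<Longrightarrow> U j \<in> borel_measurable (F 0)"
    and bd: "\<And>j \<omega>. j \<in> S \<Longrightarrow> \<omega> \<in> space M \<Longrightarrow> norm (U j \<omega>) \<le> C"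
  shows "(\<integral>\<^sup>+\<omega>. ennreal ((norm (\<Sum>j\<in>S. I (x j) t \<omega> *\<^sub>R U j \<omega>))\<^sup>2) \<partial>M) =
    ennreal (\<Sum>j\<in>S. \<Sum>k\<in>S. moment_poly \<kappa> (Base 0) (x j) (x k) t * (\<integral>\<omega>. U j \<omega> \<bullet> U k \<omega> \<partial>M))"
proof -
  let ?X = "\<lambda>\<omega>. (norm (\<Sum>j\<in>S. I (x j) t \<omega> *\<^sub>R U j \<omega>))\<^sup>2"
  have G: "(\<lambda>\<omega>. U j \<omega> \<bullet> U k \<omega>) \<in> borel_measurable (F 0)" if "j \<in> S" "k \<in> S" for j k
    using U that by (intro borel_measurable_inner) auto
  have G_bd: "\<bar>U j \<omega> \<bullet> U k \<omega>\<bar> \<le> C * C" if "j \<in> S" "k \<in> S" "\<omega> \<in> space M" for j k \<omega>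
  proof -
    have "\<bar>U j \<omega> \<bullet> U k \<omega>\<bar> \<le> norm (U j \<omega>) * norm (U k \<omega>)" by (rule Cauchy_Schwarz_ineq2)
    also have "\<dots> \<le> C * C"
      using bd[OF that(1,3)] bd[OF that(2,3)] order_trans[OF norm_ge_zero bd[OF that(1,3)]] by (intro mult_mono) auto
    finally show ?thesis .
  qed
  have eq: "?X \<omega> = (\<Sum>j\<in>S. \<Sum>k\<in>S. (U j \<omega> \<bullet> U k \<omega>) * I (x j) t \<omega> * I (x k) t \<omega>)" for \<omega>
    unfolding power2_norm_eq_inner inner_sum_left unfolding inner_sum_right by (simp add: mult_ac)
  have int: "integrable M (\<lambda>\<omega>. (U j \<omega> \<bullet> U k \<omega>) * I (x j) t \<omega> * I (x k) t \<omega>)" if "j \<in> S" "k \<in> S" for j k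
    using that by (intro L2_mult_integrable L2_mult_bounded[OF L2_I[OF x t] F_M[OF G] G_bd] L2_I[OF x t])
  have "integrable M ?X" unfolding eq using int by (intro Bochner_Integration.integrable_sum) auto
  then have "(\<integral>\<^sup>+\<omega>. ennreal (?X \<omega>) \<partial>M) = ennreal (\<integral>\<omega>. ?X \<omega> \<partial>M)"
    by (intro nn_integral_eq_integral) auto
  also have "(\<integral>\<omega>. ?X \<omega> \<partial>M) = (\<Sum>j\<in>S. \<Sum>k\<in>S. (\<integral>\<omega>. (U j \<omega> \<bullet> U k \<omega>) * I (x j) t \<omega> * I (x k) t \<omega> \<partial>M))"
    unfolding eq using int by (subst Bochner_Integration.integral_sum)
      (auto intro!: sum.cong Bochner_Integration.integral_sum Bochner_Integration.integrable_sum)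
  also have "\<dots> = (\<Sum>j\<in>S. \<Sum>k\<in>S. moment_poly \<kappa> (Base 0) (x j) (x k) t * (\<integral>\<omega>. U j \<omega> \<bullet> U k \<omega> \<partial>M))"
    using x t G G_bd by (intro sum.cong refl word_moments) auto
  finally show ?thesis .
qed

text \<open>The coefficients \<open>U j\<close> are unbounded, and individual terms need not be
  square integrable, so the identity is stated for nonnegative integrals. It holds after truncation
  to events of \<open>F 0\<close> on which all coefficients are bounded, and monotone convergence
  removes the truncation.\<close>

lemma word_sum_reversal_nn:
  fixes U :: "'j \<Rightarrow> 'a \<Rightarrow> 'b::euclidean_space"
  assumes S: "finite S" and x: "\<And>j. j \<in> S \<Longrightarrow> x j \<in> lists A" and t: "0 \<le> t"
    and U: "\<And>j. j \<in> S \<Longrightarrow> U j \<in> borel_measurable (F 0)"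
  shows "(\<integral>\<^sup>+\<omega>. ennreal ((norm (\<Sum>j\<in>S. I (rev (x j)) t \<omega> *\<^sub>R U j \<omega>))\<^sup>2) \<partial>M) =
    (\<integral>\<^sup>+\<omega>. ennreal ((norm (\<Sum>j\<in>S. I (x j) t \<omega> *\<^sub>R U j \<omega>))\<^sup>2) \<partial>M)"
proof -
  \<comment> \<open>One event for all coefficients together: the whole sum is then multiplied by a
    single indicator, and its square increases with \<open>m\<close>.\<close>
  define E where "E m = {\<omega> \<in> space (F 0). \<forall>j\<in>S. norm (U j \<omega>) \<le> real m}" for m :: nat
  have E: "E m \<in> sets (F 0)" for m
    unfolding E_def
  proof (intro sets.sets_Collect_finite_All S)
    fix j assume "j \<in> S"
    then have "(\<lambda>\<omega>. norm (U j \<omega>)) \<in> borel_measurable (F 0)"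
      by (intro measurable_compose[OF U borel_measurable_norm])
    then show "{\<omega> \<in> space (F 0). norm (U j \<omega>) \<le> real m} \<in> sets (F 0)" by measurable
  qed
  have spF: "space (F 0) = space M" using subalg by (simp add: subalgebra_def)
  define V where "V m j \<omega> = indicator (E m) \<omega> *\<^sub>R U j \<omega>" for m j \<omega>
  have V: "V m j \<in> borel_measurable (F 0)" if "j \<in> S" for m j
    unfolding V_def using U[OF that] E by (intro borel_measurable_scaleR borel_measurable_indicator)
  have V_bd: "norm (V m j \<omega>) \<le> real m" if "j \<in> S" for m j \<omega>
    using that by (auto simp: V_def E_def indicator_def)
  have lim: "(\<lambda>m. \<integral>\<^sup>+\<omega>. ennreal ((norm (\<Sum>j\<in>S. I (y j) t \<omega> *\<^sub>R V m j \<omega>))\<^sup>2) \<partial>M) \<longlonglongrightarrow>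
      (\<integral>\<^sup>+\<omega>. ennreal ((norm (\<Sum>j\<in>S. I (y j) t \<omega> *\<^sub>R U j \<omega>))\<^sup>2) \<partial>M)"
    if y: "\<And>j. j \<in> S \<Longrightarrow> y j \<in> lists A" for y
  proof -
    let ?f = "\<lambda>\<omega>. ennreal ((norm (\<Sum>j\<in>S. I (y j) t \<omega> *\<^sub>R U j \<omega>))\<^sup>2)"
    have [measurable]: "?f \<in> borel_measurable M"
      using L2_measurable[OF L2_I[OF y t]] F_M[OF U]
      by (intro measurable_compose[OF _ measurable_ennreal] borel_measurable_power
          measurable_compose[OF _ borel_measurable_norm] borel_measurable_sum borel_measurable_scaleR) auto
    have [measurable]: "E m \<in> sets M" for m using E subalg by (auto simp: subalgebra_def)
    have eq: "ennreal ((norm (\<Sum>j\<in>S. I (y j) t \<omega> *\<^sub>R V m j \<omega>))\<^sup>2) = indicator (E m) \<omega> * ?f \<omega>" for m \<omega>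
      by (auto simp: V_def indicator_def)
    have "incseq E" by (auto simp: incseq_def E_def intro: order_trans)
    have lim: "(\<lambda>m. indicator (E m) \<omega> * ?f \<omega>) \<longlonglongrightarrow> indicator (space M) \<omega> * ?f \<omega>" for \<omega>
    proof (cases "\<omega> \<in> space M")
      case False
      then have "\<omega> \<notin> E m" for m using spF by (simp add: E_def)
      then show ?thesis using False by simp
    next
      case True
      obtain N :: nat where N: "(\<Sum>j\<in>S. norm (U j \<omega>)) \<le> real N" using real_arch_simple by blast
      have "\<omega> \<in> E m" if "N \<le> m" for m
      proof -
        have "norm (U j \<omega>) \<le> real m" if "j \<in> S" for j
        proof -
          have "norm (U j \<omega>) \<le> (\<Sum>j\<in>S. norm (U j \<omega>))" using that S by (intro member_le_sum) auto
          then show ?thesis using N \<open>N \<le> m\<close> by linarith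
        qed
        then show ?thesis using \<open>\<omega> \<in> space M\<close> spF by (auto simp: E_def)
      qed
      then have "\<forall>\<^sub>F m in sequentially. indicator (E m) \<omega> * ?f \<omega> = indicator (space M) \<omega> * ?f \<omega>"
        using True
        by (intro eventually_sequentiallyI[of N]) simp
      then show ?thesis by (rule tendsto_eventually)
    qed
    have "(\<lambda>m. \<integral>\<^sup>+\<omega>. indicator (E m) \<omega> * ?f \<omega> \<partial>M) \<longlonglongrightarrow> (\<integral>\<^sup>+\<omega>. indicator (space M) \<omega> * ?f \<omega> \<partial>M)"
    proof (rule nn_integral_LIMSEQ)
      show "incseq (\<lambda>m \<omega>. indicator (E m) \<omega> * ?f \<omega>)"
        using \<open>incseq E\<close> by (fastforce simp: incseq_def le_fun_def indicator_def)
    qed (use lim in auto)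
    moreover have "(\<integral>\<^sup>+\<omega>. indicator (space M) \<omega> * ?f \<omega> \<partial>M) = (\<integral>\<^sup>+\<omega>. ?f \<omega> \<partial>M)"
      by (intro nn_integral_cong) simp
    ultimately show ?thesis unfolding eq by simp
  qed
  have rx: "rev (x j) \<in> lists A" if "j \<in> S" for j using x[OF that] by auto
  have bdd: "(\<integral>\<^sup>+\<omega>. ennreal ((norm (\<Sum>j\<in>S. I (y j) t \<omega> *\<^sub>R V m j \<omega>))\<^sup>2) \<partial>M) =
      ennreal (\<Sum>j\<in>S. \<Sum>k\<in>S. moment_poly \<kappa> (Base 0) (y j) (y k) t * (\<integral>\<omega>. V m j \<omega> \<bullet> V m k \<omega> \<partial>M))"
    if "\<And>j. j \<in> S \<Longrightarrow> y j \<in> lists A" for y m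
    by (rule bounded_word_sum_normsq[OF S that t V V_bd])
  have "(\<integral>\<^sup>+\<omega>. ennreal ((norm (\<Sum>j\<in>S. I (rev (x j)) t \<omega> *\<^sub>R V m j \<omega>))\<^sup>2) \<partial>M) =
      (\<integral>\<^sup>+\<omega>. ennreal ((norm (\<Sum>j\<in>S. I (x j) t \<omega> *\<^sub>R V m j \<omega>))\<^sup>2) \<partial>M)" for m
    by (simp add: bdd[OF x] bdd[OF rx] moment_poly_rev)
  moreover have "(\<lambda>m. \<integral>\<^sup>+\<omega>. ennreal ((norm (\<Sum>j\<in>S. I (rev (x j)) t \<omega> *\<^sub>R V m j \<omega>))\<^sup>2) \<partial>M) \<longlonglongrightarrow>
      (\<integral>\<^sup>+\<omega>. ennreal ((norm (\<Sum>j\<in>S. I (rev (x j)) t \<omega> *\<^sub>R U j \<omega>))\<^sup>2) \<partial>M)"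
    by (rule lim[OF rx])
  moreover have "(\<lambda>m. \<integral>\<^sup>+\<omega>. ennreal ((norm (\<Sum>j\<in>S. I (x j) t \<omega> *\<^sub>R V m j \<omega>))\<^sup>2) \<partial>M) \<longlonglongrightarrow>
      (\<integral>\<^sup>+\<omega>. ennreal ((norm (\<Sum>j\<in>S. I (x j) t \<omega> *\<^sub>R U j \<omega>))\<^sup>2) \<partial>M)"
    by (rule lim[OF x])
  ultimately show ?thesis by (auto intro: LIMSEQ_unique)
qed

text \<open>Passage from words to polynomials. Square integrability of the reversed sum is a
  consequence of the equality of nonnegative integrals.\<close>

theorem word_sum_reversal:
  fixes V :: "'w \<Rightarrow> 'a \<Rightarrow> 'b::euclidean_space"
  assumes B: "finite B" and q: "\<And>w. w \<in> B \<Longrightarrow> q w \<in> word_space A" and t: "0 \<le> t"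
    and V: "\<And>w. w \<in> B \<Longrightarrow> V w \<in> borel_measurable (F 0)"
    and L2: "L2 M (\<lambda>\<omega>. \<Sum>w\<in>B. poly_integral I (q w) t \<omega> *\<^sub>R V w \<omega>)"
  shows "L2 M (\<lambda>\<omega>. \<Sum>w\<in>B. poly_integral (\<lambda>x. I (rev x)) (q w) t \<omega> *\<^sub>R V w \<omega>)"
    "L2_normsq M (\<lambda>\<omega>. \<Sum>w\<in>B. poly_integral (\<lambda>x. I (rev x)) (q w) t \<omega> *\<^sub>R V w \<omega>) =
     L2_normsq M (\<lambda>\<omega>. \<Sum>w\<in>B. poly_integral I (q w) t \<omega> *\<^sub>R V w \<omega>)"
proof -
  \<comment> \<open>Pairs of an outer word and a word occurring in its polynomial; the same inner
    word may occur repeatedly, with different coefficients.\<close>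
  define S where "S = Sigma B (\<lambda>w. Poly_Mapping.keys (q w))"
  define U where "U j \<omega> = Poly_Mapping.lookup (q (fst j)) (snd j) *\<^sub>R V (fst j) \<omega>" for j \<omega>
  have flat: "(\<Sum>w\<in>B. poly_integral K (q w) t \<omega> *\<^sub>R V w \<omega>) = (\<Sum>j\<in>S. K (snd j) t \<omega> *\<^sub>R U j \<omega>)"
    for K :: "letter list \<Rightarrow> real \<Rightarrow> 'a \<Rightarrow> real" and \<omega>
    unfolding S_def U_def poly_integral_def scaleR_sum_left using B
    by (subst sum.Sigma) (auto simp: case_prod_beta' mult.commute)
  have S: "finite S" using B by (simp add: S_def)
  have x: "snd j \<in> lists A" if "j \<in> S" for j
  proof -
    have "fst j \<in> B" "snd j \<in> Poly_Mapping.keys (q (fst j))" using that by (auto simp: S_def)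
    then show ?thesis using q[of "fst j"] unfolding word_space_def by blast
  qed
  have U: "U j \<in> borel_measurable (F 0)" if "j \<in> S" for j
    unfolding U_def using that V by (intro borel_measurable_scaleR) (auto simp: S_def)
  let ?X = "\<lambda>\<omega>. \<Sum>j\<in>S. I (snd j) t \<omega> *\<^sub>R U j \<omega>" and ?Y = "\<lambda>\<omega>. \<Sum>j\<in>S. I (rev (snd j)) t \<omega> *\<^sub>R U j \<omega>"
  have eq: "(\<integral>\<^sup>+\<omega>. ennreal ((norm (?Y \<omega>))\<^sup>2) \<partial>M) = (\<integral>\<^sup>+\<omega>. ennreal ((norm (?X \<omega>))\<^sup>2) \<partial>M)"
    by (rule word_sum_reversal_nn[OF S x t U])
  have X: "L2 M ?X" using L2 by (simp add: flat)
  have rx: "rev (snd j) \<in> lists A" if "j \<in> S" for j using x[OF that] by auto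
  have Y: "?Y \<in> borel_measurable M"
    using L2_measurable[OF L2_I[OF rx t]] F_M[OF U]
    by (intro borel_measurable_sum borel_measurable_scaleR) auto
  have "(\<integral>\<^sup>+\<omega>. ennreal ((norm (?Y \<omega>))\<^sup>2) \<partial>M) < \<infinity>"
    unfolding eq using L2_integrable[OF X] by (simp add: nn_integral_eq_integral)
  then have "integrable M (\<lambda>\<omega>. (norm (?Y \<omega>))\<^sup>2)"
    using Y by (intro integrableI_nonneg) auto
  then show "L2 M (\<lambda>\<omega>. \<Sum>w\<in>B. poly_integral (\<lambda>x. I (rev x)) (q w) t \<omega> *\<^sub>R V w \<omega>)"
    using Y by (simp add: L2_def flat)
  show "L2_normsq M (\<lambda>\<omega>. \<Sum>w\<in>B. poly_integral (\<lambda>x. I (rev x)) (q w) t \<omega> *\<^sub>R V w \<omega>) =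
     L2_normsq M (\<lambda>\<omega>. \<Sum>w\<in>B. poly_integral I (q w) t \<omega> *\<^sub>R V w \<omega>)"
    unfolding flat L2_normsq_def using Y L2_measurable[OF X] eq
    by (simp add: integral_eq_nn_integral)
qed

end

section \<open>Comparison of the leading remainders\<close>

text \<open>The squared norm of a sum is at most twice the sum of the squared norms, and the factor
  \<open>1/2\<close> contributes a quarter. The sign \<open>c\<close> accommodates lengths of either
  parity.\<close>

lemma L2_normsq_half_diff_le:
  fixes X Y :: "'a \<Rightarrow> 'b::{real_normed_vector, second_countable_topology}"
  assumes X: "L2 M X" and Y: "L2 M Y" "L2_normsq M Y = L2_normsq M X" and c: "c\<^sup>2 = (1::real)"
  shows "L2_normsq M (\<lambda>\<omega>. (1/2) *\<^sub>R (X \<omega> - c *\<^sub>R Y \<omega>)) \<le> L2_normsq M X"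
  using L2_normsq_add_le[OF X L2_scaleR[OF Y(1), of "- c"]] c Y(2)
  by (simp only: L2_normsq_scaleR) (simp add: power2_eq_square)

text \<open>Norms are continuous in mean square, so it suffices to compare the two families over the
  same finite sets of words.\<close>

lemma L2_has_sum_normsq_le:
  fixes f g :: "'i \<Rightarrow> 'a \<Rightarrow> 'b::{real_normed_vector, second_countable_topology}"
  assumes "L2_has_sum M f A X" "L2_has_sum M g A Y"
    and "\<And>B. finite B \<Longrightarrow> B \<subseteq> A \<Longrightarrow> L2_normsq M (\<lambda>\<omega>. \<Sum>i\<in>B. f i \<omega>) \<le> L2_normsq M (\<lambda>\<omega>. \<Sum>i\<in>B. g i \<omega>)"
  shows "L2_normsq M X \<le> L2_normsq M Y"
  using L2_tendsto_normsq[OF L2_has_sum_tendsto[OF assms(2)]] L2_tendsto_normsq[OF L2_has_sum_tendsto[OF assms(1)]]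
  by (rule tendsto_le[rotated]) (auto intro!: eventually_finite_subsets_at_top_weakI assms(3))

theorem theorem4:
  fixes M :: "'a measure" and F :: "real \<Rightarrow> 'a measure" and d l :: nat
    and W :: "nat \<Rightarrow> real \<Rightarrow> 'a \<Rightarrow> real" and \<rho> :: "nat \<Rightarrow> real measure"
    and Q :: "nat \<Rightarrow> 'a \<Rightarrow> (real \<times> real) measure"
    and J :: "nat \<Rightarrow> nat \<Rightarrow> real \<Rightarrow> 'a \<Rightarrow> real"
    and A :: "letter set" and I :: "letter list \<Rightarrow> real \<Rightarrow> 'a \<Rightarrow> real"
    and V :: "nat \<Rightarrow> real^'n \<Rightarrow> real^'n"
    and Vt :: "letter \<Rightarrow> (real^'n \<Rightarrow> real^'n) \<Rightarrow> real^'n \<Rightarrow> real^'n"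
    and y0 :: "'a \<Rightarrow> real^'n" and y :: "real \<Rightarrow> 'a \<Rightarrow> real^'n"
    and t T :: real and n :: nat
    and Y_wl Y_asri R_wl R_asri :: "'a \<Rightarrow> real^'n"
  assumes alphabet: "A = alphabet M d l J"
    and noise: "levy_noise M F d l W \<rho> Q J"
    and iterated: "iterated_integrals M F A (letter_process d W J) I"
    and initial: "y0 \<in> borel_measurable (F 0)" "L2 M y0"
    and solution: "ito_solution M F d l (letter_process d W J) V y0 y"
    and expansion: "separated_expansion M A I Vt T y0 y"
    and time: "t \<in> {0..T}"
    and taylor: "taylor_scheme M A I Vt n t y0 Y_wl"
    and asri: "asri_scheme M A I Vt n t y0 Y_asri"
    and leading_wl: "L2_has_sum M (\<lambda>w \<omega>. I w t \<omega> *\<^sub>R word_field Vt w (y0 \<omega>))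
                       (words_of_length A (n + 1)) R_wl"
    and leading_asri: "L2_has_sum M
                         (\<lambda>w \<omega>. (1/2 * (I w t \<omega> - poly_integral I (sign_reversal (word w)) t \<omega>)) *\<^sub>R
                                    word_field Vt w (y0 \<omega>))
                         (words_of_length A (n + 1)) R_asri"
  shows
    "word_series M A (\<lambda>w \<omega>. I w t \<omega> *\<^sub>R word_field Vt w (y0 \<omega>)) (n + 2)
       (\<lambda>\<omega>. (y t \<omega> - Y_wl \<omega>) - R_wl \<omega>) \<and>
     word_series M A (\<lambda>w \<omega>. I w t \<omega> *\<^sub>R word_field Vt w (y0 \<omega>)) (n + 2)
       (\<lambda>\<omega>. (y t \<omega> - Y_asri \<omega>) - R_asri \<omega>) \<and>
     L2_normsq M R_asri \<le> L2_normsq M R_wl \<and>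
     (odd n \<longrightarrow>
        (\<forall>(Z :: (letter list, real) poly_mapping \<Rightarrow> (letter list, real) poly_mapping) (R :: real \<Rightarrow> 'a \<Rightarrow> real^'n).
           linear Z \<and> Z ` word_space A \<subseteq> word_space A \<and>
           (\<forall>w\<in>words_of_length A (n + 1). reversal (Z (word w)) = Z (word w)) \<and>
           (\<forall>\<epsilon>. L2_has_sum M
              (\<lambda>w \<omega>. (1/2 * (I w t \<omega> - poly_integral I (sign_reversal (word w)) t \<omega>)
                          + \<epsilon> * poly_integral I (Z (word w)) t \<omega>) *\<^sub>R word_field Vt w (y0 \<omega>))
              (words_of_length A (n + 1)) (R \<epsilon>)) \<longrightarrow>
           (\<forall>\<epsilon>. L2_normsq M (R 0) - L2_normsq M R_wl \<le> L2_normsq M (R \<epsilon>) - L2_normsq M R_wl)))"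
proof -
  interpret levy_noise M F d l W \<rho> Q J by fact
  have noise': "ito_noise M F A (letter_process d W J) noise_cov"
    using alphabet_noise_letters unfolding alphabet by (rule ito_noise_letters)
  interpret ito_words M F A "letter_process d W J" noise_cov I
    by (intro ito_words.intro ito_words_axioms.intro noise' iterated)
  have t: "0 \<le> t" using time by simp
  let ?f = "\<lambda>w \<omega>. I w t \<omega> *\<^sub>R word_field Vt w (y0 \<omega>)"
  have ser: "word_series M A ?f 0 (y t)" using expansion time by (simp add: separated_expansion_def)
  have yt: "L2 M (y t)" using ser by (auto simp: word_series_def L2_tendsto_def)
  have L2_sum_limit: "L2 M X" if "L2_has_sum M f B X" for f :: "letter list \<Rightarrow> 'a \<Rightarrow> real^'n" and B X
    using that by (auto simp: L2_has_sum_def L2_tendsto_def)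
  have field: "(\<lambda>\<omega>. word_field Vt w (y0 \<omega>)) \<in> borel_measurable (F 0)" if "w \<in> lists A" for w
    using expansion that measurable_compose[OF initial(1)] by (auto simp: separated_expansion_def)
  let ?L = "words_of_length A (n + 1)"
  have L: "w \<in> lists A" "length w = n + 1" if "w \<in> ?L" for w using that by (auto simp: words_of_length_def)
  have word_in: "word w \<in> word_space A" if "w \<in> lists A" for w
    using that by (auto simp: word_space_def word_def)

  have tail_wl: "word_series M A ?f (n + 2) (\<lambda>\<omega>. (y t \<omega> - Y_wl \<omega>) - R_wl \<omega>)"
  proof (rule word_series_tail[OF ser _ leading_wl])
    show head: "L2_has_sum M ?f {w \<in> lists A. length w \<le> n} Y_wl" using taylor by (simp add: taylor_scheme_def)
    show "(\<lambda>\<omega>. (y t \<omega> - Y_wl \<omega>) - R_wl \<omega>) \<in> borel_measurable M"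
      by (intro L2_measurable L2_diff yt L2_sum_limit[OF head] L2_sum_limit[OF leading_wl])
  qed simp

  obtain Y1 Y2 where Y1: "taylor_scheme M A I Vt n t y0 Y1"
    and Y2: "L2_has_sum M (\<lambda>w \<omega>. (1/2 * poly_integral I (word w + sign_reversal (word w)) t \<omega>) *\<^sub>R
                     word_field Vt w (y0 \<omega>)) ?L Y2"
    and Y_asri: "Y_asri = (\<lambda>\<omega>. Y1 \<omega> + Y2 \<omega>)"
    using asri by (auto simp: asri_scheme_def)
  have tail_asri: "word_series M A ?f (n + 2) (\<lambda>\<omega>. (y t \<omega> - Y_asri \<omega>) - R_asri \<omega>)"
  proof (rule word_series_tail[OF ser _ leading_wl])
    show head: "L2_has_sum M ?f {w \<in> lists A. length w \<le> n} Y1" using Y1 by (simp add: taylor_scheme_def)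
    show "(\<lambda>\<omega>. (y t \<omega> - Y_asri \<omega>) - R_asri \<omega>) \<in> borel_measurable M"
      unfolding Y_asri
      by (intro L2_measurable L2_diff L2_add yt L2_sum_limit[OF head] L2_sum_limit[OF Y2] L2_sum_limit[OF leading_asri])
    \<comment> \<open>The half \<open>(id + S)/2\<close> kept by the scheme and the half
      \<open>(id - S)/2\<close> left in the remainder add up to the identity. Hence the extra terms
      of the scheme plus \<open>R_asri\<close> reproduce \<open>R_wl\<close> up to a null set, and
      both schemes have the same tail.\<close>
    have "(1/2 * poly_integral I (word w + sign_reversal (word w)) t \<omega>) *\<^sub>R word_field Vt w (y0 \<omega>) +
        (1/2 * (I w t \<omega> - poly_integral I (sign_reversal (word w)) t \<omega>)) *\<^sub>R word_field Vt w (y0 \<omega>) = ?f w \<omega>" for w \<omega>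
      unfolding poly_integral_add poly_integral_word scaleR_add_left[symmetric] by (simp add: field_simps)
    with L2_has_sum_add[OF Y2 leading_asri] have "L2_has_sum M ?f ?L (\<lambda>\<omega>. Y2 \<omega> + R_asri \<omega>)" by simp
    from L2_has_sum_unique[OF this leading_wl]
    show "AE \<omega> in M. (y t \<omega> - Y_asri \<omega>) - R_asri \<omega> = y t \<omega> - Y1 \<omega> - R_wl \<omega>"
      unfolding Y_asri by eventually_elim (simp add: algebra_simps)
  qed

  have efficient: "L2_normsq M R_asri \<le> L2_normsq M R_wl"
  proof (rule L2_has_sum_normsq_le[OF leading_asri leading_wl])
    fix B assume B: "finite B" "B \<subseteq> ?L"
    have X: "L2 M (\<lambda>\<omega>. \<Sum>w\<in>B. poly_integral I (word w) t \<omega> *\<^sub>R word_field Vt w (y0 \<omega>))"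
      unfolding poly_integral_word using leading_wl B by (intro L2_sum) (auto simp: L2_has_sum_def)
    note rev = word_sum_reversal[OF B(1) word_in t field X]
    \<comment> \<open>All words in \<open>B\<close> have length \<open>n + 1\<close>, so the sign in
      the reversal is the common factor \<open>(- 1) ^ (n + 1)\<close>, whose square is one. This is
      why part (a) holds for both parities.\<close>
    have "(\<Sum>w\<in>B. (1/2 * (I w t \<omega> - poly_integral I (sign_reversal (word w)) t \<omega>)) *\<^sub>R word_field Vt w (y0 \<omega>)) =
        (1/2) *\<^sub>R ((\<Sum>w\<in>B. poly_integral I (word w) t \<omega> *\<^sub>R word_field Vt w (y0 \<omega>)) -
          (- 1) ^ (n + 1) *\<^sub>R (\<Sum>w\<in>B. poly_integral (\<lambda>x. I (rev x)) (word w) t \<omega> *\<^sub>R word_field Vt w (y0 \<omega>)))" for \<omega>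
      unfolding poly_integral_word poly_integral_sign_reversal scaleR_sum_right sum_subtractf[symmetric]
    proof (intro sum.cong refl)
      fix w assume "w \<in> B"
      then have "length w = n + 1" using B L by blast
      then show "(1/2 * (I w t \<omega> - (- 1) ^ length w * I (rev w) t \<omega>)) *\<^sub>R word_field Vt w (y0 \<omega>) =
          (1/2) *\<^sub>R (I w t \<omega> *\<^sub>R word_field Vt w (y0 \<omega>) -
            (- 1) ^ (n + 1) *\<^sub>R I (rev w) t \<omega> *\<^sub>R word_field Vt w (y0 \<omega>))"
        by (simp only: scaleR_scaleR flip: scaleR_diff_left)
    qed
    then show "L2_normsq M (\<lambda>\<omega>. \<Sum>w\<in>B. (1/2 * (I w t \<omega> - poly_integral I (sign_reversal (word w)) t \<omega>)) *\<^sub>R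
        word_field Vt w (y0 \<omega>)) \<le> L2_normsq M (\<lambda>\<omega>. \<Sum>w\<in>B. ?f w \<omega>)"
      using L2_normsq_half_diff_le[OF X rev, of "(- 1) ^ (n + 1)"] B L
      by (auto simp: poly_integral_word power_mult[symmetric])
  qed

  \<comment> \<open>The norm of \<open>R_wl\<close> does not depend on \<open>\<epsilon>\<close>, so
    minimising the difference amounts to minimising the norm of \<open>R \<epsilon>\<close>.\<close>
  have optimal: "L2_normsq M (R 0) \<le> L2_normsq M (R \<epsilon>)"
    if n: "odd n" and Z: "Z ` word_space A \<subseteq> word_space A"
      and Z_rev: "\<And>w. w \<in> ?L \<Longrightarrow> reversal (Z (word w)) = Z (word w)"
      and R: "\<And>\<epsilon>. L2_has_sum M
              (\<lambda>w \<omega>. (1/2 * (I w t \<omega> - poly_integral I (sign_reversal (word w)) t \<omega>)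
                          + \<epsilon> * poly_integral I (Z (word w)) t \<omega>) *\<^sub>R word_field Vt w (y0 \<omega>)) ?L (R \<epsilon>)"
    for Z and R :: "real \<Rightarrow> 'a \<Rightarrow> real^'n" and \<epsilon>
  proof (rule L2_has_sum_normsq_le[OF R R])
    fix B assume B: "finite B" "B \<subseteq> ?L"
    \<comment> \<open>The complete perturbed coefficient of \<open>w\<close> as one polynomial, to
      be reversed as a whole.\<close>
    define q where "q w = (1/2) *\<^sub>R word w + ((- 1/2) *\<^sub>R word (rev w) + \<epsilon> *\<^sub>R Z (word w))" for w
    have q_I: "poly_integral K (q w) t \<omega> = 1/2 * (K w t \<omega> - K (rev w) t \<omega>) + \<epsilon> * poly_integral K (Z (word w)) t \<omega>"
      for K :: "letter list \<Rightarrow> real \<Rightarrow> 'a \<Rightarrow> real" and w \<omega>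
      unfolding q_def poly_integral_add poly_integral_scaleR poly_integral_word by (simp add: algebra_simps)
    \<comment> \<open>Oddness of \<open>n\<close> enters here: the length \<open>n + 1\<close> is
      even, so signed reversal is plain reversal and \<open>(id - S)/2\<close> is the projection
      onto antisymmetric polynomials.\<close>
    have S_I: "poly_integral I (sign_reversal (word w)) t \<omega> = I (rev w) t \<omega>" if "w \<in> B" for w \<omega>
      using that B L n by (auto simp: poly_integral_sign_reversal)
    \<comment> \<open>The unperturbed part changes sign while the \<open>Z\<close> part is fixed, so
      half the difference below is free of \<open>Z\<close> for every
      \<open>\<epsilon>\<close>.\<close>
    have q_rev: "poly_integral (\<lambda>x. I (rev x)) (q w) t \<omega> =
        - (1/2 * (I w t \<omega> - I (rev w) t \<omega>)) + \<epsilon> * poly_integral I (Z (word w)) t \<omega>" if "w \<in> B" for w \<omega>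
      using Z_rev[of w] poly_integral_reversal[of I "Z (word w)" t \<omega>] that B(2)
      by (auto simp: q_I algebra_simps)
    have q_space: "q w \<in> word_space A" if "w \<in> B" for w
    proof -
      have "w \<in> lists A" using that B L by blast
      then have "Poly_Mapping.keys (Z (word w)) \<subseteq> lists A" "{w, rev w} \<subseteq> lists A"
        using Z word_in[of w] by (auto simp: word_space_def)
      moreover have "Poly_Mapping.keys (q w) \<subseteq> {w, rev w} \<union> Poly_Mapping.keys (Z (word w))"
        by (auto simp: q_def lookup_add lookup_minus lookup_scaleR_poly_mapping word_def lookup_single in_keys_iff when_def split: if_splits)
      ultimately show ?thesis unfolding word_space_def by blast
    qed
    have "L2 M (\<lambda>\<omega>. \<Sum>w\<in>B. (1/2 * (I w t \<omega> - poly_integral I (sign_reversal (word w)) t \<omega>)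
                          + \<epsilon> * poly_integral I (Z (word w)) t \<omega>) *\<^sub>R word_field Vt w (y0 \<omega>))"
      using R[of \<epsilon>] B by (intro L2_sum) (auto simp: L2_has_sum_def)
    then have X: "L2 M (\<lambda>\<omega>. \<Sum>w\<in>B. poly_integral I (q w) t \<omega> *\<^sub>R word_field Vt w (y0 \<omega>))"
      by (simp add: q_I S_I)
    note rev = word_sum_reversal[OF B(1) q_space t field X]
    have "(\<Sum>w\<in>B. (1/2 * (I w t \<omega> - poly_integral I (sign_reversal (word w)) t \<omega>)
                          + 0 * poly_integral I (Z (word w)) t \<omega>) *\<^sub>R word_field Vt w (y0 \<omega>)) =
        (1/2) *\<^sub>R ((\<Sum>w\<in>B. poly_integral I (q w) t \<omega> *\<^sub>R word_field Vt w (y0 \<omega>)) -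
          1 *\<^sub>R (\<Sum>w\<in>B. poly_integral (\<lambda>x. I (rev x)) (q w) t \<omega> *\<^sub>R word_field Vt w (y0 \<omega>)))" for \<omega>
      unfolding scaleR_sum_right sum_subtractf[symmetric]
    proof (intro sum.cong refl)
      fix w assume w: "w \<in> B"
      define a where "a = 1/2 * (I w t \<omega> - I (rev w) t \<omega>)"
      define b where "b = \<epsilon> * poly_integral I (Z (word w)) t \<omega>"
      show "(1/2 * (I w t \<omega> - poly_integral I (sign_reversal (word w)) t \<omega>)
               + 0 * poly_integral I (Z (word w)) t \<omega>) *\<^sub>R word_field Vt w (y0 \<omega>) =
          (1/2) *\<^sub>R (poly_integral I (q w) t \<omega> *\<^sub>R word_field Vt w (y0 \<omega>) -
            1 *\<^sub>R poly_integral (\<lambda>x. I (rev x)) (q w) t \<omega> *\<^sub>R word_field Vt w (y0 \<omega>))"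
        unfolding S_I[OF w] q_rev[OF w] unfolding q_I a_def[symmetric] b_def[symmetric]
        by (simp flip: scaleR_diff_left)
    qed
    then show "L2_normsq M (\<lambda>\<omega>. \<Sum>w\<in>B. (1/2 * (I w t \<omega> - poly_integral I (sign_reversal (word w)) t \<omega>)
                          + 0 * poly_integral I (Z (word w)) t \<omega>) *\<^sub>R word_field Vt w (y0 \<omega>)) \<le>
        L2_normsq M (\<lambda>\<omega>. \<Sum>w\<in>B. (1/2 * (I w t \<omega> - poly_integral I (sign_reversal (word w)) t \<omega>)
                          + \<epsilon> * poly_integral I (Z (word w)) t \<omega>) *\<^sub>R word_field Vt w (y0 \<omega>))"
      using L2_normsq_half_diff_le[OF X rev, of 1] B L by (auto simp: q_I S_I)
  qed
  show ?thesis
    using tail_wl tail_asri efficient optimal by auto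
qed

end
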